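(* There exists an algorithm that, on input of a diffusion instance $\mathcal G$ whose underlying graph $G$ has $n$ vertices and $m$ edges and whose VWFs have total size $O(S)$, a graph $H$ which is a $\kappa$-spectral sparsifier of $G$ with $\kappa\in[1,m]$, and an oracle $\mathcal O$ that can output $(1+n^{-c})$-approximate optimal potentials for an arbitrarily large constant $c>0$, outputs a $2$-approximated optimal potential for $\mathcal G$. The algorithm runs in time $$O\!\left(\sqrt{\kappa}\,\bigl(m+T(|E(H)|,O(S),1+n^{-c})\bigr)\right)$$ by making $O(\sqrt\kappa)$ oracle calls to $\mathcal O$ on diffusion instances based on the graph $H$.
   Context: Graphs are undirected multigraphs with positive edge conductances; $L(G)$ is the weighted Laplacian; $A\preceq B$ means $B-A$ is positive semidefinite. $H$ is a $\kappa$-spectral sparsifier of $G$ if both have the same vertex set and $L(G)\preceq L(H)\preceq\kappa L(G)$. Vertex weighting function (VWF): a continuous convex function $f$ with domain $[L,\infty)$, $L\le 0$, is a VWF of size $k$ (written $|f|=k$) if (i) $f(0)\le 0$; (ii) $f$ is piecewise quadratic with split points $L=s_0,s_1,\dots,s_k=\infty$; (iii) $f'$ is continuous, concave, and constant for $x\ge s_{k-1}$. A diffusion instance is a tuple $\mathcal G=(G,f^{\mathcal G},b^{\mathcal G})$ where $G=(V,E,c)$ is a graph, $f^{\mathcal G}=\{f_u\}_{u\in V}$ is a family of VWFs, and $b^{\mathcal G}\in\mathbb R^V_{\le 0}$. A potential $x\in\mathbb R^V$ is feasible if $x\ge b^{\mathcal G}$; its energy is $\mathcal E^{\mathcal G}(x)=\frac12x^\top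 L(G)x+\sum_{u}f_u(x_u)$, and $\mathcal E(\mathcal G)=\min_{x\ge b^{\mathcal G}}\mathcal E^{\mathcal G}(x)$ (which is $\le0$). For $\kappa\ge 1$, a feasible $x$ is a $\kappa$-approximated optimal potential if $\mathcal E^{\mathcal G}(x)\le\frac1\kappa\mathcal E(\mathcal G)$. $T(m,S,\kappa)$ denotes the time to compute a $\kappa$-approximated optimal potential, with probability at least $1-n^{-10}$, for a diffusion instance with $m$ edges and total VWF size $S$. Standing assumption: every number encountered is zero or has absolute value in $[n^{-c_0},n^{c_0}]$ for some universal constant $c_0>0$. *)

theory Defs
  imports "HOL-Probability.Probability"
begin

section \<open>Multigraphs, Laplacians and spectral sparsifiers\<close>

text \<open>The vertices are \<open>0, \<dots>, verts G - 1\<close>; an edge \<open>(u, v, w)\<close> joins \<open>u\<close> and \<open>v\<close> and has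
  conductance \<open>w\<close>. Parallel edges are repeated list entries.\<close>

record wgraph =
  verts :: nat
  edges :: "(nat \<times> nat \<times> real) list"

definition wf_graph :: "wgraph \<Rightarrow> bool" where
  "wf_graph G \<longleftrightarrow> verts G > 0 \<and>
     (\<forall>(u, v, w) \<in> set (edges G). u < verts G \<and> v < verts G \<and> u \<noteq> v \<and> w > 0)"

definition num_edges :: "wgraph \<Rightarrow> nat" where
  "num_edges G = length (edges G)"

definition laplacian :: "wgraph \<Rightarrow> nat \<Rightarrow> nat \<Rightarrow> real" where
  "laplacian G i j =
     (if i = j then (\<Sum>(u, v, w) \<leftarrow> edges G. if i = u \<or> i = v then w else 0)
      else - (\<Sum>(u, v, w) \<leftarrow> edges G. if (i, j) = (u, v) \<or> (i, j) = (v, u) then w else 0))"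

definition quad_form :: "nat \<Rightarrow> (nat \<Rightarrow> nat \<Rightarrow> real) \<Rightarrow> (nat \<Rightarrow> real) \<Rightarrow> real" where
  "quad_form n A x = (\<Sum>i<n. \<Sum>j<n. x i * A i j * x j)"

definition loewner_le :: "nat \<Rightarrow> (nat \<Rightarrow> nat \<Rightarrow> real) \<Rightarrow> (nat \<Rightarrow> nat \<Rightarrow> real) \<Rightarrow> bool" where
  "loewner_le n A B \<longleftrightarrow> (\<forall>x. 0 \<le> quad_form n (\<lambda>i j. B i j - A i j) x)"

definition spectral_sparsifier :: "real \<Rightarrow> wgraph \<Rightarrow> wgraph \<Rightarrow> bool" where
  "spectral_sparsifier \<kappa> G H \<longleftrightarrow> verts H = verts G \<and>
     loewner_le (verts G) (laplacian G) (laplacian H) \<and>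
     loewner_le (verts G) (laplacian H) (\<lambda>i j. \<kappa> * laplacian G i j)"


section \<open>Vertex weighting functions\<close>

text \<open>\<open>vwf s f\<close>: \<open>f\<close>, restricted to \<open>[hd s, \<infinity>)\<close>, is a VWF whose finite split points are the
  entries of \<open>s\<close>. The last split point \<open>\<infinity>\<close> is not listed, so the size is \<open>length s\<close>.
  Values of \<open>f\<close> to the left of \<open>hd s\<close> are irrelevant.\<close>

definition vwf :: "real list \<Rightarrow> (real \<Rightarrow> real) \<Rightarrow> bool" where
  "vwf s f \<longleftrightarrow> s \<noteq> [] \<and> sorted_wrt (<) s \<and> hd s \<le> 0 \<and>
     continuous_on {hd s..} f \<and> convex_on {hd s..} f \<and>
     f 0 \<le> 0 \<and>
     (\<forall>i<length s. \<exists>p q r. \<forall>x \<ge> s ! i. (Suc i < length s \<longrightarrow> x \<le> s ! Suc i) \<longrightarrow>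
        f x = p * x\<^sup>2 + q * x + r) \<and>
     (\<exists>f'. (\<forall>x \<ge> hd s. (f has_real_derivative f' x) (at x within {hd s..})) \<and>
        continuous_on {hd s..} f' \<and> concave_on {hd s..} f' \<and>
        (\<forall>x \<ge> last s. f' x = f' (last s)))"

text \<open>An algorithm receives a VWF as its list of pieces \<open>(s, p, q, r)\<close>: from the split point \<open>s\<close>
  up to the next one the function is \<open>x \<mapsto> p x\<^sup>2 + q x + r\<close>.\<close>

type_synonym pieces = "(real \<times> real \<times> real \<times> real) list"

definition splits :: "pieces \<Rightarrow> real list" where
  "splits ps = map fst ps"

definition piecewise :: "pieces \<Rightarrow> real \<Rightarrow> real" where
  "piecewise ps x = (case last (filter (\<lambda>(s, _). s \<le> x) ps) of (_, p, q, r) \<Rightarrow> p * x\<^sup>2 + q * x + r)"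


section \<open>Diffusion instances\<close>

record diffusion =
  graph :: wgraph
  weights :: "pieces list"
  bound :: "real list"

abbreviation num_verts :: "diffusion \<Rightarrow> nat" where
  "num_verts D \<equiv> verts (graph D)"

definition total_size :: "diffusion \<Rightarrow> nat" where
  "total_size D = (\<Sum>ps \<leftarrow> weights D. length ps)"

text \<open>A potential is a function on \<open>nat\<close> of which only the values at \<open>u < num_verts D\<close> matter. It has to
  lie in the domains of the VWFs as well (equivalently, a VWF is \<open>+\<infinity>\<close> outside its domain).\<close>

definition feasible :: "diffusion \<Rightarrow> (nat \<Rightarrow> real) \<Rightarrow> bool" where
  "feasible D x \<longleftrightarrow> (\<forall>u < num_verts D. bound D ! u \<le> x u \<and> hd (splits (weights D ! u)) \<le> x u)"

definition energy :: "diffusion \<Rightarrow> (nat \<Rightarrow> real) \<Rightarrow> real" where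
  "energy D x = quad_form (num_verts D) (laplacian (graph D)) x / 2
     + (\<Sum>u < num_verts D. piecewise (weights D ! u) (x u))"

definition opt_energy :: "diffusion \<Rightarrow> real" where
  "opt_energy D = energy D (arg_min (energy D) (feasible D))"

text \<open>The existence of the minimum is part of the notion: e.g. for \<open>f\<^sub>u(x) = - x\<close> at all vertices
  the energy is unbounded below.\<close>

definition diffusion_instance :: "diffusion \<Rightarrow> bool" where
  "diffusion_instance D \<longleftrightarrow> wf_graph (graph D) \<and>
     length (weights D) = num_verts D \<and> (\<forall>ps \<in> set (weights D). vwf (splits ps) (piecewise ps)) \<and>
     length (bound D) = num_verts D \<and> (\<forall>b \<in> set (bound D). b \<le> 0) \<and>
     (\<exists>x. is_arg_min (energy D) (feasible D) x)"

definition approx_optimal :: "real \<Rightarrow> diffusion \<Rightarrow> (nat \<Rightarrow> real) \<Rightarrow> bool" where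
  "approx_optimal \<kappa> D x \<longleftrightarrow> feasible D x \<and> energy D x \<le> opt_energy D / \<kappa>"

text \<open>The numbers describing an input \<open>(D, H, \<kappa>)\<close>, and the standing assumption that each of them is
  zero or of absolute value between \<open>n\<^sup>-\<^sup>c\<close> and \<open>n\<^sup>c\<close>.\<close>

definition input_numbers :: "diffusion \<Rightarrow> wgraph \<Rightarrow> real \<Rightarrow> real set" where
  "input_numbers D H \<kappa> = {real (num_edges (graph D)), \<kappa>}
     \<union> (\<Union>(u, v, w) \<in> set (edges (graph D)) \<union> set (edges H). {w})
     \<union> (\<Union>ps \<in> set (weights D). \<Union>(s, p, q, r) \<in> set ps. {s, p, q, r})
     \<union> set (bound D)"

definition poly_bounded :: "real \<Rightarrow> nat \<Rightarrow> real set \<Rightarrow> bool" where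
  "poly_bounded c n A \<longleftrightarrow>
     (\<forall>a \<in> A. a = 0 \<or> real n powr - c \<le> \<bar>a\<bar> \<and> \<bar>a\<bar> \<le> real n powr c)"


section \<open>Real RAM programs with calls to a diffusion solver\<close>

text \<open>The memory consists of arrays of natural numbers (for indices and counters, with addition and
  truncated subtraction only) and arrays of reals (with the field operations and comparison, and
  without rounding). A scalar is an array used at index 0 only. Array names are static, so that a
  program uses finitely many arrays. There are no real literals, hence a program is a finite
  object containing no real-valued advice.\<close>

datatype nexp =
    NConst nat
  | NRead nat nexp
  | NAdd nexp nexp
  | NSub nexp nexp

datatype rexp =
    ROfNat nexp
  | RRead nat nexp
  | RAdd rexp rexp
  | RSub rexp rexp
  | RMul rexp rexp
  | RDiv rexp rexp

datatype bexp =
    NLess nexp nexp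
  | RLess rexp rexp
  | BNot bexp
  | BAnd bexp bexp

text \<open>\<open>NWrite a i e\<close> and \<open>RWrite a i e\<close> assign \<open>e\<close> to the \<open>i\<close>-th entry of array \<open>a\<close>. \<open>Call a z\<close> asks
  the solver for a potential of the diffusion instance stored at \<open>a\<close> (see below) and has the answer
  stored in the real array \<open>z\<close>.\<close>

datatype prog =
    Skip
  | NWrite nat nexp nexp
  | RWrite nat nexp rexp
  | Seq prog prog
  | Cond bexp prog prog
  | While bexp prog
  | Call nat nat

text \<open>Besides the memory, a configuration records the time spent and the solver calls made so far,
  as pairs of a query and its answer.\<close>

record config =
  nmem :: "nat \<Rightarrow> nat \<Rightarrow> nat"
  rmem :: "nat \<Rightarrow> nat \<Rightarrow> real"
  time :: real
  calls :: "(diffusion \<times> (nat \<Rightarrow> real)) list"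

fun nval :: "nexp \<Rightarrow> config \<Rightarrow> nat" where
  "nval (NConst k) \<sigma> = k"
| "nval (NRead a i) \<sigma> = nmem \<sigma> a (nval i \<sigma>)"
| "nval (NAdd e e') \<sigma> = nval e \<sigma> + nval e' \<sigma>"
| "nval (NSub e e') \<sigma> = nval e \<sigma> - nval e' \<sigma>"

fun rval :: "rexp \<Rightarrow> config \<Rightarrow> real" where
  "rval (ROfNat i) \<sigma> = real (nval i \<sigma>)"
| "rval (RRead a i) \<sigma> = rmem \<sigma> a (nval i \<sigma>)"
| "rval (RAdd e e') \<sigma> = rval e \<sigma> + rval e' \<sigma>"
| "rval (RSub e e') \<sigma> = rval e \<sigma> - rval e' \<sigma>"
| "rval (RMul e e') \<sigma> = rval e \<sigma> * rval e' \<sigma>"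
| "rval (RDiv e e') \<sigma> = rval e \<sigma> / rval e' \<sigma>"

fun bval :: "bexp \<Rightarrow> config \<Rightarrow> bool" where
  "bval (NLess e e') \<sigma> \<longleftrightarrow> nval e \<sigma> < nval e' \<sigma>"
| "bval (RLess e e') \<sigma> \<longleftrightarrow> rval e \<sigma> < rval e' \<sigma>"
| "bval (BNot b) \<sigma> \<longleftrightarrow> \<not> bval b \<sigma>"
| "bval (BAnd b b') \<sigma> \<longleftrightarrow> bval b \<sigma> \<and> bval b' \<sigma>"

text \<open>Unit costs: one time step for each operation, memory access and constant.\<close>

fun ncost :: "nexp \<Rightarrow> nat" where
  "ncost (NConst k) = 1"
| "ncost (NRead a i) = 1 + ncost i"
| "ncost (NAdd e e') = 1 + ncost e + ncost e'"
| "ncost (NSub e e') = 1 + ncost e + ncost e'"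

fun rcost :: "rexp \<Rightarrow> nat" where
  "rcost (ROfNat i) = 1 + ncost i"
| "rcost (RRead a i) = 1 + ncost i"
| "rcost (RAdd e e') = 1 + rcost e + rcost e'"
| "rcost (RSub e e') = 1 + rcost e + rcost e'"
| "rcost (RMul e e') = 1 + rcost e + rcost e'"
| "rcost (RDiv e e') = 1 + rcost e + rcost e'"

fun bcost :: "bexp \<Rightarrow> nat" where
  "bcost (NLess e e') = 1 + ncost e + ncost e'"
| "bcost (RLess e e') = 1 + rcost e + rcost e'"
| "bcost (BNot b) = 1 + bcost b"
| "bcost (BAnd b b') = 1 + bcost b + bcost b'"

text \<open>Memory layout of a graph at base \<open>a\<close>: natural arrays \<open>a\<close> (number of vertices), \<open>a + 1\<close> (number
  of edges), \<open>a + 2\<close> and \<open>a + 3\<close> (end points); real array \<open>a\<close> (conductances). A diffusion instance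
  has in addition the pieces of all VWFs in the real arrays \<open>a + 1, \<dots>, a + 4\<close>, those of vertex \<open>u\<close>
  at the indices from \<open>off u\<close> to \<open>off (u + 1) - 1\<close> where \<open>off\<close> is the natural array \<open>a + 4\<close>, and the
  lower bounds in the real array \<open>a + 5\<close>.\<close>

definition stored_graph :: "config \<Rightarrow> nat \<Rightarrow> wgraph" where
  "stored_graph \<sigma> a = \<lparr>
     verts = nmem \<sigma> a 0,
     edges = map (\<lambda>e. (nmem \<sigma> (a + 2) e, nmem \<sigma> (a + 3) e, rmem \<sigma> a e)) [0..<nmem \<sigma> (a + 1) 0]\<rparr>"

definition stored_diffusion :: "config \<Rightarrow> nat \<Rightarrow> diffusion" where
  "stored_diffusion \<sigma> a = \<lparr>
     graph = stored_graph \<sigma> a,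
     weights = map (\<lambda>u. map (\<lambda>j. (rmem \<sigma> (a + 1) j, rmem \<sigma> (a + 2) j, rmem \<sigma> (a + 3) j, rmem \<sigma> (a + 4) j))
       [nmem \<sigma> (a + 4) u ..< nmem \<sigma> (a + 4) (Suc u)]) [0..<nmem \<sigma> a 0],
     bound = map (rmem \<sigma> (a + 5)) [0..<nmem \<sigma> a 0]\<rparr>"

definition tick :: "nat \<Rightarrow> config \<Rightarrow> config" where
  "tick k \<sigma> = \<sigma>\<lparr>time := time \<sigma> + real k\<rparr>"

definition answer_call ::
    "(diffusion \<Rightarrow> real) \<Rightarrow> nat \<Rightarrow> nat \<Rightarrow> (nat \<Rightarrow> real) \<Rightarrow> config \<Rightarrow> config" where
  "answer_call charge a z x \<sigma> = (let D = stored_diffusion \<sigma> a in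
     \<sigma>\<lparr>rmem := (rmem \<sigma>)(z := (\<lambda>u. if u < num_verts D then x u else rmem \<sigma> z u)),
       time := time \<sigma> + charge D,
       calls := calls \<sigma> @ [(D, x)]\<rparr>)"

text \<open>The solver may be randomized: \<open>solve D\<close> is the distribution of its answer to the query \<open>D\<close>,
  drawn afresh in every call, and \<open>charge D\<close> is the time charged for such a call. The execution of
  a program is therefore a distribution as well; \<open>k\<close> bounds the number of loop
  iterations, \<open>None\<close> stands for a computation cut off by this bound, and a run without \<open>None\<close> is not
  affected by increasing \<open>k\<close>.\<close>

fun exec ::
    "(diffusion \<Rightarrow> real) \<Rightarrow> (diffusion \<Rightarrow> (nat \<Rightarrow> real) pmf) \<Rightarrow> nat \<Rightarrow> prog \<Rightarrow> config
      \<Rightarrow> config option pmf" where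
  "exec charge solve k Skip \<sigma> = return_pmf (Some (tick 1 \<sigma>))"
| "exec charge solve k (NWrite a i e) \<sigma> = return_pmf (Some (tick (1 + ncost i + ncost e)
     (\<sigma>\<lparr>nmem := (nmem \<sigma>)(a := (nmem \<sigma> a)(nval i \<sigma> := nval e \<sigma>))\<rparr>)))"
| "exec charge solve k (RWrite a i e) \<sigma> = return_pmf (Some (tick (1 + ncost i + rcost e)
     (\<sigma>\<lparr>rmem := (rmem \<sigma>)(a := (rmem \<sigma> a)(nval i \<sigma> := rval e \<sigma>))\<rparr>)))"
| "exec charge solve k (Seq c c') \<sigma> =
     bind_pmf (exec charge solve k c \<sigma>) (\<lambda>r. case r of None \<Rightarrow> return_pmf None
       | Some \<sigma>' \<Rightarrow> exec charge solve k c' \<sigma>')"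
| "exec charge solve k (Cond b c c') \<sigma> =
     (if bval b \<sigma> then exec charge solve k c (tick (1 + bcost b) \<sigma>)
      else exec charge solve k c' (tick (1 + bcost b) \<sigma>))"
| "exec charge solve 0 (While b c) \<sigma> = return_pmf None"
| "exec charge solve (Suc k) (While b c) \<sigma> =
     (if bval b \<sigma>
      then bind_pmf (exec charge solve k c (tick (1 + bcost b) \<sigma>)) (\<lambda>r. case r of
          None \<Rightarrow> return_pmf None
        | Some \<sigma>' \<Rightarrow> exec charge solve k (While b c) \<sigma>')
      else return_pmf (Some (tick (1 + bcost b) \<sigma>)))"
| "exec charge solve k (Call a z) \<sigma> =
     map_pmf (\<lambda>x. Some (answer_call charge a z x (tick 1 \<sigma>))) (solve (stored_diffusion \<sigma> a))"

text \<open>Input and output conventions. Nothing is assumed about the remaining memory.\<close>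

definition input_config :: "diffusion \<Rightarrow> wgraph \<Rightarrow> real \<Rightarrow> config \<Rightarrow> bool" where
  "input_config D H \<kappa> \<sigma> \<longleftrightarrow> stored_diffusion \<sigma> 0 = D \<and> stored_graph \<sigma> 6 = H \<and> rmem \<sigma> 7 0 = \<kappa> \<and>
     time \<sigma> = 0 \<and> calls \<sigma> = []"

definition result :: "config \<Rightarrow> nat \<Rightarrow> real" where
  "result \<sigma> = rmem \<sigma> 8"

lemma concat_segment:
  assumes "u < length xss"
  shows "map ((!) (concat xss))
    [length (concat (take u xss)) ..< length (concat (take (Suc u) xss))] = xss ! u"
proof -
  have *: "concat xss = concat (take u xss) @ xss ! u @ concat (drop (Suc u) xss)"
    using assms id_take_nth_drop[of u xss] by (metis concat.simps(2) concat_append)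
  have "length (concat (take (Suc u) xss)) = length (concat (take u xss)) + length (xss ! u)"
    using assms by (simp add: take_Suc_conv_app_nth)
  then show ?thesis
    by (intro nth_equalityI) (auto simp: * nth_append)
qed

lemma input_config_exists:
  assumes "length (weights D) = num_verts D" "length (bound D) = num_verts D"
  shows "\<exists>\<sigma>. input_config D H \<kappa> \<sigma>"
proof -
  let ?E = "edges (graph D)" and ?F = "edges H" and ?w = "concat (weights D)"
  define \<sigma> where "\<sigma> = \<lparr>
    nmem = (\<lambda>a i. [num_verts D, length ?E, fst (?E ! i), fst (snd (?E ! i)),
      length (concat (take i (weights D))), 0,
      verts H, length ?F, fst (?F ! i), fst (snd (?F ! i))] ! a),
    rmem = (\<lambda>a i. [snd (snd (?E ! i)), fst (?w ! i), fst (snd (?w ! i)), fst (snd (snd (?w ! i))),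
      snd (snd (snd (?w ! i))), bound D ! i, snd (snd (?F ! i)), \<kappa>] ! a),
    time = 0, calls = []\<rparr>"
  have G: "stored_graph \<sigma> 0 = graph D" and H: "stored_graph \<sigma> 6 = H"
    by (auto simp: stored_graph_def \<sigma>_def map_nth intro!: wgraph.equality)
  have "map (\<lambda>u. map ((!) ?w) [length (concat (take u (weights D))) ..<
      length (concat (take (Suc u) (weights D)))]) [0..<num_verts D] = weights D"
    using assms(1) by (intro nth_equalityI) (auto simp: concat_segment simp del: length_concat)
  then have "stored_diffusion \<sigma> 0 = D"
    using G assms(2) map_nth[of "bound D"]
    by (auto simp: stored_diffusion_def \<sigma>_def simp del: length_concat intro!: diffusion.equality)
  with H show ?thesis
    by (intro exI[of _ \<sigma>]) (simp add: input_config_def, simp add: \<sigma>_def)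
qed


section \<open>The solver and its running time\<close>

definition accuracy :: "real \<Rightarrow> nat \<Rightarrow> real" where
  "accuracy c n = 1 + real n powr - c"

text \<open>On an instance with \<open>n\<close> vertices, a \<open>(1 + n\<^sup>-\<^sup>c)\<close>-approximated optimal potential is returned
  with probability at least \<open>1 - n\<^sup>-\<^sup>1\<^sup>0\<close>.\<close>

definition approx_solver :: "real \<Rightarrow> (diffusion \<Rightarrow> (nat \<Rightarrow> real) pmf) \<Rightarrow> bool" where
  "approx_solver c solve \<longleftrightarrow> (\<forall>D. diffusion_instance D \<longrightarrow>
     measure_pmf.prob (solve D) {x. approx_optimal (accuracy c (num_verts D)) D x}
       \<ge> 1 - 1 / real (num_verts D) ^ 10)"

definition call_time :: "(nat \<Rightarrow> nat \<Rightarrow> real \<Rightarrow> real) \<Rightarrow> real \<Rightarrow> diffusion \<Rightarrow> real" where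
  "call_time T c D = T (num_edges (graph D)) (total_size D) (accuracy c (num_verts D))"

text \<open>\<open>T m S \<delta>\<close> is a worst-case time over the instances with \<open>m\<close> edges and total VWF size (at most)
  \<open>S\<close>. It includes the time for reading the instance, which consists of more than \<open>m + S\<close>
  numbers.\<close>

definition solver_time :: "(nat \<Rightarrow> nat \<Rightarrow> real \<Rightarrow> real) \<Rightarrow> bool" where
  "solver_time T \<longleftrightarrow> (\<forall>m S \<delta>. real (m + S) \<le> T m S \<delta>) \<and>
     (\<forall>m S S' \<delta>. S \<le> S' \<longrightarrow> T m S \<delta> \<le> T m S' \<delta>)"

end

theory Submission
  imports Defs
begin

text \<open>The algorithm is Nesterov's accelerated proximal point method in the seminorm of
  \<open>M = L(H) - L(G)\<close>. Expanding \<open>\<parallel>x - y\<parallel>\<^sub>M\<^sup>2 / 2\<close> shows that a proximal step from \<open>y\<close> minimises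
  \<open>x\<^sup>T L(H) x / 2 + \<Sum>\<^sub>u (f\<^sub>u(x\<^sub>u) + l\<^sub>u x\<^sub>u)\<close> with \<open>l = (L(G) - L(H)) y\<close>, which is a diffusion instance on \<open>H\<close>.
  As \<open>\<parallel>x\<parallel>\<^sub>M\<^sup>2 \<le> (\<kappa> - 1) x\<^sup>T L(G) x\<close> and the optimal potential \<open>x\<^sup>*\<close> satisfies
  \<open>x\<^sup>*\<^sup>T L(G) x\<^sup>* = O(\<bar>\<E>\<bar>)\<close>, the gap after \<open>k\<close> steps is \<open>O(\<kappa> / k\<^sup>2) \<bar>\<E>\<bar>\<close>, and \<open>O(\<surd>\<kappa>)\<close> steps suffice. The strong
  convexity of the energy with respect to \<open>L(G)\<close> absorbs the inexactness of the steps: the errors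
  only add up, and their sum is negligible because they are \<open>n\<^sup>-\<^sup>c\<close> times a polynomial in \<open>\<kappa>\<close>.

  Even after a wrong answer the next query has to attain its minimum. It is bounded below because
  the energy of \<open>G\<close> is, and a Frank-Wolfe type argument yields a minimiser.\<close>

section \<open>Dirichlet forms and energies\<close>

text \<open>Plain proximal steps would only give a gap of O(\<kappa> / k); acceleration is what
  brings the number of steps down to O(sqrt \<kappa>). The delicate point is that the solver is
  accurate relative to the optimum of the query, not of \<open>D\<close>. That optimum is at least
  \<open>opt_energy D - qM y / 2\<close>, so an error is proportional to the optimum of
  \<open>D\<close> only while the extrapolated points stay bounded, and it is the potential function
  itself that keeps them bounded. The program neither draws random numbers nor inspects the answers.
  Hence the analysis separates two claims: every run, whatever is answered, respects the bounds on
  time and calls, and its output is good provided that all recorded answers are. Probability enters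
  only at the end, through a union bound over the calls. Work proportional to the number of vertices
  is charged to the total VWF size, since every VWF has at least one piece; a disconnected graph may
  have fewer edges than vertices.\<close>

definition edge_src :: "wgraph \<Rightarrow> nat \<Rightarrow> nat" where
  "edge_src G e = fst (edges G ! e)"

definition edge_tgt :: "wgraph \<Rightarrow> nat \<Rightarrow> nat" where
  "edge_tgt G e = fst (snd (edges G ! e))"

definition conductance :: "wgraph \<Rightarrow> nat \<Rightarrow> real" where
  "conductance G e = snd (snd (edges G ! e))"

text \<open>The bilinear form \<open>x\<^sup>T L(G) y\<close>.\<close>

definition dirichlet :: "wgraph \<Rightarrow> (nat \<Rightarrow> real) \<Rightarrow> (nat \<Rightarrow> real) \<Rightarrow> real" where
  "dirichlet G x y = (\<Sum>e<num_edges G. conductance G e *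
     (x (edge_src G e) - x (edge_tgt G e)) * (y (edge_src G e) - y (edge_tgt G e)))"

lemma wf_graphD:
  assumes "wf_graph G" "e < num_edges G"
  shows "edge_src G e < verts G" "edge_tgt G e < verts G" "edge_src G e \<noteq> edge_tgt G e"
    "conductance G e > 0"
proof -
  have "edges G ! e \<in> set (edges G)"
    using assms by (simp add: num_edges_def)
  then show "edge_src G e < verts G" "edge_tgt G e < verts G" "edge_src G e \<noteq> edge_tgt G e"
    "conductance G e > 0"
    using assms by (auto simp: wf_graph_def edge_src_def edge_tgt_def conductance_def)
qed

lemma dirichlet_cong:
  assumes "wf_graph G" "\<And>u. u < verts G \<Longrightarrow> x u = x' u" "\<And>u. u < verts G \<Longrightarrow> y u = y' u"
  shows "dirichlet G x y = dirichlet G x' y'"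
  unfolding dirichlet_def using assms wf_graphD(1,2)[OF assms(1)] by (intro sum.cong) auto

lemma dirichlet_lincomb:
  "dirichlet G (\<lambda>u. a * x u + b * y u) (\<lambda>u. a * x u + b * y u) =
     a\<^sup>2 * dirichlet G x x + 2 * a * b * dirichlet G x y + b\<^sup>2 * dirichlet G y y"
  unfolding dirichlet_def sum_distrib_left sum.distrib[symmetric]
  by (intro sum.cong) (auto simp: algebra_simps power2_eq_square)

lemma dirichlet_sym: "dirichlet G x y = dirichlet G y x"
  by (simp add: dirichlet_def mult_ac)

lemma dirichlet_nonneg: "wf_graph G \<Longrightarrow> dirichlet G x x \<ge> 0"
  unfolding dirichlet_def mult.assoc
  by (intro sum_nonneg mult_nonneg_nonneg zero_le_square) (auto intro: less_imp_le wf_graphD(4))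

lemma dirichlet_diff:
  "dirichlet G (\<lambda>u. x u - y u) (\<lambda>u. x u - y u) =
     dirichlet G x x - 2 * dirichlet G x y + dirichlet G y y"
  using dirichlet_lincomb[of G 1 x "-1" y] by simp

lemma quad_form_diff:
  "quad_form n (\<lambda>i j. A i j - B i j) x = quad_form n A x - quad_form n B x"
  by (simp add: quad_form_def algebra_simps sum_subtractf)

lemma quad_form_add:
  "quad_form n (\<lambda>i j. A i j + B i j) x = quad_form n A x + quad_form n B x"
  by (simp add: quad_form_def algebra_simps sum.distrib)

lemma quad_form_scale: "quad_form n (\<lambda>i j. c * A i j) x = c * quad_form n A x"
  by (simp add: quad_form_def algebra_simps sum_distrib_left)

text \<open>An edge contributes the rank-one matrix w b b^T with b = e_u - e_v, so the double sum
  factors into a square.\<close>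

lemma quad_form_edge:
  assumes "u < n" "v < n"
  shows "quad_form n (\<lambda>i j. w * (of_bool (i = u) - of_bool (i = v)) *
    (of_bool (j = u) - of_bool (j = v))) x = w * (x u - x v)\<^sup>2"
proof -
  have "(\<Sum>i<n. x i * of_bool (i = k)) = (if k < n then x k else 0)" for k
    using sum.delta[of "{..<n}" k x] by (simp add: of_bool_def if_distrib[of "(*) _"] cong: if_cong)
  then have *: "(\<Sum>i<n. x i * (of_bool (i = u) - of_bool (i = v))) = x u - x v"
    using assms by (simp add: right_diff_distrib sum_subtractf)
  have "quad_form n (\<lambda>i j. w * (of_bool (i = u) - of_bool (i = v)) *
      (of_bool (j = u) - of_bool (j = v))) x
    = w * ((\<Sum>i<n. x i * (of_bool (i = u) - of_bool (i = v))) *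
        (\<Sum>j<n. x j * (of_bool (j = u) - of_bool (j = v))))"
    unfolding quad_form_def
    by (subst sum_product) (simp add: sum_distrib_left mult_ac)
  then show ?thesis
    by (simp only: * power2_eq_square)
qed

text \<open>The Laplacian is the sum of the rank-one matrices of its edges; a parallel edge is just
  another summand.\<close>

lemma quad_form_laplacian:
  assumes "wf_graph G"
  shows "quad_form (verts G) (laplacian G) x = dirichlet G x x"
proof -
  let ?n = "verts G"
  \<comment> \<open>The induction runs over the edge list alone; the vertex set, and with it the
    size of the matrix, stays that of \<open>G\<close>.\<close>
  have "quad_form ?n (laplacian (G\<lparr>edges := es\<rparr>)) x = (\<Sum>(u, v, w) \<leftarrow> es. w * (x u - x v)\<^sup>2)"
    if "\<forall>(u, v, w) \<in> set es. u < ?n \<and> v < ?n \<and> u \<noteq> v" for es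
    using that
  proof (induction es)
    case Nil
    have "laplacian (G\<lparr>edges := []\<rparr>) = (\<lambda>i j. 0)"
      by (auto simp: laplacian_def fun_eq_iff)
    then show ?case
      by (simp add: quad_form_def)
  next
    case (Cons e es)
    obtain u v w where e: "e = (u, v, w)"
      by (cases e)
    have "laplacian (G\<lparr>edges := e # es\<rparr>) = (\<lambda>i j. w * (of_bool (i = u) - of_bool (i = v)) *
        (of_bool (j = u) - of_bool (j = v)) + laplacian (G\<lparr>edges := es\<rparr>) i j)"
      using Cons.prems by (auto simp: laplacian_def e fun_eq_iff)
    then show ?case
      using Cons quad_form_edge[of u ?n v w x] by (simp add: quad_form_add e)
  qed
  moreover have "\<forall>(u, v, w) \<in> set (edges G). u < ?n \<and> v < ?n \<and> u \<noteq> v"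
    using assms by (fastforce simp: wf_graph_def)
  ultimately have "quad_form ?n (laplacian (G\<lparr>edges := edges G\<rparr>)) x =
      (\<Sum>(u, v, w) \<leftarrow> edges G. w * (x u - x v)\<^sup>2)"
    by blast
  then have "quad_form ?n (laplacian G) x = (\<Sum>(u, v, w) \<leftarrow> edges G. w * (x u - x v)\<^sup>2)"
    by simp
  also have "\<dots> = dirichlet G x x"
    by (simp add: dirichlet_def sum_list_sum_nth num_edges_def edge_src_def edge_tgt_def
        conductance_def case_prod_unfold atLeast0LessThan power2_eq_square mult.assoc)
  finally show ?thesis .
qed

lemma spectral_sparsifierD:
  assumes "spectral_sparsifier \<kappa> G H" "wf_graph G" "wf_graph H"
  shows "verts H = verts G" "dirichlet G x x \<le> dirichlet H x x"
    "dirichlet H x x \<le> \<kappa> * dirichlet G x x"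
  using assms quad_form_laplacian[of G x] quad_form_laplacian[of H x]
  by (auto simp: spectral_sparsifier_def loewner_le_def quad_form_diff quad_form_scale)
    (smt (verit))+

text \<open>This is \<open>diffusion_instance\<close> without the existence of a minimum. Queries
  have this part by construction; existence is derived from it and a lower bound on the
  energy.\<close>

definition diffusion_data :: "diffusion \<Rightarrow> bool" where
  "diffusion_data D \<longleftrightarrow> wf_graph (graph D) \<and> length (weights D) = num_verts D \<and>
     (\<forall>ps \<in> set (weights D). vwf (splits ps) (piecewise ps)) \<and>
     length (bound D) = num_verts D \<and> (\<forall>b \<in> set (bound D). b \<le> 0)"

lemma diffusion_instance_iff:
  "diffusion_instance D \<longleftrightarrow> diffusion_data D \<and> (\<exists>x. is_arg_min (energy D) (feasible D) x)"
  by (auto simp: diffusion_instance_def diffusion_data_def)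

lemma diffusion_dataD:
  assumes "diffusion_data D"
  shows "wf_graph (graph D)" "u < num_verts D \<Longrightarrow> vwf (splits (weights D ! u)) (piecewise (weights D ! u))"
    "u < num_verts D \<Longrightarrow> bound D ! u \<le> 0"
  using assms by (auto simp: diffusion_data_def)

lemma energy_eq:
  "diffusion_data D \<Longrightarrow> energy D x = dirichlet (graph D) x x / 2
     + (\<Sum>u<num_verts D. piecewise (weights D ! u) (x u))"
  by (simp add: energy_def quad_form_laplacian diffusion_data_def)

lemma energy_cong:
  assumes "diffusion_data D" "\<And>u. u < num_verts D \<Longrightarrow> x u = y u"
  shows "energy D x = energy D y"
  using assms dirichlet_cong[of "graph D" x y x y] diffusion_dataD(1)[OF assms(1)]
  by (simp add: energy_eq)

lemma feasible_cong:
  "(\<And>u. u < num_verts D \<Longrightarrow> x u = y u) \<Longrightarrow> feasible D x \<longleftrightarrow> feasible D y"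
  by (simp add: feasible_def)

lemma feasible_zero: "diffusion_data D \<Longrightarrow> feasible D (\<lambda>_. 0)"
  using diffusion_dataD by (auto simp: feasible_def vwf_def)

lemma energy_zero:
  assumes "diffusion_data D"
  shows "energy D (\<lambda>_. 0) \<le> 0"
proof -
  have "(\<Sum>u<num_verts D. piecewise (weights D ! u) 0) \<le> 0"
    using diffusion_dataD(2)[OF assms] by (intro sum_nonpos) (auto simp: vwf_def)
  then show ?thesis
    using assms by (simp add: energy_eq dirichlet_def)
qed

lemma feasible_convex:
  assumes "feasible D x" "feasible D y" "0 \<le> t" "t \<le> 1"
  shows "feasible D (\<lambda>u. (1 - t) * x u + t * y u)"
proof -
  have "a \<le> (1 - t) * b + t * c" if "a \<le> b" "a \<le> c" for a b c :: real
    using convex_bound_le[of "- b" "- a" "- c" "1 - t" t] that assms by simp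
  then show ?thesis
    using assms by (auto simp: feasible_def)
qed

text \<open>The VWFs contribute mere convexity. The subtracted term is the exact convexity deficit
  of the quadratic part, so the modulus is the seminorm of L(G).\<close>

lemma energy_strongly_convex:
  assumes "diffusion_data D" "feasible D x" "feasible D y" "0 \<le> t" "t \<le> 1"
  shows "energy D (\<lambda>u. (1 - t) * x u + t * y u) \<le> (1 - t) * energy D x + t * energy D y
    - t * (1 - t) / 2 * dirichlet (graph D) (\<lambda>u. y u - x u) (\<lambda>u. y u - x u)"
proof -
  let ?f = "\<lambda>u. piecewise (weights D ! u)"
  have "(\<Sum>u<num_verts D. ?f u ((1 - t) * x u + t * y u))
    \<le> (\<Sum>u<num_verts D. (1 - t) * ?f u (x u) + t * ?f u (y u))"
  proof (rule sum_mono)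
    fix u assume u: "u \<in> {..<num_verts D}"
    then have "convex_on {hd (splits (weights D ! u))..} (?f u)"
      using diffusion_dataD(2)[OF assms(1)] by (auto simp: vwf_def)
    from convex_onD[OF this, of t "x u" "y u"]
    show "?f u ((1 - t) * x u + t * y u) \<le> (1 - t) * ?f u (x u) + t * ?f u (y u)"
      using u assms(2-5) by (auto simp: feasible_def)
  qed
  moreover have "\<dots> = (1 - t) * (\<Sum>u<num_verts D. ?f u (x u)) + t * (\<Sum>u<num_verts D. ?f u (y u))"
    by (simp add: sum.distrib sum_distrib_left)
  ultimately show ?thesis
    unfolding energy_eq[OF assms(1)] dirichlet_lincomb dirichlet_diff dirichlet_sym[of _ y x]
    by (simp add: field_simps power2_eq_square)
qed

section \<open>Vertex weighting functions and linear terms\<close>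

text \<open>Past the last split point the derivative is constant, so \<open>f\<close> is a line
  there. By convexity the line through two points of the tail lies below \<open>f\<close> further to
  the left.\<close>

lemma vwf_eventually_linear:
  assumes "vwf s f"
  obtains a m where "\<And>x. x \<ge> hd s \<Longrightarrow> a + m * x \<le> f x" "\<And>x. x \<ge> last s \<Longrightarrow> f x = a + m * x"
proof -
  from assms obtain f' where f': "\<And>x. x \<ge> hd s \<Longrightarrow> (f has_real_derivative f' x) (at x within {hd s..})"
    "\<And>x. x \<ge> last s \<Longrightarrow> f' x = f' (last s)" and conv: "convex_on {hd s..} f"
    unfolding vwf_def by blast
  have le: "hd s \<le> last s"
    using assms by (cases s) (auto simp: vwf_def intro: less_imp_le)
  define m where "m = f' (last s)"
  have "((\<lambda>x. f x - m * x) has_field_derivative 0) (at x within {last s..})" if "x \<in> {last s..}" for x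
  proof -
    have "(f has_real_derivative m) (at x within {last s..})"
      using DERIV_subset[OF f'(1)[of x], of "{last s..}"] f'(2)[of x] that le by (simp add: m_def)
    then show ?thesis
      by (auto intro!: derivative_eq_intros)
  qed
  then obtain a where "\<forall>x\<in>{last s..}. f x - m * x = a"
    using has_field_derivative_zero_constant[of "{last s..}" "\<lambda>x. f x - m * x"] by auto
  then have lin: "f x = a + m * x" if "x \<ge> last s" for x
    using that by (force simp: algebra_simps)
  have "a + m * x \<le> f x" if x: "x \<ge> hd s" for x
  proof (cases "x \<ge> last s")
    case False
    \<comment> \<open>The weight for which \<open>last s\<close> is the convex combination of x and
      \<open>last s + 1\<close>, the latter two points of the tail being on the line.\<close>
    define \<tau> t where "\<tau> = last s" and "t = (\<tau> - x) / (\<tau> + 1 - x)"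
    have "t * (\<tau> + 1 - x) = \<tau> - x"
      using False by (simp add: t_def \<tau>_def)
    then have "(1 - t) * x + t * (\<tau> + 1) = \<tau>"
      by (simp add: algebra_simps)
    moreover have "0 \<le> t" "t < 1"
      using False by (auto simp: t_def \<tau>_def)
    ultimately have t: "0 \<le> t" "t < 1" "(1 - t) * x + t * (\<tau> + 1) = \<tau>"
      by blast+
    have "f ((1 - t) * x + t * (\<tau> + 1)) \<le> (1 - t) * f x + t * f (\<tau> + 1)"
      using convex_onD[OF conv, of t x "\<tau> + 1"] t x le by (simp add: \<tau>_def)
    then have "a + m * ((1 - t) * x + t * (\<tau> + 1)) \<le> (1 - t) * f x + t * (a + m * (\<tau> + 1))"
      using lin[of \<tau>] lin[of "\<tau> + 1"] \<tau>_def t(3) by simp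
    then have "(1 - t) * (a + m * x) \<le> (1 - t) * f x"
      by (simp add: algebra_simps)
    then show ?thesis
      using t(2) by simp
  qed (simp add: lin)
  then show ?thesis
    using lin that by blast
qed

text \<open>A linear term shifts the derivative by a constant and vanishes at 0, so all clauses
  survive with the same split points. This is why the queries have the same total size as the
  original instance.\<close>

lemma vwf_add_linear:
  assumes "vwf s f" "\<And>x. x \<ge> hd s \<Longrightarrow> g x = f x + l * x"
  shows "vwf s g"
proof -
  let ?S = "{hd s..}"
  have hd_le: "hd s \<le> s ! i" if "i < length s" for i
    using assms(1) that by (cases s; cases i) (auto simp: vwf_def intro: less_imp_le)
  have s: "s \<noteq> []" "sorted_wrt (<) s" "hd s \<le> 0" "f 0 \<le> 0" and cont: "continuous_on ?S f"
    and conv: "convex_on ?S f"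
    and quad: "\<And>i. i < length s \<Longrightarrow> \<exists>p q r. \<forall>x \<ge> s ! i. (Suc i < length s \<longrightarrow> x \<le> s ! Suc i) \<longrightarrow>
        f x = p * x\<^sup>2 + q * x + r"
    using assms(1) unfolding vwf_def by blast+
  obtain f' where f': "\<And>x. x \<ge> hd s \<Longrightarrow> (f has_real_derivative f' x) (at x within ?S)"
    "continuous_on ?S f'" "concave_on ?S f'" "\<And>x. x \<ge> last s \<Longrightarrow> f' x = f' (last s)"
    using assms(1) unfolding vwf_def by blast
  have 1: "continuous_on ?S g"
    using cont assms(2) by (subst continuous_on_cong[of _ ?S _ "\<lambda>x. f x + l * x"])
      (auto intro!: continuous_intros)
  have 2: "convex_on ?S g"
  proof (rule convex_onI)
    fix t x y :: real assume t: "0 < t" "t < 1" "x \<in> ?S" "y \<in> ?S"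
    then have "(1 - t) * x + t * y \<in> ?S"
      using convexD_alt[of ?S x y t] by auto
    with t convex_onD[OF conv, of t x y]
    show "g ((1 - t) *\<^sub>R x + t *\<^sub>R y) \<le> (1 - t) * g x + t * g y"
      by (simp add: assms(2) algebra_simps)
  qed simp
  have 3: "\<exists>p q r. \<forall>x \<ge> s ! i. (Suc i < length s \<longrightarrow> x \<le> s ! Suc i) \<longrightarrow>
        g x = p * x\<^sup>2 + q * x + r" if i: "i < length s" for i
  proof -
    obtain p q r where "\<forall>x \<ge> s ! i. (Suc i < length s \<longrightarrow> x \<le> s ! Suc i) \<longrightarrow>
        f x = p * x\<^sup>2 + q * x + r"
      using quad i by blast
    then have "\<forall>x \<ge> s ! i. (Suc i < length s \<longrightarrow> x \<le> s ! Suc i) \<longrightarrow>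
        g x = p * x\<^sup>2 + (q + l) * x + r"
      using hd_le[OF i] assms(2) by (auto simp: algebra_simps)
    then show ?thesis
      by blast
  qed
  have 4: "(g has_real_derivative f' x + l) (at x within ?S)" if "x \<ge> hd s" for x
  proof (rule has_field_derivative_transform_within[of "\<lambda>x. f x + l * x" _ _ _ 1])
    show "((\<lambda>x. f x + l * x) has_real_derivative f' x + l) (at x within ?S)"
      using f'(1)[OF that] by (auto intro!: derivative_eq_intros)
  qed (use that assms(2) in auto)
  have 5: "continuous_on ?S (\<lambda>x. f' x + l)"
    using f'(2) by (intro continuous_intros)
  have 6: "concave_on ?S (\<lambda>x. f' x + l)"
    using convex_on_add[of ?S "\<lambda>x. - f' x" "\<lambda>x. - l"] f'(3)
    by (simp add: concave_on_def convex_on_const)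
  have 7: "g 0 \<le> 0"
    using s(3,4) assms(2)[of 0] by simp
  have 8: "f' x + l = f' (last s) + l" if "x \<ge> last s" for x
    by (simp only: f'(4)[OF that])
  have "\<exists>f'. (\<forall>x \<ge> hd s. (g has_real_derivative f' x) (at x within ?S)) \<and>
      continuous_on ?S f' \<and> concave_on ?S f' \<and> (\<forall>x \<ge> last s. f' x = f' (last s))"
    by (rule exI[of _ "\<lambda>x. f' x + l"]) (intro conjI allI impI 4 5 6 8)
  then show ?thesis
    unfolding vwf_def by (intro conjI allI impI s(1-3) 1 2 3 7)
qed

definition add_linear :: "real \<Rightarrow> pieces \<Rightarrow> pieces" where
  "add_linear l ps = map (\<lambda>(s, p, q, r). (s, p, q + l, r)) ps"

lemma splits_add_linear [simp]: "splits (add_linear l ps) = splits ps"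
  by (simp add: splits_def add_linear_def case_prod_unfold)

lemma length_add_linear [simp]: "length (add_linear l ps) = length ps"
  by (simp add: add_linear_def)

text \<open>To the left of the first split point \<open>piecewise\<close> evaluates
  \<open>last []\<close>, so the identity is claimed on the domain only.\<close>

lemma piecewise_add_linear:
  assumes "ps \<noteq> []" "x \<ge> hd (splits ps)"
  shows "piecewise (add_linear l ps) x = piecewise ps x + l * x"
proof -
  let ?f = "filter (\<lambda>(s, _). s \<le> x)"
  have "hd ps \<in> set (?f ps)"
    using assms by (cases ps) (auto simp: splits_def)
  then have ne: "?f ps \<noteq> []"
    by force
  have "?f (add_linear l ps) = add_linear l (?f ps)"
    by (auto simp: add_linear_def filter_map comp_def case_prod_unfold)
  then have "last (?f (add_linear l ps)) = (\<lambda>(s, p, q, r). (s, p, q + l, r)) (last (?f ps))"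
    using ne by (simp add: add_linear_def last_map)
  then show ?thesis
    by (simp add: piecewise_def case_prod_unfold algebra_simps)
qed

lemma vwf_add_linear_pieces:
  assumes "vwf (splits ps) (piecewise ps)"
  shows "vwf (splits (add_linear l ps)) (piecewise (add_linear l ps))"
proof -
  have "ps \<noteq> []"
    using assms by (auto simp: vwf_def splits_def)
  from vwf_add_linear[OF assms piecewise_add_linear[OF this]] show ?thesis
    by simp
qed

section \<open>Existence of minimisers\<close>

text \<open>Potentials are functions on all of \<open>nat\<close>. Fixing them to 0 outside the
  vertices makes a box a product of compact sets, and Tychonoff's theorem applies.\<close>

lemma compact_box: "compact {x :: nat \<Rightarrow> real. \<forall>u. if u < n then lo u \<le> x u \<and> x u \<le> R else x u = 0}"
proof -
  have "compactin (product_topology (\<lambda>_. euclidean) UNIV)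
      (\<Pi>\<^sub>E u\<in>UNIV. if u < n then {lo u..R} else {0 :: real})"
    by (auto simp: compactin_PiE)
  then have "compact (\<Pi>\<^sub>E u\<in>UNIV. if u < n then {lo u..R} else {0 :: real})"
    by (simp add: euclidean_product_topology)
  also have "(\<Pi>\<^sub>E u\<in>UNIV. if u < n then {lo u..R} else {0}) =
      {x. \<forall>u. if u < n then lo u \<le> x u \<and> x u \<le> R else x u = 0}"
    by (auto simp: PiE_def Pi_def split: if_splits)
  finally show ?thesis .
qed

text \<open>Bolzano-Weierstrass for the vectors divided by their size. The summand 1 keeps the
  divisor away from 0 and disappears in the limit, so the entries of d sum to 1; the fixed lower
  bounds divided by s tend to 0, so d is nonnegative.\<close>

lemma limit_direction:
  fixes X :: "nat \<Rightarrow> nat \<Rightarrow> real"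
  assumes unbounded: "\<And>R. \<exists>j. \<exists>u<n. X j u > R"
    and lo: "\<And>j u. u < n \<Longrightarrow> lo u \<le> X j u"
  shows "\<exists>J s d. (\<forall>r. s r = 1 + (\<Sum>u<n. \<bar>X (J r) u\<bar>)) \<and> filterlim s at_top sequentially \<and>
    (\<forall>u<n. ((\<lambda>r. X (J r) u / s r) \<longlonglongrightarrow> d u) \<and> d u \<ge> 0) \<and> (\<Sum>u<n. d u) = 1"
proof -
  define S where "S j = 1 + (\<Sum>u<n. \<bar>X j u\<bar>)" for j
  have "\<exists>j. S j > real r" for r :: nat
  proof -
    obtain j u where ju: "u < n" "X j u > real r"
      using unbounded by blast
    then have "\<bar>X j u\<bar> \<le> (\<Sum>u<n. \<bar>X j u\<bar>)"
      by (intro member_le_sum) auto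
    then show ?thesis
      using ju by (intro exI[of _ j]) (simp add: S_def)
  qed
  then obtain J where J: "\<And>r. S (J r) > real r"
    by metis
  have pos: "S j \<ge> 1" for j
    by (simp add: S_def sum_nonneg)
  define w where "w r = (\<lambda>u. if u < n then X (J r) u / S (J r) else 0)" for r
  have "w r \<in> {x. \<forall>u. if u < n then -1 \<le> x u \<and> x u \<le> 1 else x u = 0}" for r
  proof -
    have "\<bar>X (J r) u\<bar> \<le> S (J r)" if "u < n" for u
      using member_le_sum[of u "{..<n}" "\<lambda>u. \<bar>X (J r) u\<bar>"] that by (simp add: S_def)
    then have "\<bar>X (J r) u / S (J r)\<bar> \<le> 1" if "u < n" for u
      using pos[of "J r"] that by simp
    then have "-1 \<le> X (J r) u / S (J r) \<and> X (J r) u / S (J r) \<le> 1" if "u < n" for u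
      using that by (meson abs_le_iff minus_le_iff)
    then show ?thesis
      unfolding w_def mem_Collect_eq by presburger
  qed
  then obtain d \<rho> where \<rho>: "strict_mono (\<rho> :: nat \<Rightarrow> nat)" "(w \<circ> \<rho>) \<longlonglongrightarrow> d"
    using compact_imp_seq_compact[OF compact_box[of n "\<lambda>_. -1" 1]]
    unfolding seq_compact_def by blast
  have lim: "(\<lambda>r. w (\<rho> r) u) \<longlonglongrightarrow> d u" for u
    using continuous_on_tendsto_compose[OF continuous_on_product_coordinates[of u] \<rho>(2)]
    by (simp add: comp_def)
  define s where "s r = S (J (\<rho> r))" for r
  have "s r \<ge> real r" for r
    using J[of "\<rho> r"] seq_suble[OF \<rho>(1), of r] unfolding s_def
    by (metis less_imp_le of_nat_le_iff order_trans)
  then have s: "filterlim s at_top sequentially"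
    by (intro filterlim_at_top_mono[OF filterlim_real_sequentially]) auto
  have lim': "(\<lambda>r. X (J (\<rho> r)) u / s r) \<longlonglongrightarrow> d u" if "u < n" for u
    using lim[of u] that by (simp add: w_def s_def)
  have nonneg: "d u \<ge> 0" if "u < n" for u
  proof (rule tendsto_le[OF _ lim'[OF that]])
    show "(\<lambda>r. lo u / s r) \<longlonglongrightarrow> 0"
      using s by (intro tendsto_divide_0[OF tendsto_const] filterlim_at_top_imp_at_infinity)
    show "\<forall>\<^sub>F r in sequentially. lo u / s r \<le> X (J (\<rho> r)) u / s r"
      using lo[OF that] pos by (intro always_eventually allI divide_right_mono)
        (auto simp: s_def intro: order_trans[OF zero_le_one])
  qed simp
  have "(\<lambda>r. \<Sum>u<n. \<bar>X (J (\<rho> r)) u / s r\<bar>) \<longlonglongrightarrow> (\<Sum>u<n. \<bar>d u\<bar>)"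
    using lim' by (intro tendsto_sum tendsto_rabs) auto
  moreover have "(\<Sum>u<n. \<bar>X (J (\<rho> r)) u / s r\<bar>) = 1 - 1 / s r" for r
  proof -
    have "(\<Sum>u<n. \<bar>X (J (\<rho> r)) u\<bar>) = s r - 1" "s r > 0"
      using less_le_trans[OF zero_less_one pos[of "J (\<rho> r)"]] by (simp_all add: s_def) (simp add: S_def)
    then show ?thesis
      by (simp add: abs_divide sum_divide_distrib[symmetric] diff_divide_distrib)
  qed
  moreover have "(\<lambda>r. 1 - 1 / s r) \<longlonglongrightarrow> 1 - 0"
    using s by (intro tendsto_diff tendsto_divide_0[OF tendsto_const] tendsto_const
        filterlim_at_top_imp_at_infinity)
  ultimately have "(\<Sum>u<n. \<bar>d u\<bar>) = 1 - 0"
    by (simp only: LIMSEQ_unique)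
  moreover have "(\<Sum>u<n. \<bar>d u\<bar>) = (\<Sum>u<n. d u)"
    using nonneg by (intro sum.cong) auto
  ultimately have "(\<Sum>u<n. d u) = 1"
    by simp
  moreover have "\<forall>r. s r = 1 + (\<Sum>u<n. \<bar>X (J (\<rho> r)) u\<bar>)"
    by (simp add: s_def S_def)
  ultimately show ?thesis
    by (intro exI[of _ "\<lambda>r. J (\<rho> r)"] exI[of _ s] exI[of _ d] conjI allI impI s lim' nonneg) simp_all
qed

lemma continuous_on_dirichlet [continuous_intros]:
  "continuous_on S (\<lambda>x. dirichlet G x x)"
  unfolding dirichlet_def
  by (intro continuous_intros continuous_on_subset[OF continuous_on_product_coordinates]) auto

definition lower :: "diffusion \<Rightarrow> nat \<Rightarrow> real" where
  "lower D u = max (bound D ! u) (hd (splits (weights D ! u)))"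

lemma feasible_iff_lower: "feasible D x \<longleftrightarrow> (\<forall>u < num_verts D. lower D u \<le> x u)"
  by (auto simp: feasible_def lower_def)

lemma lower_nonpos: "diffusion_data D \<Longrightarrow> u < num_verts D \<Longrightarrow> lower D u \<le> 0"
  using diffusion_dataD(2,3)[of D] by (auto simp: lower_def vwf_def)

lemma continuous_on_energy:
  assumes "diffusion_data D" "\<And>x. x \<in> S \<Longrightarrow> feasible D x"
  shows "continuous_on S (energy D)"
proof -
  have "continuous_on S (\<lambda>x. piecewise (weights D ! u) (x u))" if u: "u < num_verts D" for u
  proof (rule continuous_on_compose2[of "{hd (splits (weights D ! u))..}" _ S "\<lambda>x. x u"])
    show "continuous_on {hd (splits (weights D ! u))..} (piecewise (weights D ! u))"
      using diffusion_dataD(2)[OF assms(1) u] by (simp add: vwf_def)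
    show "continuous_on S (\<lambda>x. x u)"
      by (rule continuous_on_subset[OF continuous_on_product_coordinates subset_UNIV])
  qed (use assms(2) u in \<open>auto simp: feasible_def\<close>)
  then have "continuous_on S (\<lambda>x. dirichlet (graph D) x x / 2
      + (\<Sum>u<num_verts D. piecewise (weights D ! u) (x u)))"
    by (intro continuous_intros) auto
  moreover have "energy D = (\<lambda>x. dirichlet (graph D) x x / 2
      + (\<Sum>u<num_verts D. piecewise (weights D ! u) (x u)))"
    by (rule ext) (rule energy_eq[OF assms(1)])
  ultimately show ?thesis
    by simp
qed

text \<open>A direction of zero Dirichlet energy takes equal values at the ends of every edge, so
  translating along it changes no potential difference.\<close>

lemma dirichlet_translate:
  assumes "wf_graph G" "dirichlet G d d \<le> 0"
  shows "dirichlet G (\<lambda>u. x u + t * d u) (\<lambda>u. x u + t * d u) = dirichlet G x x"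
proof -
  have "(\<Sum>e<num_edges G. conductance G e * (d (edge_src G e) - d (edge_tgt G e))\<^sup>2) = 0"
    using assms(2) dirichlet_nonneg[OF assms(1), of d]
    by (simp add: dirichlet_def power2_eq_square mult.assoc)
  then have "conductance G e * (d (edge_src G e) - d (edge_tgt G e))\<^sup>2 = 0" if "e < num_edges G" for e
    using that wf_graphD(4)[OF assms(1)] by (subst (asm) sum_nonneg_eq_0_iff) (auto intro!: mult_nonneg_nonneg intro: less_imp_le)
  then have "d (edge_src G e) = d (edge_tgt G e)" if "e < num_edges G" for e
    using that wf_graphD(4)[OF assms(1) that] by fastforce
  then show ?thesis
    by (simp add: dirichlet_def)
qed


text \<open>Minimisers of the energy perturbed by \<open>\<epsilon> \<Sum>\<^sub>u x\<^sub>u\<close> cannot escape to infinity as \<open>\<epsilon> \<longrightarrow> 0\<close>: along a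
  limit direction \<open>d\<close> the energy would be constant, while moving by \<open>- d\<close> decreases the perturbation.\<close>

lemma perturbed_minimizers_bounded:
  assumes D: "diffusion_data D"
    and below: "\<And>x. feasible D x \<Longrightarrow> low \<le> energy D x"
    and feas: "\<And>j. feasible D (X j)" and le: "\<And>j u. u < num_verts D \<Longrightarrow> X j u \<le> real j"
    and zero: "\<And>j u. u \<ge> num_verts D \<Longrightarrow> X j u = 0"
    and opt: "\<And>j y. feasible D y \<Longrightarrow> (\<And>u. u < num_verts D \<Longrightarrow> y u \<le> real j) \<Longrightarrow>
      energy D (X j) + (\<Sum>u<num_verts D. X j u) / real (Suc j)
        \<le> energy D y + (\<Sum>u<num_verts D. y u) / real (Suc j)"
  shows "\<exists>R. \<forall>j. \<forall>u<num_verts D. X j u \<le> R"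
proof (rule ccontr)
  let ?n = "num_verts D" and ?q = "\<lambda>x. dirichlet (graph D) x x"
  let ?f = "\<lambda>u. piecewise (weights D ! u)"
  define \<tau> where "\<tau> u = last (splits (weights D ! u))" for u
  have "\<exists>a m. (\<forall>x \<ge> hd (splits (weights D ! u)). a + m * x \<le> ?f u x) \<and>
      (\<forall>x \<ge> \<tau> u. ?f u x = a + m * x)" if "u < ?n" for u
    using vwf_eventually_linear[OF diffusion_dataD(2)[OF D that]] unfolding \<tau>_def by metis
  then obtain a m where am: "\<And>u x. u < ?n \<Longrightarrow> x \<ge> hd (splits (weights D ! u)) \<Longrightarrow> a u + m u * x \<le> ?f u x"
    "\<And>u x. u < ?n \<Longrightarrow> x \<ge> \<tau> u \<Longrightarrow> ?f u x = a u + m u * x"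
    by metis
  assume "\<nexists>R. \<forall>j. \<forall>u<?n. X j u \<le> R"
  then have "\<exists>j. \<exists>u<?n. X j u > R" for R
    by (meson not_le)
  moreover have "lower D u \<le> X j u" if "u < ?n" for j u
    using feas that by (simp add: feasible_iff_lower)
  ultimately obtain J s d where lim_dir: "\<forall>r. s r = 1 + (\<Sum>u<?n. \<bar>X (J r) u\<bar>)"
      "filterlim s at_top sequentially"
      "\<forall>u<?n. ((\<lambda>r. X (J r) u / s r) \<longlonglongrightarrow> d u) \<and> d u \<ge> 0" "(\<Sum>u<?n. d u) = 1"
    using limit_direction[of ?n X "lower D"] by auto
  then have s: "\<And>r. s r = 1 + (\<Sum>u<?n. \<bar>X (J r) u\<bar>)" "filterlim s at_top sequentially"
    and lim: "\<And>u. u < ?n \<Longrightarrow> (\<lambda>r. X (J r) u / s r) \<longlonglongrightarrow> d u"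
    and d: "\<And>u. u < ?n \<Longrightarrow> d u \<ge> 0" "(\<Sum>u<?n. d u) = 1"
    by auto
  have wf: "wf_graph (graph D)"
    using diffusion_dataD(1)[OF D] .
  have s1: "s r \<ge> 1" for r
    by (simp add: s(1) sum_nonneg)
  define A where "A = (\<Sum>u<?n. \<bar>a u\<bar>)"
  define M where "M = (\<Sum>u<?n. \<bar>m u\<bar>)"
  have nn: "A \<ge> 0" "M \<ge> 0"
    by (simp_all add: A_def M_def sum_nonneg)
  \<comment> \<open>Comparison with the zero potential: the VWFs are bounded below by lines, hence
    the quadratic part of the energy grows at most linearly in s. After division by the square of s
    it vanishes in the limit.\<close>
  have q_le: "?q (\<lambda>u. X (J r) u / s r) \<le> 2 * (A + M + 1) / s r" for r
  proof -
    let ?x = "X (J r)"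
    have "energy D ?x + (\<Sum>u<?n. ?x u) / real (Suc (J r)) \<le> energy D (\<lambda>_. 0) + 0"
      using opt[OF feasible_zero[OF D], of "J r"] by simp
    then have "energy D ?x + (\<Sum>u<?n. ?x u) / real (Suc (J r)) \<le> 0"
      using energy_zero[OF D] by simp
    moreover have "\<bar>\<Sum>u<?n. ?x u\<bar> \<le> s r"
      using sum_abs[of ?x "{..<?n}"] unfolding s(1) by linarith
    then have "\<bar>(\<Sum>u<?n. ?x u) / real (Suc (J r))\<bar> \<le> s r / 1"
      unfolding abs_divide using s1[of r] by (intro frac_le) auto
    then have "- ((\<Sum>u<?n. ?x u) / real (Suc (J r))) \<le> s r"
      by linarith
    moreover have "(\<Sum>u<?n. ?f u (?x u)) \<ge> (\<Sum>u<?n. - \<bar>a u\<bar> + - \<bar>m u\<bar> * s r)"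
    proof (rule sum_mono)
      fix u assume u: "u \<in> {..<?n}"
      then have "\<bar>?x u\<bar> \<le> s r"
        using member_le_sum[of u "{..<?n}" "\<lambda>u. \<bar>?x u\<bar>"] by (simp add: s(1))
      then have "\<bar>m u * ?x u\<bar> \<le> \<bar>m u\<bar> * s r"
        by (simp add: abs_mult mult_left_mono)
      moreover have "a u + m u * ?x u \<le> ?f u (?x u)"
        using am(1)[of u "?x u"] u feas[of "J r"] by (simp add: feasible_def)
      ultimately show "- \<bar>a u\<bar> + - \<bar>m u\<bar> * s r \<le> ?f u (?x u)"
        by linarith
    qed
    then have "(\<Sum>u<?n. ?f u (?x u)) \<ge> - A - M * s r"
      by (simp add: A_def M_def sum.distrib sum_negf sum_distrib_right sum_subtractf)
    moreover have "A \<le> A * s r"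
      using nn s1[of r] by (simp add: mult_le_cancel_left1)
    ultimately have "?q ?x \<le> 2 * (A * s r + M * s r + s r)"
      unfolding energy_eq[OF D] by argo
    then have "?q ?x \<le> 2 * (A + M + 1) * s r"
      by (simp add: algebra_simps)
    moreover have "?q (\<lambda>u. ?x u / s r) = ?q ?x / (s r)\<^sup>2"
      using dirichlet_lincomb[of "graph D" "1 / s r" ?x 0 ?x] by (simp add: power_divide)
    ultimately have "?q (\<lambda>u. ?x u / s r) \<le> 2 * (A + M + 1) * s r / (s r)\<^sup>2"
      by (metis divide_right_mono zero_le_power2)
    then show ?thesis
      using s1[of r] by (simp add: power2_eq_square)
  qed
  have "(\<lambda>r. ?q (\<lambda>u. X (J r) u / s r)) \<longlonglongrightarrow> ?q d"
    unfolding dirichlet_def using lim wf_graphD(1,2)[OF wf] by (intro tendsto_intros) auto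
  moreover have "(\<lambda>r. 2 * (A + M + 1) / s r) \<longlonglongrightarrow> 0"
    using s(2) by (intro tendsto_divide_0[OF tendsto_const] filterlim_at_top_imp_at_infinity)
  ultimately have "?q d \<le> 0"
    using q_le by (intro tendsto_le[OF sequentially_bot]) auto
  then have q_eq: "?q (\<lambda>u. x u + t * d u) = ?q x" for x t
    by (rule dirichlet_translate[OF wf])
  \<comment> \<open>A coordinate along which d is positive ends up so far in the linear tail that a
    step by - d does not leave it; the maximum with 0 keeps the step feasible because lower bounds
    are nonpositive.\<close>
  have "\<forall>\<^sub>F r in sequentially. d u > 0 \<longrightarrow> X (J r) u \<ge> max (\<tau> u) 0 + d u" if u: "u < ?n" for u
  proof (cases "d u > 0")
    case True
    have "filterlim (\<lambda>r. X (J r) u / s r * s r) at_top sequentially"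
      by (rule filterlim_tendsto_pos_mult_at_top[OF lim[OF u] True s(2)])
    moreover have "X (J r) u / s r * s r = X (J r) u" for r
      using s1[of r] by simp
    ultimately show ?thesis
      by (simp add: filterlim_at_top)
  qed simp
  then have "\<forall>\<^sub>F r in sequentially. \<forall>u\<in>{..<?n}. d u > 0 \<longrightarrow> X (J r) u \<ge> max (\<tau> u) 0 + d u"
    by (intro eventually_ball_finite) auto
  then obtain r where r: "\<And>u. u < ?n \<Longrightarrow> d u > 0 \<Longrightarrow> X (J r) u \<ge> max (\<tau> u) 0 + d u"
    using eventually_happens'[OF sequentially_bot] by blast
  define x where "x = X (J r)"
  define z where "z t = (\<lambda>u. x u + t * d u)" for t
  define \<sigma> where "\<sigma> = (\<Sum>u<?n. m u * d u)"
  \<comment> \<open>Along d only linear tails are met and the quadratic part is constant, so the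
    energy is affine in t with slope \<sigma>.\<close>
  have z: "feasible D (z t) \<and> energy D (z t) = energy D x + t * \<sigma>" if t: "t \<ge> -1" for t
  proof
    have *: "z t u \<ge> max (\<tau> u) 0 \<and> x u \<ge> \<tau> u" if "u < ?n" "d u > 0" for u
    proof -
      have "t * d u \<ge> - 1 * d u"
        using t that(2) by (intro mult_right_mono) auto
      then show ?thesis
        using r[OF that] that(2) by (auto simp: z_def x_def)
    qed
    have **: "d u = 0" if "u < ?n" "\<not> d u > 0" for u
      using d(1) that by fastforce
    have "lower D u \<le> z t u" if "u < ?n" for u
    proof (cases "d u > 0")
      case True
      then show ?thesis
        using *[OF that] lower_nonpos[OF D that] by simp
    next
      case False
      then show ?thesis
        using **[OF that] feas[of "J r"] that by (simp add: z_def x_def feasible_iff_lower)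
    qed
    then show "feasible D (z t)"
      by (simp add: feasible_iff_lower)
    have "?f u (z t u) = ?f u (x u) + t * (m u * d u)" if "u < ?n" for u
    proof (cases "d u > 0")
      case True
      then show ?thesis
        using *[OF that] am(2)[OF that] by (simp add: z_def algebra_simps)
    next
      case False
      then show ?thesis
        using **[OF that] by (simp add: z_def)
    qed
    then show "energy D (z t) = energy D x + t * \<sigma>"
      using q_eq[of x t]
      by (simp add: energy_eq[OF D] \<sigma>_def sum.distrib sum_distrib_left z_def)
  qed
  \<comment> \<open>A negative slope would push the energy below \<open>low\<close> on the ray t
    \<ge> 0.\<close>
  have "\<sigma> \<ge> 0"
  proof (rule ccontr)
    assume neg: "\<not> \<sigma> \<ge> 0"
    define t where "t = (energy D x - low + 1) / (- \<sigma>)"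
    have "energy D x \<ge> low"
      using below feas by (simp add: x_def)
    then have "t \<ge> 0"
      unfolding t_def using neg by (intro divide_nonneg_nonneg) auto
    moreover have "t * \<sigma> = low - energy D x - 1"
      using neg by (simp add: t_def field_simps)
    ultimately show False
      using z[of t] below[of "z t"] by auto
  qed
  moreover have "z (-1) u \<le> real (J r)" if "u < ?n" for u
    using le[OF that, of "J r"] d(1)[OF that] by (simp add: z_def x_def)
  then have "energy D x + (\<Sum>u<?n. x u) / real (Suc (J r))
      \<le> energy D (z (-1)) + (\<Sum>u<?n. z (-1) u) / real (Suc (J r))"
    unfolding x_def using z[of "-1"] by (intro opt) auto
  moreover have "(\<Sum>u<?n. z (-1) u) = (\<Sum>u<?n. x u) - 1"
    using d(2) by (simp add: z_def sum_subtractf)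
  then have "(\<Sum>u<?n. z (-1) u) / real (Suc (J r)) = (\<Sum>u<?n. x u) / real (Suc (J r)) - 1 / real (Suc (J r))"
    by (simp add: diff_divide_distrib)
  moreover have "1 / real (Suc (J r)) > 0"
    by simp
  ultimately show False
    using conjunct2[OF z[of "-1", OF order_refl]] by argo
qed

text \<open>A convex function that is bounded below need not have a minimiser; here the linear tails
  of the VWFs help. Compactness yields minimisers of the perturbed energy on growing boxes,
  \<open>perturbed_minimizers_bounded\<close> puts them all into one box, and a minimiser of the
  energy on that box is global because the weight 1 / (j + 1) of the perturbation tends to
  0.\<close>

lemma energy_attains_minimum:
  assumes D: "diffusion_data D" and below: "\<And>x. feasible D x \<Longrightarrow> low \<le> energy D x"
  shows "\<exists>x. is_arg_min (energy D) (feasible D) x"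
proof -
  let ?n = "num_verts D"
  define B where "B R = {x. \<forall>u. if u < ?n then lower D u \<le> x u \<and> x u \<le> R else x u = 0}" for R
  have B: "x \<in> B R \<longleftrightarrow> feasible D x \<and> (\<forall>u<?n. x u \<le> R) \<and> (\<forall>u\<ge>?n. x u = 0)" for x R
    unfolding B_def feasible_iff_lower if_bool_eq_conj not_less mem_Collect_eq by blast
  have compact: "compact (B R)" for R
    unfolding B_def by (rule compact_box)
  have ne: "B R \<noteq> {}" if "R \<ge> 0" for R
  proof -
    have "(\<lambda>_. 0) \<in> B R"
      using feasible_zero[OF D] that by (simp add: B)
    then show ?thesis
      by blast
  qed
  have cont: "continuous_on (B R) (energy D)" for R
    using B by (intro continuous_on_energy[OF D]) auto
  let ?F = "\<lambda>j x. energy D x + (\<Sum>u<?n. x u) / real (Suc j)"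
  have "\<exists>x \<in> B (real j). \<forall>y \<in> B (real j). ?F j x \<le> ?F j y" for j
    by (intro continuous_attains_inf compact ne continuous_intros cont
        continuous_on_subset[OF continuous_on_product_coordinates]) auto
  then obtain X where X: "\<And>j. X j \<in> B (real j)" "\<And>j y. y \<in> B (real j) \<Longrightarrow> ?F j (X j) \<le> ?F j y"
    by metis
  define cut where "cut y u = (if u < ?n then y u else 0)" for y :: "nat \<Rightarrow> real" and u
  have cut: "feasible D (cut y) \<longleftrightarrow> feasible D y" "energy D (cut y) = energy D y"
    "(\<Sum>u<?n. cut y u) = (\<Sum>u<?n. y u)" for y
    using feasible_cong[of D "cut y" y] energy_cong[OF D, of "cut y" y] by (auto simp: cut_def)
  have opt: "?F j (X j) \<le> ?F j y" if "feasible D y" "\<And>u. u < ?n \<Longrightarrow> y u \<le> real j" for j y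
    using X(2)[of "cut y" j] that cut[of y] by (simp add: B) (simp add: cut_def)
  obtain R where R: "\<And>j u. u < ?n \<Longrightarrow> X j u \<le> R"
    using perturbed_minimizers_bounded[OF D below, of X] X(1) opt unfolding B by blast
  obtain x where x: "x \<in> B (max R 0)" "\<And>y. y \<in> B (max R 0) \<Longrightarrow> energy D x \<le> energy D y"
    using continuous_attains_inf[OF compact ne cont, of "max R 0"] by auto
  have "energy D x \<le> energy D y" if y: "feasible D y" for y
  proof -
    \<comment> \<open>From \<open>j0\<close> on, y lies below the cap j and competes in the
      perturbed problem. The difference of the perturbations is at most
      \<open>c / real (Suc j)\<close>.\<close>
    define j0 where "j0 = nat \<lceil>\<Sum>u<?n. \<bar>y u\<bar>\<rceil>"
    define c where "c = (\<Sum>u<?n. y u) - (\<Sum>u<?n. lower D u)"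
    have "energy D x \<le> energy D y + c / real (Suc j)" if j: "j \<ge> j0" for j
    proof -
      have "y u \<le> real j" if "u < ?n" for u
      proof -
        have "y u \<le> (\<Sum>u<?n. \<bar>y u\<bar>)"
          using member_le_sum[of u "{..<?n}" "\<lambda>u. \<bar>y u\<bar>"] that by simp
        then show ?thesis
          using j unfolding j0_def by linarith
      qed
      then have "?F j (X j) \<le> ?F j y"
        by (intro opt y)
      moreover have "energy D x \<le> energy D (X j)"
        using X(1) R by (intro x(2)) (auto simp: B le_max_iff_disj)
      moreover have "(\<Sum>u<?n. lower D u) \<le> (\<Sum>u<?n. X j u)"
        using X(1)[of j] by (intro sum_mono) (auto simp: B feasible_iff_lower)
      then have "(\<Sum>u<?n. lower D u) / real (Suc j) \<le> (\<Sum>u<?n. X j u) / real (Suc j)"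
        by (intro divide_right_mono) auto
      ultimately show ?thesis
        by (simp add: c_def diff_divide_distrib)
    qed
    then have ev: "\<exists>N. \<forall>j\<ge>N. energy D x \<le> energy D y + c / real (Suc j)"
      by blast
    have "(\<lambda>j. energy D y + c / real (Suc j)) \<longlonglongrightarrow> energy D y + 0"
      by (intro tendsto_add tendsto_const LIMSEQ_Suc[OF lim_const_over_n])
    from LIMSEQ_le_const[OF this ev] show ?thesis
      by simp
  qed
  then show ?thesis
    using x(1) by (metis B is_arg_min_linorder)
qed

section \<open>Inexact accelerated proximal point steps\<close>

text \<open>The vector L(G) y as a sum over edges rather than over a matrix row, which is how the
  program accumulates it.\<close>

definition laplacian_apply :: "wgraph \<Rightarrow> (nat \<Rightarrow> real) \<Rightarrow> nat \<Rightarrow> real" where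
  "laplacian_apply G y j = (\<Sum>e<num_edges G. conductance G e * (y (edge_src G e) - y (edge_tgt G e)) *
     (of_bool (j = edge_src G e) - of_bool (j = edge_tgt G e)))"

lemma sum_mult_laplacian_apply:
  assumes "wf_graph G"
  shows "(\<Sum>j<verts G. laplacian_apply G y j * x j) = dirichlet G x y"
proof -
  have *: "(\<Sum>j<verts G. (of_bool (j = u) - of_bool (j = v)) * x j) = x u - x v"
    if "u < verts G" "v < verts G" for u v
  proof -
    have "(\<Sum>j<verts G. of_bool (j = k) * x j) = (if k < verts G then x k else 0)" for k
      using sum.delta[of "{..<verts G}" k x]
      by (simp add: of_bool_def if_distrib[of "\<lambda>a. a * _"] cong: if_cong)
    then show ?thesis
      using that by (simp add: left_diff_distrib sum_subtractf)
  qed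
  have "(\<Sum>j<verts G. laplacian_apply G y j * x j) =
      (\<Sum>e<num_edges G. \<Sum>j<verts G. conductance G e * (y (edge_src G e) - y (edge_tgt G e)) *
        ((of_bool (j = edge_src G e) - of_bool (j = edge_tgt G e)) * x j))"
    unfolding laplacian_apply_def sum_distrib_right by (subst sum.swap) (simp add: mult.assoc)
  also have "\<dots> = dirichlet G x y"
    unfolding sum_distrib_left[symmetric] dirichlet_def
    using wf_graphD(1,2)[OF assms] by (intro sum.cong) (auto simp: *)
  finally show ?thesis .
qed

text \<open>Up to a constant, the energy of \<open>prox_query D H y\<close> is the energy of \<open>D\<close> plus
  \<open>\<parallel>x - y\<parallel>\<^sup>2 / 2\<close> in the seminorm of \<open>L(H) - L(G)\<close>.\<close>

definition prox_query :: "diffusion \<Rightarrow> wgraph \<Rightarrow> (nat \<Rightarrow> real) \<Rightarrow> diffusion" where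
  "prox_query D H y = \<lparr>
     graph = H,
     weights = map (\<lambda>u. add_linear (laplacian_apply (graph D) y u - laplacian_apply H y u) (weights D ! u))
       [0..<num_verts D],
     bound = bound D\<rparr>"

lemma is_arg_min_opt_energy:
  assumes "diffusion_instance D"
  shows "feasible D (arg_min (energy D) (feasible D))"
    and "energy D (arg_min (energy D) (feasible D)) = opt_energy D"
    and "feasible D x \<Longrightarrow> opt_energy D \<le> energy D x"
proof -
  have "is_arg_min (energy D) (feasible D) (arg_min (energy D) (feasible D))"
    using assms unfolding diffusion_instance_def arg_min_def by (metis someI)
  then show "feasible D (arg_min (energy D) (feasible D))"
    and "energy D (arg_min (energy D) (feasible D)) = opt_energy D"
    and "feasible D x \<Longrightarrow> opt_energy D \<le> energy D x"
    by (auto simp: is_arg_min_linorder opt_energy_def)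
qed

lemma opt_energy_nonpos:
  assumes "diffusion_instance D"
  shows "opt_energy D \<le> 0"
  using is_arg_min_opt_energy(3)[OF assms feasible_zero] energy_zero[of D] assms
  by (auto simp: diffusion_instance_iff)

text \<open>Compare \<open>x\<close> with the feasible point at distance \<open>t\<close> towards \<open>z\<close>.\<close>

lemma near_optimal_energy_le:
  assumes D: "diffusion_instance D" and "feasible D x" "feasible D z" "0 < t" "t \<le> 1"
    and \<epsilon>: "energy D x \<le> opt_energy D + \<epsilon>"
  shows "energy D x + (1 - t) / 2 * dirichlet (graph D) (\<lambda>u. z u - x u) (\<lambda>u. z u - x u)
    \<le> energy D z + \<epsilon> / t"
proof -
  define q where "q = dirichlet (graph D) (\<lambda>u. z u - x u) (\<lambda>u. z u - x u)"
  have "opt_energy D \<le> energy D (\<lambda>u. (1 - t) * x u + t * z u)"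
    using assms by (intro is_arg_min_opt_energy(3) feasible_convex) auto
  also have "\<dots> \<le> (1 - t) * energy D x + t * energy D z - t * (1 - t) / 2 * q"
    using assms unfolding q_def by (intro energy_strongly_convex) (auto simp: diffusion_instance_iff)
  finally have "t * (energy D x + (1 - t) / 2 * q) \<le> t * energy D z + \<epsilon>"
    using \<epsilon> by (simp add: algebra_simps)
  then have "t * (energy D x + (1 - t) / 2 * q) / t \<le> (t * energy D z + \<epsilon>) / t"
    using assms(4) by (intro divide_right_mono) auto
  then show ?thesis
    using assms(4) by (simp add: q_def add_divide_distrib)
qed

text \<open>The left side is what the program computes, the right side the convex combination with
  Nesterov's weight \<theta> = 2 / (k + 2).\<close>

lemma extrapolation_eq:
  "(real k * a + 2 * b) / (real k + 2) = (1 - 2 / (real k + 2)) * a + 2 / (real k + 2) * b"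
proof -
  have "1 - 2 / (real k + 2) = real k / (real k + 2)"
    by (simp add: field_simps)
  then show ?thesis
    by (simp add: add_divide_distrib)
qed

section \<open>Accelerated proximal steps in the seminorm of L(H) - L(G)\<close>

locale sparsified_instance =
  fixes D :: diffusion and H :: wgraph and \<kappa> :: real
  assumes D: "diffusion_instance D" and H: "wf_graph H"
    and sparsifier: "spectral_sparsifier \<kappa> (graph D) H" and \<kappa>: "1 \<le> \<kappa>"
begin

definition qG :: "(nat \<Rightarrow> real) \<Rightarrow> real" where
  "qG x = dirichlet (graph D) x x"

definition qM :: "(nat \<Rightarrow> real) \<Rightarrow> real" where
  "qM x = dirichlet H x x - dirichlet (graph D) x x"

definition opt :: "nat \<Rightarrow> real" where
  "opt = arg_min (energy D) (feasible D)"

lemma data: "diffusion_data D"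
  using D by (simp add: diffusion_instance_iff)

lemma G: "wf_graph (graph D)"
  using diffusion_dataD(1)[OF data] .

lemma verts_H [simp]: "verts H = num_verts D"
  using spectral_sparsifierD(1)[OF sparsifier G H] .

lemma opt: "feasible D opt" "energy D opt = opt_energy D"
  using is_arg_min_opt_energy(1,2)[OF D] by (simp_all add: opt_def)

lemma qG_nonneg: "qG x \<ge> 0"
  using dirichlet_nonneg[OF G] by (simp add: qG_def)

lemma qM_nonneg: "qM x \<ge> 0"
  using spectral_sparsifierD(2)[OF sparsifier G H] by (simp add: qM_def)

lemma qM_le: "qM x \<le> (\<kappa> - 1) * qG x"
  using spectral_sparsifierD(3)[OF sparsifier G H, of x] by (simp add: qM_def qG_def algebra_simps)

lemma qM_le': "qM x \<le> \<kappa> * qG x"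
  using qM_le[of x] qG_nonneg[of x] by (simp add: algebra_simps)

lemma qM_cong: "(\<And>u. u < num_verts D \<Longrightarrow> x u = y u) \<Longrightarrow> qM x = qM y"
  unfolding qM_def using dirichlet_cong[OF G, of x y x y] dirichlet_cong[OF H, of x y x y] by simp

lemma qM_scale: "qM (\<lambda>u. t * x u) = t\<^sup>2 * qM x"
  using dirichlet_lincomb[of _ t x 0 x] by (simp add: qM_def algebra_simps)

text \<open>The parallelogram identity, with the term of the difference dropped.\<close>

lemma qM_add_le: "qM (\<lambda>u. x u + y u) \<le> 2 * qM x + 2 * qM y"
proof -
  have "qM (\<lambda>u. x u + y u) + qM (\<lambda>u. x u - y u) = 2 * qM x + 2 * qM y"
    using dirichlet_lincomb[of _ 1 x 1 y] dirichlet_lincomb[of _ 1 x "-1" y] by (simp add: qM_def)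
  then show ?thesis
    using qM_nonneg[of "\<lambda>u. x u - y u"] by linarith
qed

lemma qM_convex:
  assumes "0 \<le> t" "t \<le> 1"
  shows "qM (\<lambda>u. (1 - t) * x u + t * y u) \<le> (1 - t) * qM x + t * qM y"
proof -
  have "(1 - t) * qM x + t * qM y - qM (\<lambda>u. (1 - t) * x u + t * y u)
      = t * (1 - t) * qM (\<lambda>u. x u - y u)"
    unfolding qM_def dirichlet_lincomb dirichlet_diff by (simp add: power2_eq_square algebra_simps)
  then show ?thesis
    using assms qM_nonneg[of "\<lambda>u. x u - y u"] by (smt (verit) mult_nonneg_nonneg)
qed

lemma feasible_query [simp]: "feasible (prox_query D H y) x \<longleftrightarrow> feasible D x"
  by (simp add: feasible_def prox_query_def)

lemma query_data: "diffusion_data (prox_query D H y)"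
  using data H vwf_add_linear_pieces diffusion_dataD(2)[OF data]
  by (auto simp: diffusion_data_def prox_query_def)

lemma energy_query:
  assumes "feasible D x"
  shows "energy (prox_query D H y) x = energy D x + qM (\<lambda>u. x u - y u) / 2 - qM y / 2"
proof -
  let ?l = "\<lambda>u. laplacian_apply (graph D) y u - laplacian_apply H y u"
  have "piecewise (add_linear (?l u) (weights D ! u)) (x u)
      = piecewise (weights D ! u) (x u) + ?l u * x u" if "u < num_verts D" for u
    using that assms diffusion_dataD(2)[OF data that]
    by (intro piecewise_add_linear) (auto simp: vwf_def splits_def feasible_def)
  then have "energy (prox_query D H y) x = dirichlet H x x / 2
      + (\<Sum>u<num_verts D. piecewise (weights D ! u) (x u)) + (\<Sum>u<num_verts D. ?l u * x u)"
    using energy_eq[OF query_data[of y]] by (simp add: prox_query_def sum.distrib)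
  also have "(\<Sum>u<num_verts D. ?l u * x u) = dirichlet (graph D) x y - dirichlet H x y"
    using sum_mult_laplacian_apply[OF G] sum_mult_laplacian_apply[OF H]
    by (simp add: left_diff_distrib sum_subtractf)
  finally show ?thesis
    by (simp add: energy_eq[OF data] qM_def dirichlet_diff field_simps)
qed

text \<open>The proximal term is nonnegative, so the energy of the query is at least that of
  \<open>D\<close> minus the constant \<open>qM y / 2\<close>. This holds for every
  \<open>y\<close>, also for one computed from wrong answers.\<close>

lemma query_instance: "diffusion_instance (prox_query D H y)"
proof -
  have "opt_energy D - qM y / 2 \<le> energy (prox_query D H y) x" if "feasible D x" for x
    using is_arg_min_opt_energy(3)[OF D that] qM_nonneg[of "\<lambda>u. x u - y u"] energy_query[OF that, of y]
    by linarith
  then have "\<exists>x. is_arg_min (energy (prox_query D H y)) (feasible (prox_query D H y)) x"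
    by (intro energy_attains_minimum[OF query_data, of _ "opt_energy D - qM y / 2"]) simp
  then show ?thesis
    using query_data by (simp add: diffusion_instance_iff)
qed

lemma graph_query [simp]: "graph (prox_query D H y) = H"
  by (simp add: prox_query_def)

lemma total_size_query [simp]: "total_size (prox_query D H y) = total_size D"
proof -
  have "weights D = map ((!) (weights D)) [0..<num_verts D]"
    using data by (metis diffusion_data_def map_nth)
  then have "total_size D = (\<Sum>u\<leftarrow>[0..<num_verts D]. length (weights D ! u))"
    unfolding total_size_def by (metis (no_types, lifting) comp_apply map_eq_conv map_map)
  then show ?thesis
    by (simp add: total_size_def prox_query_def comp_def)
qed

text \<open>Strong convexity at the minimiser, from \<open>near_optimal_energy_le\<close> with t =
  1/2 and no error. Letting t tend to 0 would give the constant 2 in place of 4.\<close>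

lemma gap_ge:
  assumes "feasible D x"
  shows "qG (\<lambda>u. x u - opt u) \<le> 4 * (energy D x - opt_energy D)"
  using near_optimal_energy_le[OF D opt(1) assms, of "1 / 2" 0] by (simp add: qG_def opt)

lemma qG_opt: "qG opt \<le> 4 * (- opt_energy D)"
proof -
  have "qG (\<lambda>u. 0 - opt u) = qG opt"
    using dirichlet_lincomb[of _ "-1" opt 0 opt] by (simp add: qG_def)
  then show ?thesis
    using gap_ge[OF feasible_zero[OF data]] energy_zero[OF data] by simp
qed

text \<open>The three-point inequality of a proximal step. The multiplicative accuracy becomes an
  additive error, \<delta> times the absolute optimum of the query. Comparing \<open>z\<close> with
  \<open>w\<close> along a segment costs a factor 1 - t in the curvature and 1 / t in the error; the
  curvature of the query is that of L(H), which exceeds M by L(G), and this slack pays for the first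
  loss.\<close>

lemma prox_step:
  assumes z: "approx_optimal (1 + \<delta>) (prox_query D H y) z" and \<delta>: "\<delta> > 0" and w: "feasible D w"
  shows "feasible D z"
    "energy D z + qM (\<lambda>u. w u - z u) / 2 \<le> energy D w + qM (\<lambda>u. w u - y u) / 2
       + (\<kappa> + 1) * \<delta> * (- opt_energy D + qM y / 2)"
proof -
  let ?Q = "prox_query D H y"
  show feas: "feasible D z"
    using z by (simp add: approx_optimal_def)
  have Q: "diffusion_instance ?Q"
    by (rule query_instance)
  define \<epsilon> where "\<epsilon> = \<delta> * (- opt_energy D + qM y / 2)"
  have "opt_energy ?Q \<ge> opt_energy D - qM y / 2"
  proof -
    let ?x = "arg_min (energy ?Q) (feasible ?Q)"
    have "feasible D ?x" "energy ?Q ?x = opt_energy ?Q"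
      using is_arg_min_opt_energy(1,2)[OF Q] by simp_all
    then show ?thesis
      using energy_query[of ?x y] is_arg_min_opt_energy(3)[OF D, of ?x] qM_nonneg[of "\<lambda>u. ?x u - y u"]
      by linarith
  qed
  then have "\<delta> * (- opt_energy ?Q) \<le> \<epsilon>"
    unfolding \<epsilon>_def using \<delta> by (intro mult_left_mono) auto
  \<comment> \<open>Holds since (1 - \<delta>)(1 + \<delta>) \<le> 1 and the optimum is
    nonpositive.\<close>
  moreover have "opt_energy ?Q / (1 + \<delta>) \<le> opt_energy ?Q + \<delta> * (- opt_energy ?Q)"
  proof -
    have "\<delta>\<^sup>2 * opt_energy ?Q \<le> 0"
      using opt_energy_nonpos[OF Q] by (intro mult_nonneg_nonpos) auto
    then have "opt_energy ?Q \<le> (opt_energy ?Q + \<delta> * (- opt_energy ?Q)) * (1 + \<delta>)"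
      by (simp add: algebra_simps power2_eq_square)
    then show ?thesis
      using \<delta> by (subst pos_divide_le_eq) auto
  qed
  ultimately have "energy ?Q z \<le> opt_energy ?Q + \<epsilon>"
    using z by (simp add: approx_optimal_def)
  \<comment> \<open>For this \<open>t\<close> the factor \<open>1 - t\<close> is compensated by \<open>L(H) = M + L(G) \<ge> (1 + 1 / \<kappa>) M\<close>.\<close>
  define t where "t = 1 / (\<kappa> + 1)"
  have t: "0 < t" "t \<le> 1" "1 - t = \<kappa> / (\<kappa> + 1)" "\<epsilon> / t = (\<kappa> + 1) * \<epsilon>"
    using \<kappa> by (auto simp: t_def field_simps)
  have *: "energy ?Q z + (1 - t) / 2 * dirichlet H (\<lambda>u. w u - z u) (\<lambda>u. w u - z u)
      \<le> energy ?Q w + \<epsilon> / t"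
    using near_optimal_energy_le[OF Q _ _ t(1,2) \<open>energy ?Q z \<le> opt_energy ?Q + \<epsilon>\<close>, of w] w feas
    by simp
  have "qM (\<lambda>u. w u - z u) \<le> (1 - t) * dirichlet H (\<lambda>u. w u - z u) (\<lambda>u. w u - z u)"
  proof -
    let ?d = "\<lambda>u. w u - z u"
    have "(\<kappa> + 1) * qM ?d \<le> \<kappa> * dirichlet H ?d ?d"
      using qM_le'[of ?d] by (simp add: qM_def qG_def algebra_simps)
    then show ?thesis
      using \<kappa> unfolding t(3) by (simp add: field_simps)
  qed
  with * have "energy ?Q z + qM (\<lambda>u. w u - z u) / 2 \<le> energy ?Q w + (\<kappa> + 1) * \<epsilon>"
    by (simp add: t(4))
  then show "energy D z + qM (\<lambda>u. w u - z u) / 2 \<le> energy D w + qM (\<lambda>u. w u - y u) / 2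
       + (\<kappa> + 1) * \<delta> * (- opt_energy D + qM y / 2)"
    using energy_query[OF feas, of y] energy_query[OF w, of y] qM_nonneg[of "\<lambda>u. z u - y u"]
    by (simp add: \<epsilon>_def mult.assoc)
qed


text \<open>The summand \<open>k / 5\<close> accounts for the inexactness of the first \<open>k\<close> steps. At most \<open>5 \<kappa>\<close> steps are made,
  so the potential never exceeds \<open>3 \<kappa> \<bar>opt_energy D\<bar>\<close>.\<close>

definition accel_inv :: "nat \<Rightarrow> (nat \<Rightarrow> real) \<Rightarrow> (nat \<Rightarrow> real) \<Rightarrow> bool" where
  "accel_inv k x v \<longleftrightarrow> feasible D x \<and>
     (real k + 1)\<^sup>2 / 4 * (energy D x - opt_energy D) + qM (\<lambda>u. v u - opt u) / 2
       \<le> (2 * \<kappa> + real k / 5) * (- opt_energy D)"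

text \<open>At zero the seminorm term is half of \<open>qM opt\<close>, at most 2 (\<kappa> - 1) W
  with W = \<open>- opt_energy D\<close>. Using \<kappa> - 1 instead of \<kappa> leaves 2 W to cover
  the initial gap, which enters with weight 1/4.\<close>

lemma accel_inv_init:
  assumes "\<And>u. u < num_verts D \<Longrightarrow> x u = 0" "\<And>u. u < num_verts D \<Longrightarrow> v u = 0"
  shows "accel_inv 0 x v"
proof -
  let ?W = "- opt_energy D"
  have x: "feasible D x" "energy D x \<le> 0"
    using feasible_cong[of D x "\<lambda>_. 0"] energy_cong[OF data, of x "\<lambda>_. 0"] assms(1)
      feasible_zero[OF data] energy_zero[OF data] by auto
  have "qM (\<lambda>u. v u - opt u) = qM (\<lambda>u. -1 * opt u)"
    using assms(2) by (intro qM_cong) simp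
  also have "\<dots> \<le> (\<kappa> - 1) * (4 * ?W)"
    unfolding qM_scale using qM_le[of opt] mult_left_mono[OF qG_opt, of "\<kappa> - 1"] \<kappa> by simp
  finally have "qM (\<lambda>u. v u - opt u) / 2 \<le> 2 * \<kappa> * ?W - 2 * ?W"
    by (simp add: algebra_simps)
  then have "(energy D x - opt_energy D) / 4 + qM (\<lambda>u. v u - opt u) / 2 \<le> 2 * \<kappa> * ?W"
    using x(2) opt_energy_nonpos[OF D] by argo
  then show ?thesis
    using x(1) by (simp add: accel_inv_def)
qed

lemma iteration_count_le:
  assumes "(real k)\<^sup>2 < 25 * \<kappa> \<or> k = 0"
  shows "real k \<le> 5 * \<kappa>"
proof (cases "k = 0")
  case False
  have "25 * \<kappa> \<le> (5 * \<kappa>)\<^sup>2"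
    using \<kappa> by (simp add: power2_eq_square)
  then have "(real k)\<^sup>2 \<le> (5 * \<kappa>)\<^sup>2"
    using assms False by linarith
  then show ?thesis
    using \<kappa> by (rule_tac power2_le_imp_le) auto
qed (use \<kappa> in simp)

lemma accel_inv_potential_le:
  assumes "accel_inv k x v" "real k \<le> 5 * \<kappa>"
  shows "(real k + 1)\<^sup>2 / 4 * (energy D x - opt_energy D) + qM (\<lambda>u. v u - opt u) / 2
    \<le> 3 * \<kappa> * (- opt_energy D)"
proof -
  have "(2 * \<kappa> + real k / 5) * (- opt_energy D) \<le> 3 * \<kappa> * (- opt_energy D)"
    using opt_energy_nonpos[OF D] assms(2) by (intro mult_right_mono) auto
  then show ?thesis
    using assms(1) by (simp add: accel_inv_def)
qed

text \<open>The origin of the 25 in the stopping test: from 25 \<kappa> / 4 times the gap being at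
  most 3 \<kappa> W, the gap is at most 12/25 W, less than half of W =
  \<open>- opt_energy D\<close>.\<close>

lemma accel_inv_approx_optimal:
  assumes "accel_inv k x v" "(real k + 1)\<^sup>2 \<ge> 25 * \<kappa>" "(real k)\<^sup>2 < 25 * \<kappa> \<or> k = 0"
  shows "approx_optimal 2 D x"
proof -
  let ?g = "energy D x - opt_energy D"
  have x: "feasible D x"
    using assms(1) by (simp add: accel_inv_def)
  have "25 * \<kappa> / 4 * ?g \<le> (real k + 1)\<^sup>2 / 4 * ?g"
    using is_arg_min_opt_energy(3)[OF D x] assms(2) by (intro mult_right_mono) auto
  also have "\<dots> \<le> 3 * \<kappa> * (- opt_energy D)"
    using accel_inv_potential_le[OF assms(1) iteration_count_le[OF assms(3)]]
      qM_nonneg[of "\<lambda>u. v u - opt u"] by linarith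
  finally have "\<kappa> * (25 / 4 * ?g) \<le> \<kappa> * (3 * (- opt_energy D))"
    by (simp add: algebra_simps)
  then have "25 / 4 * ?g \<le> 3 * (- opt_energy D)"
    using \<kappa> by (simp only: mult_le_cancel_left_pos)
  then show ?thesis
    using x opt_energy_nonpos[OF D] by (simp add: approx_optimal_def)
qed

text \<open>The potential bounds the gap by 12 \<kappa> W and \<open>a\<close> by 6 \<kappa> W, so x
  and v, hence also their convex combination y, have squared distance at most 48 \<kappa>^2 W from
  \<open>opt\<close>. With \<open>qM opt\<close> \<le> 4 \<kappa> W this makes W +
  \<open>qM y / 2\<close> at most 53 \<kappa>^2 W. Together with (k + 2)^2 / 4 \<le> (k + 1)^2 < 25
  \<kappa> and \<kappa> + 1 \<le> 2 \<kappa>, the weighted error is at most 25 times 2 times 53 =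
  2650 times \<kappa>^4 \<delta> W. The allowance of W / 5 per step explains 13250 = 5 times
  2650.\<close>

lemma accel_step_error:
  assumes inv: "accel_inv k x v" and k: "(real k + 1)\<^sup>2 < 25 * \<kappa>"
    and \<delta>: "\<delta> > 0" "13250 * \<kappa> ^ 4 * \<delta> \<le> 1"
    and y: "\<And>u. u < num_verts D \<Longrightarrow> y u = (real k * x u + 2 * v u) / (real k + 2)"
  shows "(real k + 2)\<^sup>2 / 4 * ((\<kappa> + 1) * \<delta> * (- opt_energy D + qM y / 2)) \<le> - opt_energy D / 5"
proof -
  define W where "W = - opt_energy D"
  have W: "W \<ge> 0"
    using opt_energy_nonpos[OF D] by (simp add: W_def)
  define g where "g = energy D x - opt_energy D"
  define a where "a = qM (\<lambda>u. v u - opt u)"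
  have x: "feasible D x"
    using inv by (simp add: accel_inv_def)
  have g: "g \<ge> 0" and a: "a \<ge> 0"
    using is_arg_min_opt_energy(3)[OF D x] qM_nonneg by (simp_all add: g_def a_def)
  have "(real k)\<^sup>2 \<le> (real k + 1)\<^sup>2"
    by (intro power_mono) auto
  then have "real k \<le> 5 * \<kappa>"
    using k by (intro iteration_count_le disjI1) linarith
  from accel_inv_potential_le[OF inv this]
  have pot: "(real k + 1)\<^sup>2 / 4 * g + a / 2 \<le> 3 * \<kappa> * W"
    by (simp add: g_def a_def W_def)
  have "1 * g \<le> (real k + 1)\<^sup>2 * g"
    using g by (intro mult_right_mono one_le_power) auto
  then have g': "g \<le> 12 * \<kappa> * W"
    using pot a by linarith
  have "0 \<le> (real k + 1)\<^sup>2 / 4 * g"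
    using g by simp
  then have "a \<le> 6 * \<kappa> * W"
    using pot by linarith
  have "W \<le> \<kappa> * W"
    using \<kappa> W mult_right_mono[of 1 \<kappa> W] by simp
  then have "\<kappa> * W \<le> \<kappa> * (\<kappa> * W)"
    using \<kappa> by (intro mult_left_mono) auto
  then have \<kappa>W: "\<kappa> * W \<le> \<kappa>\<^sup>2 * W"
    by (simp add: power2_eq_square mult.assoc)
  then have a': "a \<le> 48 * \<kappa>\<^sup>2 * W"
    using \<open>a \<le> 6 * \<kappa> * W\<close> mult_nonneg_nonneg[OF zero_le_power2[of \<kappa>] W] by linarith
  have "qM (\<lambda>u. x u - opt u) \<le> \<kappa> * (4 * g)"
    using \<kappa> unfolding g_def by (intro order_trans[OF qM_le' mult_left_mono[OF gap_ge[OF x]]]) simp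
  also have "\<dots> \<le> \<kappa> * (4 * (12 * \<kappa> * W))"
    using g' \<kappa> by (intro mult_left_mono) auto
  finally have b': "qM (\<lambda>u. x u - opt u) \<le> 48 * \<kappa>\<^sup>2 * W"
    by (simp add: power2_eq_square)
  define \<theta> where "\<theta> = 2 / (real k + 2)"
  have \<theta>: "0 \<le> \<theta>" "\<theta> \<le> 1"
    by (simp_all add: \<theta>_def)
  have "qM (\<lambda>u. y u - opt u) = qM (\<lambda>u. (1 - \<theta>) * (x u - opt u) + \<theta> * (v u - opt u))"
  proof (rule qM_cong)
    fix u assume "u < num_verts D"
    then have "y u = (1 - \<theta>) * x u + \<theta> * v u"
      by (simp add: y \<theta>_def extrapolation_eq)
    then show "y u - opt u = (1 - \<theta>) * (x u - opt u) + \<theta> * (v u - opt u)"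
      by (simp add: algebra_simps)
  qed
  also have "\<dots> \<le> (1 - \<theta>) * (48 * \<kappa>\<^sup>2 * W) + \<theta> * (48 * \<kappa>\<^sup>2 * W)"
    using \<theta> a' b' by (intro order_trans[OF qM_convex] add_mono mult_left_mono) (auto simp: a_def)
  finally have "qM (\<lambda>u. y u - opt u) \<le> 48 * \<kappa>\<^sup>2 * W"
    by (simp add: algebra_simps)
  moreover have "qM y \<le> 2 * qM (\<lambda>u. y u - opt u) + 2 * qM opt"
    using qM_add_le[of "\<lambda>u. y u - opt u" opt] by simp
  moreover have "qM opt \<le> 4 * (\<kappa> * W)"
    using qM_le'[of opt] mult_left_mono[OF qG_opt, of \<kappa>] \<kappa> by (simp add: W_def)
  ultimately have "W + qM y / 2 \<le> 53 * \<kappa>\<^sup>2 * W"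
    using \<kappa>W \<open>W \<le> \<kappa> * W\<close> by linarith
  moreover have "(real k + 2)\<^sup>2 / 4 \<le> 25 * \<kappa>"
  proof -
    have "(real k + 2)\<^sup>2 \<le> (2 * (real k + 1))\<^sup>2"
      by (intro power_mono) auto
    also have "\<dots> = 4 * (real k + 1)\<^sup>2"
      unfolding power_mult_distrib by simp
    finally show ?thesis
      using k by linarith
  qed
  moreover have "\<kappa> + 1 \<le> 2 * \<kappa>"
    using \<kappa> by simp
  ultimately have "(real k + 2)\<^sup>2 / 4 * ((\<kappa> + 1) * \<delta> * (W + qM y / 2))
      \<le> 25 * \<kappa> * (2 * \<kappa> * \<delta> * (53 * \<kappa>\<^sup>2 * W))"
    using \<kappa> \<delta>(1) W qM_nonneg[of y] by (intro mult_mono mult_nonneg_nonneg add_nonneg_nonneg) auto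
  also have "\<dots> = 13250 * \<kappa> ^ 4 * \<delta> * (W / 5)"
    by (simp add: power2_eq_square power4_eq_xxxx)
  also have "\<dots> \<le> 1 * (W / 5)"
    using \<delta>(2) W by (intro mult_right_mono) auto
  finally show ?thesis
    by (simp add: W_def)
qed

text \<open>Nesterov's comparison point w = (1 - \<theta>) x + \<theta> opt turns both distances of
  \<open>prox_step\<close> into multiples of distances to \<open>opt\<close>: w - y = - \<theta> (v
  - opt) and w - z = - \<theta> (v' - opt). Dividing by \<theta>^2 gives the potential, since (1 -
  \<theta>) / \<theta>^2 = k (k + 2) / 4 \<le> (k + 1)^2 / 4. The new iterate \<open>z'\<close> is
  distinguished from the answer \<open>z\<close> because memory and answer agree on the vertices
  only.\<close>

lemma accel_step:
  assumes inv: "accel_inv k x v" and k: "(real k + 1)\<^sup>2 < 25 * \<kappa>"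
    and \<delta>: "\<delta> > 0" "13250 * \<kappa> ^ 4 * \<delta> \<le> 1"
    and y: "\<And>u. u < num_verts D \<Longrightarrow> y u = (real k * x u + 2 * v u) / (real k + 2)"
    and z: "approx_optimal (1 + \<delta>) (prox_query D H y) z"
    and z': "\<And>u. u < num_verts D \<Longrightarrow> z' u = z u"
    and v': "\<And>u. u < num_verts D \<Longrightarrow> v' u = x u + (z u - x u) * (real k + 2) / 2"
  shows "accel_inv (Suc k) z' v'"
proof -
  define \<theta> where "\<theta> = 2 / (real k + 2)"
  have \<theta>: "0 < \<theta>" "\<theta> \<le> 1"
    by (simp_all add: \<theta>_def)
  define w where "w u = (1 - \<theta>) * x u + \<theta> * opt u" for u
  define e where "e = (\<kappa> + 1) * \<delta> * (- opt_energy D + qM y / 2)"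
  define g where "g = energy D x - opt_energy D"
  define g' where "g' = energy D z - opt_energy D"
  define a where "a = qM (\<lambda>u. v u - opt u)"
  define a' where "a' = qM (\<lambda>u. v' u - opt u)"
  have x: "feasible D x"
    using inv by (simp add: accel_inv_def)
  have w: "feasible D w"
    unfolding w_def using x opt(1) \<theta> by (intro feasible_convex) auto
  have Ew: "energy D w \<le> (1 - \<theta>) * energy D x + \<theta> * opt_energy D"
  proof -
    have "0 \<le> \<theta> * (1 - \<theta>) / 2 * dirichlet (graph D) (\<lambda>u. opt u - x u) (\<lambda>u. opt u - x u)"
      using \<theta> dirichlet_nonneg[OF G] by simp
    then show ?thesis
      using energy_strongly_convex[OF data x opt(1), of \<theta>] \<theta> unfolding w_def opt(2) by simp
  qed
  have "qM (\<lambda>u. w u - z u) = qM (\<lambda>u. - \<theta> * (v' u - opt u))"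
  proof (rule qM_cong)
    fix u assume "u < num_verts D"
    then have "v' u = x u + (z u - x u) / \<theta>"
      by (simp add: v' \<theta>_def)
    then have "\<theta> * v' u = \<theta> * x u + (z u - x u)"
      using \<theta>(1) by (simp add: distrib_left)
    then show "w u - z u = - \<theta> * (v' u - opt u)"
      by (simp add: w_def algebra_simps)
  qed
  then have wz: "qM (\<lambda>u. w u - z u) = \<theta>\<^sup>2 * a'"
    by (simp only: qM_scale a'_def power2_minus)
  have "qM (\<lambda>u. w u - y u) = qM (\<lambda>u. - \<theta> * (v u - opt u))"
  proof (rule qM_cong)
    fix u assume "u < num_verts D"
    then have "y u = (1 - \<theta>) * x u + \<theta> * v u"
      by (simp add: y \<theta>_def extrapolation_eq)
    then show "w u - y u = - \<theta> * (v u - opt u)"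
      by (simp add: w_def algebra_simps)
  qed
  then have wy: "qM (\<lambda>u. w u - y u) = \<theta>\<^sup>2 * a"
    by (simp only: qM_scale a_def power2_minus)
  note step = prox_step[OF z \<delta>(1) w]
  have "g' + \<theta>\<^sup>2 * a' / 2 \<le> (1 - \<theta>) * g + \<theta>\<^sup>2 * a / 2 + e"
    using step(2) Ew unfolding wz wy e_def[symmetric] by (simp add: g_def g'_def algebra_simps)
  then have "(g' + \<theta>\<^sup>2 * a' / 2) * (1 / \<theta>\<^sup>2) \<le> ((1 - \<theta>) * g + \<theta>\<^sup>2 * a / 2 + e) * (1 / \<theta>\<^sup>2)"
    by (intro mult_right_mono) auto
  then have *: "1 / \<theta>\<^sup>2 * g' + a' / 2 \<le> 1 / \<theta>\<^sup>2 * (1 - \<theta>) * g + a / 2 + 1 / \<theta>\<^sup>2 * e"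
    using \<theta>(1) by (simp add: add_divide_distrib distrib_right)
  have \<theta>2: "1 / \<theta>\<^sup>2 = (real k + 2)\<^sup>2 / 4"
    by (simp add: \<theta>_def power_divide)
  have "1 / \<theta>\<^sup>2 * (1 - \<theta>) * g \<le> (real k + 1)\<^sup>2 / 4 * g"
  proof (rule mult_right_mono)
    have "(real k + 2)\<^sup>2 * (1 - \<theta>) = (real k + 2) * ((real k + 2) * (1 - \<theta>))"
      by (simp add: power2_eq_square)
    also have "(real k + 2) * (1 - \<theta>) = real k"
      by (simp add: \<theta>_def field_simps)
    also have "(real k + 2) * real k \<le> (real k + 1)\<^sup>2"
      by (simp add: power2_eq_square algebra_simps)
    finally show "1 / \<theta>\<^sup>2 * (1 - \<theta>) \<le> (real k + 1)\<^sup>2 / 4"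
      unfolding \<theta>2 by simp
  qed (use is_arg_min_opt_energy(3)[OF D x] in \<open>simp add: g_def\<close>)
  moreover have "1 / \<theta>\<^sup>2 * e \<le> - opt_energy D / 5"
    unfolding \<theta>2 e_def by (rule accel_step_error[OF inv k \<delta> y])
  moreover have "(real k + 1)\<^sup>2 / 4 * g + a / 2 \<le> (2 * \<kappa> + real k / 5) * (- opt_energy D)"
    using inv by (simp add: accel_inv_def g_def a_def)
  ultimately have "1 / \<theta>\<^sup>2 * g' + a' / 2
      \<le> (2 * \<kappa> + real k / 5) * (- opt_energy D) + - opt_energy D / 5"
    using * by argo
  then have "(real k + 2)\<^sup>2 / 4 * g' + a' / 2
      \<le> (2 * \<kappa> + real k / 5) * (- opt_energy D) + - opt_energy D / 5"
    unfolding \<theta>2 .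
  also have "\<dots> = (2 * \<kappa> + real (Suc k) / 5) * (- opt_energy D)"
    by (simp add: field_simps)
  finally have "(real (Suc k) + 1)\<^sup>2 / 4 * g' + a' / 2 \<le> (2 * \<kappa> + real (Suc k) / 5) * (- opt_energy D)"
    by (simp add: add.commute)
  moreover have "feasible D z' \<longleftrightarrow> feasible D z" "energy D z' = energy D z"
    using z' by (auto intro!: feasible_cong energy_cong[OF data])
  ultimately show ?thesis
    using step(1) by (simp add: accel_inv_def g'_def a'_def)
qed

end

section \<open>Executions with failing calls\<close>

text \<open>Total correctness on the whole support, without probabilities: accurate and wrong
  answers are covered alike. Quantifying over all \<open>k \<ge> K\<close> lets the parts of a
  program share one bound.\<close>

definition runs :: "(diffusion \<Rightarrow> real) \<Rightarrow> (diffusion \<Rightarrow> (nat \<Rightarrow> real) pmf) \<Rightarrow> nat \<Rightarrow> prog \<Rightarrow> config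
    \<Rightarrow> (config \<Rightarrow> bool) \<Rightarrow> bool" where
  "runs charge solve K P \<sigma> Q \<longleftrightarrow>
     (\<forall>k\<ge>K. \<forall>r \<in> set_pmf (exec charge solve k P \<sigma>). \<exists>\<sigma>'. r = Some \<sigma>' \<and> Q \<sigma>')"

lemma tick_simps [simp]:
  "nmem (tick k \<sigma>) = nmem \<sigma>" "rmem (tick k \<sigma>) = rmem \<sigma>" "calls (tick k \<sigma>) = calls \<sigma>"
  "time (tick k \<sigma>) = time \<sigma> + real k"
  by (simp_all add: tick_def)

lemma runs_weaken:
  assumes "runs ch so K P \<sigma> Q" "K \<le> K'" "\<And>\<sigma>'. Q \<sigma>' \<Longrightarrow> Q' \<sigma>'"
  shows "runs ch so K' P \<sigma> Q'"
  using assms unfolding runs_def by (meson order_trans)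

lemma runs_NWrite [simp]:
  "runs ch so K (NWrite a i e) \<sigma> Q \<longleftrightarrow> Q (tick (1 + ncost i + ncost e)
     (\<sigma>\<lparr>nmem := (nmem \<sigma>)(a := (nmem \<sigma> a)(nval i \<sigma> := nval e \<sigma>))\<rparr>))"
  by (auto simp: runs_def)

lemma runs_RWrite [simp]:
  "runs ch so K (RWrite a i e) \<sigma> Q \<longleftrightarrow> Q (tick (1 + ncost i + rcost e)
     (\<sigma>\<lparr>rmem := (rmem \<sigma>)(a := (rmem \<sigma> a)(nval i \<sigma> := rval e \<sigma>))\<rparr>))"
  by (auto simp: runs_def)

lemma runs_Call [simp]:
  "runs ch so K (Call a z) \<sigma> Q \<longleftrightarrow>
     (\<forall>x \<in> set_pmf (so (stored_diffusion \<sigma> a)). Q (answer_call ch a z x (tick 1 \<sigma>)))"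
  by (auto simp: runs_def)

lemma runs_Seq:
  assumes "runs ch so K P \<sigma> (\<lambda>\<sigma>'. runs ch so K P' \<sigma>' Q)"
  shows "runs ch so K (Seq P P') \<sigma> Q"
  using assms unfolding runs_def by (fastforce simp: set_bind_pmf split: option.splits)

lemma runs_While:
  assumes step: "\<And>i \<sigma>. I i \<sigma> \<Longrightarrow> bval b \<sigma> \<Longrightarrow> runs ch so K P (tick (1 + bcost b) \<sigma>) (I (Suc i))"
    and exit: "\<And>i \<sigma>. I i \<sigma> \<Longrightarrow> \<not> bval b \<sigma> \<Longrightarrow> Q (tick (1 + bcost b) \<sigma>)"
    and le: "\<And>i \<sigma>. I i \<sigma> \<Longrightarrow> i \<le> N"
    and init: "I i \<sigma>"
  shows "runs ch so (K + (N - i) + 1) (While b P) \<sigma> Q"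
  using init
proof (induction "N - i" arbitrary: i \<sigma> rule: less_induct)
  case less
  show ?case
    unfolding runs_def
  proof (intro allI impI ballI)
    fix k r
    assume k: "K + (N - i) + 1 \<le> k" and r: "r \<in> set_pmf (exec ch so k (While b P) \<sigma>)"
    obtain k' where k': "k = Suc k'" "K + (N - i) \<le> k'"
      using k by (cases k) auto
    show "\<exists>\<sigma>'. r = Some \<sigma>' \<and> Q \<sigma>'"
    proof (cases "bval b \<sigma>")
      case True
      then obtain r1 where r1: "r1 \<in> set_pmf (exec ch so k' P (tick (1 + bcost b) \<sigma>))"
        and r2: "r \<in> set_pmf (case r1 of None \<Rightarrow> return_pmf None
          | Some \<sigma>' \<Rightarrow> exec ch so k' (While b P) \<sigma>')"
        using r by (auto simp: k'(1))
      have "K \<le> k'"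
        using k'(2) by simp
      then obtain \<sigma>1 where \<sigma>1: "r1 = Some \<sigma>1" "I (Suc i) \<sigma>1"
        using step[OF less.prems True] r1 unfolding runs_def by blast
      have "Suc i \<le> N"
        using le[OF \<sigma>1(2)] .
      then have "runs ch so (K + (N - Suc i) + 1) (While b P) \<sigma>1 Q"
        by (intro less.hyps \<sigma>1(2)) simp
      moreover have "K + (N - Suc i) + 1 \<le> k'"
        using k'(2) \<open>Suc i \<le> N\<close> by simp
      ultimately show ?thesis
        using r2 unfolding runs_def \<sigma>1(1) by simp
    next
      case False
      then show ?thesis
        using r exit[OF less.prems] by (simp add: k'(1))
    qed
  qed
qed

section \<open>Counting loops\<close>

abbreviation counter :: "nat \<Rightarrow> nexp" where
  "counter v \<equiv> NRead v (NConst 0)"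

definition For :: "nat \<Rightarrow> nexp \<Rightarrow> nexp \<Rightarrow> prog \<Rightarrow> prog" where
  "For v lo hi P = Seq (NWrite v (NConst 0) lo)
     (While (NLess (counter v) hi) (Seq P (NWrite v (NConst 0) (NAdd (counter v) (NConst 1)))))"

text \<open>The numbers are costs: \<open>2 + ncost lo\<close> for initialising the counter,
  \<open>4 + ncost hi\<close> for a test and 6 for an increment.\<close>

lemma runs_For:
  assumes "nval lo \<sigma> = a" "a \<le> h"
    and init: "J a (tick (2 + ncost lo) (\<sigma>\<lparr>nmem := (nmem \<sigma>)(v := (nmem \<sigma> v)(0 := a))\<rparr>))"
    and val: "\<And>i \<sigma>'. J i \<sigma>' \<Longrightarrow> nmem \<sigma>' v 0 = i \<and> nval hi \<sigma>' = h"
    and body: "\<And>i \<sigma>'. a \<le> i \<Longrightarrow> i < h \<Longrightarrow> J i \<sigma>' \<Longrightarrow> runs ch so K P (tick (4 + ncost hi) \<sigma>')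
      (\<lambda>\<sigma>''. J (Suc i) (tick 6 (\<sigma>''\<lparr>nmem := (nmem \<sigma>'')(v := (nmem \<sigma>'' v)(0 := Suc (nmem \<sigma>'' v 0)))\<rparr>)))"
    and exit: "\<And>\<sigma>'. J h \<sigma>' \<Longrightarrow> Q (tick (4 + ncost hi) \<sigma>')"
    and K': "K + (h - a) + 1 \<le> K'"
  shows "runs ch so K' (For v lo hi P) \<sigma> Q"
proof -
  define I where "I i \<sigma>' \<longleftrightarrow> J (a + i) \<sigma>' \<and> a + i \<le> h" for i \<sigma>'
  let ?P = "Seq P (NWrite v (NConst 0) (NAdd (counter v) (NConst 1)))"
  have "runs ch so (K + (h - a - 0) + 1) (While (NLess (counter v) hi) ?P)
     (tick (2 + ncost lo) (\<sigma>\<lparr>nmem := (nmem \<sigma>)(v := (nmem \<sigma> v)(0 := a))\<rparr>)) Q"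
  proof (rule runs_While[of I])
    fix i \<sigma>' assume I: "I i \<sigma>'"
    then have J: "J (a + i) \<sigma>'" "nmem \<sigma>' v 0 = a + i" "nval hi \<sigma>' = h" "a + i \<le> h"
      using val by (auto simp: I_def)
    show "i \<le> h - a"
      using J(4) by simp
    show "runs ch so K ?P (tick (1 + bcost (NLess (counter v) hi)) \<sigma>') (I (Suc i))"
      if "bval (NLess (counter v) hi) \<sigma>'"
    proof (rule runs_Seq)
      have lt: "a + i < h"
        using that J by simp
      have cost: "1 + bcost (NLess (counter v) hi) = 4 + ncost hi"
        by simp
      show "runs ch so K P (tick (1 + bcost (NLess (counter v) hi)) \<sigma>')
        (\<lambda>\<sigma>'. runs ch so K (NWrite v (NConst 0) (NAdd (counter v) (NConst 1))) \<sigma>' (I (Suc i)))"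
        unfolding cost using lt by (intro runs_weaken[OF body[OF _ lt J(1)] order_refl]) (auto simp: I_def numeral_eq_Suc)
    qed
    show "Q (tick (1 + bcost (NLess (counter v) hi)) \<sigma>')" if "\<not> bval (NLess (counter v) hi) \<sigma>'"
    proof -
      have "a + i = h"
        using that J by simp
      then show ?thesis
        using exit[of \<sigma>'] J(1) by (simp add: numeral_eq_Suc)
    qed
  qed (use init assms(2) in \<open>auto simp: I_def\<close>)
  then show ?thesis
    unfolding For_def using assms(1) K' by (intro runs_Seq) (auto intro: runs_weaken)
qed

text \<open>Union bound over the calls: \<open>risk\<close> is a nonnegative supermartingale along any execution, and it
  is at least 1 once a call has failed, as long as there are at most \<open>N\<close> calls.\<close>

definition risk :: "(diffusion \<Rightarrow> (nat \<Rightarrow> real) \<Rightarrow> bool) \<Rightarrow> real \<Rightarrow> real \<Rightarrow> config \<Rightarrow> real" where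
  "risk ok p N \<sigma> = (if real (length (calls \<sigma>)) > N then 0
     else if \<exists>(Q, x) \<in> set (calls \<sigma>). \<not> ok Q x then 1
     else p * (N - real (length (calls \<sigma>))))"

lemma risk_cong: "calls \<sigma> = calls \<sigma>' \<Longrightarrow> risk ok p N \<sigma> = risk ok p N \<sigma>'"
  by (simp add: risk_def)

definition risk_option ::
    "(diffusion \<Rightarrow> (nat \<Rightarrow> real) \<Rightarrow> bool) \<Rightarrow> real \<Rightarrow> real \<Rightarrow> config option \<Rightarrow> real" where
  "risk_option ok p N r = (case r of None \<Rightarrow> 0 | Some \<sigma> \<Rightarrow> risk ok p N \<sigma>)"

text \<open>With l earlier calls, all good, the new risk is 1 with probability at most p and
  otherwise p (N - l - 1), so its mean is at most p (N - l). A failed history keeps risk 1, and once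
  the budget N is exceeded the risk is 0.\<close>

lemma risk_answer_call:
  assumes "p \<ge> 0" and fail: "measure_pmf.prob M {x. \<not> ok (stored_diffusion \<sigma> a) x} \<le> p"
  shows "(\<integral>\<^sup>+x. ennreal (risk ok p N (answer_call ch a z x \<sigma>)) \<partial>measure_pmf M) \<le> ennreal (risk ok p N \<sigma>)"
proof -
  let ?Q = "stored_diffusion \<sigma> a" and ?l = "real (length (calls \<sigma>))"
  have calls: "calls (answer_call ch a z x \<sigma>) = calls \<sigma> @ [(?Q, x)]" for x
    by (simp add: answer_call_def Let_def)
  consider "?l + 1 > N" | "?l + 1 \<le> N" "\<exists>(Q, x) \<in> set (calls \<sigma>). \<not> ok Q x"
    | "?l + 1 \<le> N" "\<forall>(Q, x) \<in> set (calls \<sigma>). ok Q x"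
    by fastforce
  then show ?thesis
  proof cases
    case 1
    then have "risk ok p N (answer_call ch a z x \<sigma>) = 0" for x
      by (simp add: risk_def calls)
    then show ?thesis
      by simp
  next
    case 2
    then have "risk ok p N (answer_call ch a z x \<sigma>) = 1" for x
      by (auto simp: risk_def calls)
    moreover have "risk ok p N \<sigma> = 1"
      using 2 by (auto simp: risk_def)
    ultimately show ?thesis
      by simp
  next
    case 3
    let ?c = "p * (N - ?l - 1)"
    have c: "?c \<ge> 0"
      using 3(1) assms(1) by simp
    have "(\<integral>\<^sup>+x. ennreal (risk ok p N (answer_call ch a z x \<sigma>)) \<partial>measure_pmf M)
        \<le> (\<integral>\<^sup>+x. indicator {x. \<not> ok ?Q x} x + ennreal ?c \<partial>measure_pmf M)"
    proof (rule nn_integral_mono)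
      fix x
      show "ennreal (risk ok p N (answer_call ch a z x \<sigma>)) \<le> indicator {x. \<not> ok ?Q x} x + ennreal ?c"
      proof (cases "ok ?Q x")
        case True
        then have "risk ok p N (answer_call ch a z x \<sigma>) = ?c"
          using 3 by (auto simp: risk_def calls algebra_simps)
        then show ?thesis
          by simp
      next
        case False
        then have "risk ok p N (answer_call ch a z x \<sigma>) = 1"
          using 3(1) by (auto simp: risk_def calls)
        then show ?thesis
          using False by simp
      qed
    qed
    also have "\<dots> = ennreal (measure_pmf.prob M {x. \<not> ok ?Q x}) + ennreal ?c"
      by (subst nn_integral_add) (auto simp: measure_pmf.emeasure_eq_measure)
    also have "\<dots> \<le> ennreal p + ennreal ?c"
      using fail by (intro add_right_mono ennreal_leI)
    also have "\<dots> = ennreal (p * (N - ?l))"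
      using assms(1) c by (simp add: ennreal_plus[symmetric] algebra_simps del: ennreal_plus)
    also have "p * (N - ?l) = risk ok p N \<sigma>"
      using 3 by (auto simp: risk_def)
    finally show ?thesis .
  qed
qed

text \<open>A bind inherits the inequality from its two parts, and only \<open>Call\<close> changes
  the risk; a cut-off run counts 0. The failure bound is required for every query, even an
  ill-formed one, so \<open>ok\<close> has to be instantiated accordingly.\<close>

lemma risk_exec:
  assumes p: "p \<ge> 0" and fail: "\<And>Q. measure_pmf.prob (so Q) {x. \<not> ok Q x} \<le> p"
  shows "(\<integral>\<^sup>+r. ennreal (risk_option ok p N r) \<partial>measure_pmf (exec ch so k P \<sigma>)) \<le> ennreal (risk ok p N \<sigma>)"
proof -
  have bind: "(\<integral>\<^sup>+r. ennreal (risk_option ok p N r)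
        \<partial>measure_pmf (bind_pmf M (\<lambda>r. case r of None \<Rightarrow> return_pmf None | Some \<sigma>' \<Rightarrow> F \<sigma>')))
      \<le> ennreal (risk ok p N \<sigma>)"
    if start: "(\<integral>\<^sup>+r. ennreal (risk_option ok p N r) \<partial>measure_pmf M) \<le> ennreal (risk ok p N \<sigma>)"
      and step: "\<And>\<sigma>'. Some \<sigma>' \<in> set_pmf M \<Longrightarrow>
        (\<integral>\<^sup>+r. ennreal (risk_option ok p N r) \<partial>measure_pmf (F \<sigma>')) \<le> ennreal (risk ok p N \<sigma>')"
    for M F \<sigma>
  proof -
    have "(\<integral>\<^sup>+s. ennreal (risk_option ok p N s)
        \<partial>measure_pmf (case r of None \<Rightarrow> return_pmf None | Some \<sigma>' \<Rightarrow> F \<sigma>'))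
      \<le> ennreal (risk_option ok p N r)" if "r \<in> set_pmf M" for r
      using step that by (cases r) (auto simp: risk_option_def)
    then show ?thesis
      unfolding nn_integral_bind_pmf
      by (intro order_trans[OF nn_integral_mono_AE start] AE_pmfI)
  qed
  have tick: "risk ok p N (tick j \<sigma>) = risk ok p N \<sigma>" for j \<sigma>
    by (rule risk_cong) simp
  show ?thesis
    using fail
  proof (induction ch so k P \<sigma> rule: exec.induct[case_names Skip NWrite RWrite Seq Cond While0 While Call])
    case (Seq charge solve k c c' \<sigma>)
    show ?case
      unfolding exec.simps by (rule bind[OF Seq.IH(1) Seq.IH(2)]) (simp_all add: Seq.prems)
  next
    case (Cond charge solve k b c c' \<sigma>)
    then show ?case
      by (simp add: tick)
  next
    case (While charge solve k b c \<sigma>)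
    have ?case if b: "bval b \<sigma>"
      unfolding exec.simps if_P[OF b]
      using While.IH(1)[OF b] While.IH(2)[OF b] While.prems by (intro bind) (simp_all add: tick)
    moreover have ?case if "\<not> bval b \<sigma>"
      using that by (simp add: risk_option_def tick)
    ultimately show ?case
      by blast
  next
    case (Call charge solve k a z \<sigma>)
    have "stored_diffusion (tick 1 \<sigma>) a = stored_diffusion \<sigma> a"
      by (simp add: stored_diffusion_def stored_graph_def)
    then show ?case
      using risk_answer_call[OF p, of "solve (stored_diffusion \<sigma> a)" ok "tick 1 \<sigma>" a N charge z] Call
      by (simp add: risk_option_def tick)
  qed (simp_all add: risk_option_def risk_def)
qed

text \<open>Markov's inequality: on the support, \<open>few\<close> rules out the exceeded budget,
  so the indicator of a failed call is below the final risk, whose mean is at most the initial risk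
  p N.\<close>

lemma prob_failed_call_le:
  assumes "p \<ge> 0" "\<And>Q. measure_pmf.prob (so Q) {x. \<not> ok Q x} \<le> p"
    and "calls \<sigma> = []" "N \<ge> 0"
    and few: "\<And>\<sigma>'. Some \<sigma>' \<in> set_pmf (exec ch so k P \<sigma>) \<Longrightarrow> real (length (calls \<sigma>')) \<le> N"
  shows "measure_pmf.prob (exec ch so k P \<sigma>) {Some \<sigma>' | \<sigma>'. \<exists>(Q, x) \<in> set (calls \<sigma>'). \<not> ok Q x} \<le> p * N"
proof -
  let ?M = "exec ch so k P \<sigma>"
  let ?A = "{Some \<sigma>' | \<sigma>'. \<exists>(Q, x) \<in> set (calls \<sigma>'). \<not> ok Q x}"
  have "ennreal (measure_pmf.prob ?M ?A) = (\<integral>\<^sup>+r. indicator ?A r \<partial>measure_pmf ?M)"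
    by (simp add: measure_pmf.emeasure_eq_measure)
  also have "\<dots> \<le> (\<integral>\<^sup>+r. ennreal (risk_option ok p N r) \<partial>measure_pmf ?M)"
  proof (rule nn_integral_mono_AE, rule AE_pmfI)
    fix r assume r: "r \<in> set_pmf ?M"
    show "indicator ?A r \<le> ennreal (risk_option ok p N r)"
    proof (cases "r \<in> ?A")
      case True
      then obtain \<sigma>' where \<sigma>': "r = Some \<sigma>'" "\<exists>(Q, x) \<in> set (calls \<sigma>'). \<not> ok Q x"
        by blast
      then have "risk_option ok p N r = 1"
        using few[of \<sigma>'] r by (simp add: risk_option_def risk_def)
      then show ?thesis
        by (simp add: indicator_def)
    qed simp
  qed
  also have "\<dots> \<le> ennreal (risk ok p N \<sigma>)"
    by (rule risk_exec[OF assms(1,2)])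
  also have "risk ok p N \<sigma> = p * N"
    using assms(3,4) by (simp add: risk_def)
  finally show ?thesis
    using assms(1,4) by (simp add: ennreal_le_iff)
qed

section \<open>The program\<close>

lemma runs_Seq_NWrite [simp]:
  "runs ch so K (Seq (NWrite a i e) P) \<sigma> Q \<longleftrightarrow> runs ch so K P (tick (1 + ncost i + ncost e)
     (\<sigma>\<lparr>nmem := (nmem \<sigma>)(a := (nmem \<sigma> a)(nval i \<sigma> := nval e \<sigma>))\<rparr>)) Q"
  by (auto simp: runs_def bind_return_pmf)

lemma runs_Seq_RWrite [simp]:
  "runs ch so K (Seq (RWrite a i e) P) \<sigma> Q \<longleftrightarrow> runs ch so K P (tick (1 + ncost i + rcost e)
     (\<sigma>\<lparr>rmem := (rmem \<sigma>)(a := (rmem \<sigma> a)(nval i \<sigma> := rval e \<sigma>))\<rparr>)) Q"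
  by (auto simp: runs_def bind_return_pmf)

definition changes :: "nat set \<Rightarrow> nat set \<Rightarrow> config \<Rightarrow> config \<Rightarrow> bool" where
  "changes A B \<sigma> \<sigma>' \<longleftrightarrow> (\<forall>a. a \<notin> A \<longrightarrow> nmem \<sigma>' a = nmem \<sigma> a) \<and>
     (\<forall>a. a \<notin> B \<longrightarrow> rmem \<sigma>' a = rmem \<sigma> a) \<and> calls \<sigma>' = calls \<sigma>"

text \<open>The form in which loops are verified. \<open>J\<close> sees only the memory and, by
  \<open>cong\<close>, not the counter array, so bookkeeping steps preserve it; the upper limit
  \<open>hi\<close> must be stable under everything the loop may change.\<close>

lemma runs_For_frame:
  assumes v: "v \<in> A" and lo: "nval lo \<sigma> = a" "a \<le> h"
    and hi: "\<And>\<sigma>'. changes A B \<sigma> \<sigma>' \<Longrightarrow> nval hi \<sigma>' = h"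
    and init: "J a ((nmem \<sigma>)(v := (nmem \<sigma> v)(0 := a))) (rmem \<sigma>)"
    and cong: "\<And>i N R c. J i N R \<Longrightarrow> J i (N(v := c)) R"
    and body: "\<And>i \<sigma>'. a \<le> i \<Longrightarrow> i < h \<Longrightarrow> changes A B \<sigma> \<sigma>' \<Longrightarrow> nmem \<sigma>' v 0 = i \<Longrightarrow>
      J i (nmem \<sigma>') (rmem \<sigma>') \<Longrightarrow> runs ch so K P \<sigma>' (\<lambda>\<sigma>''. changes A B \<sigma>' \<sigma>'' \<and>
        nmem \<sigma>'' v 0 = i \<and> J (Suc i) (nmem \<sigma>'') (rmem \<sigma>'') \<and> time \<sigma>'' \<le> time \<sigma>' + t i)"
    and K': "K + (h - a) + 1 \<le> K'"
  shows "runs ch so K' (For v lo hi P) \<sigma> (\<lambda>\<sigma>'. changes A B \<sigma> \<sigma>' \<and> J h (nmem \<sigma>') (rmem \<sigma>') \<and>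
    time \<sigma>' \<le> time \<sigma> + (6 + real (ncost lo) + real (ncost hi)) + (\<Sum>i\<in>{a..<h}. t i + (10 + real (ncost hi))))"
proof -
  define I where "I i \<sigma>' \<longleftrightarrow> changes A B \<sigma> \<sigma>' \<and> nmem \<sigma>' v 0 = i \<and> a \<le> i \<and> J i (nmem \<sigma>') (rmem \<sigma>') \<and>
    time \<sigma>' \<le> time \<sigma> + (2 + real (ncost lo)) + (\<Sum>i\<in>{a..<i}. t i + (10 + real (ncost hi)))" for i \<sigma>'
  show ?thesis
  proof (rule runs_For[OF lo, of I])
    show "I a (tick (2 + ncost lo) (\<sigma>\<lparr>nmem := (nmem \<sigma>)(v := (nmem \<sigma> v)(0 := a))\<rparr>))"
      using init v by (auto simp: I_def changes_def)
    show "nmem \<sigma>' v 0 = i \<and> nval hi \<sigma>' = h" if "I i \<sigma>'" for i \<sigma>'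
      using that hi by (auto simp: I_def)
    show "runs ch so K P (tick (4 + ncost hi) \<sigma>')
      (\<lambda>\<sigma>''. I (Suc i) (tick 6 (\<sigma>''\<lparr>nmem := (nmem \<sigma>'')(v := (nmem \<sigma>'' v)(0 := Suc (nmem \<sigma>'' v 0)))\<rparr>)))"
      if "a \<le> i" "i < h" "I i \<sigma>'" for i \<sigma>'
    proof (rule runs_weaken[OF body[OF that(1,2)] order_refl])
      fix \<sigma>''
      assume \<sigma>'': "changes A B (tick (4 + ncost hi) \<sigma>') \<sigma>'' \<and> nmem \<sigma>'' v 0 = i \<and>
        J (Suc i) (nmem \<sigma>'') (rmem \<sigma>'') \<and> time \<sigma>'' \<le> time (tick (4 + ncost hi) \<sigma>') + t i"
      have "(\<Sum>i\<in>{a..<Suc i}. t i + (10 + real (ncost hi)))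
          = (\<Sum>i\<in>{a..<i}. t i + (10 + real (ncost hi))) + (t i + (10 + real (ncost hi)))"
        using that(1) by simp
      then show "I (Suc i) (tick 6 (\<sigma>''\<lparr>nmem := (nmem \<sigma>'')(v := (nmem \<sigma>'' v)(0 := Suc (nmem \<sigma>'' v 0)))\<rparr>))"
        using \<sigma>'' that v cong by (auto simp: I_def changes_def)
    qed (use that in \<open>auto simp: I_def changes_def\<close>)
    show "changes A B \<sigma> (tick (4 + ncost hi) \<sigma>') \<and> J h (nmem (tick (4 + ncost hi) \<sigma>')) (rmem (tick (4 + ncost hi) \<sigma>')) \<and>
      time (tick (4 + ncost hi) \<sigma>') \<le> time \<sigma> + (6 + real (ncost lo) + real (ncost hi)) +
        (\<Sum>i\<in>{a..<h}. t i + (10 + real (ncost hi)))" if "I h \<sigma>'" for \<sigma>'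
      using that by (auto simp: I_def changes_def)
  qed (use K' in simp)
qed

text \<open>Natural arrays: 20 and 21 are loop counters and 22 is the iteration counter \<open>k\<close>. Real arrays: 20 is
  \<open>\<kappa>\<close>, 21 the extrapolated point \<open>y\<close>, 22 and 23 the iterates \<open>x\<close> and \<open>v\<close>, 24 the linear term of the query,
  and 25 the answer. The query is assembled at base 6, around the graph \<open>H\<close> which is there already.\<close>

definition init_vertices :: prog where
  "init_vertices = For 20 (NConst 0) (counter 0)
     (Seq (NWrite 10 (counter 20) (NRead 4 (counter 20)))
     (Seq (RWrite 11 (counter 20) (RRead 5 (counter 20)))
     (Seq (RWrite 22 (counter 20) (ROfNat (NConst 0)))
          (RWrite 23 (counter 20) (ROfNat (NConst 0))))))"

text \<open>Array 3 is left out: the linear coefficients change with every query and are recomputed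
  by \<open>update_pieces\<close>. The other coefficients are copied once, as no iteration writes to
  them.\<close>

definition copy_pieces :: prog where
  "copy_pieces = For 20 (NRead 4 (NConst 0)) (NRead 4 (counter 0))
     (Seq (RWrite 7 (counter 20) (RRead 1 (counter 20)))
     (Seq (RWrite 8 (counter 20) (RRead 2 (counter 20)))
          (RWrite 10 (counter 20) (RRead 4 (counter 20)))))"

definition extrapolate :: prog where
  "extrapolate = For 20 (NConst 0) (counter 0)
     (Seq (RWrite 21 (counter 20)
        (RDiv (RAdd (RMul (ROfNat (counter 22)) (RRead 22 (counter 20)))
                    (RMul (ROfNat (NConst 2)) (RRead 23 (counter 20))))
              (RAdd (ROfNat (counter 22)) (ROfNat (NConst 2)))))
        (RWrite 24 (counter 20) (ROfNat (NConst 0))))"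

text \<open>\<open>f\<close> is \<open>RAdd\<close> or \<open>RSub\<close>, so that L(G) y is added
  and L(H) y subtracted by the same code.\<close>

definition add_flow :: "(rexp \<Rightarrow> rexp \<Rightarrow> rexp) \<Rightarrow> nat \<Rightarrow> nexp \<Rightarrow> nexp \<Rightarrow> prog" where
  "add_flow f a u v = RWrite 24 u (f (RRead 24 u)
     (RMul (RRead a (counter 20)) (RSub (RRead 21 u) (RRead 21 v))))"

definition add_laplacian :: "(rexp \<Rightarrow> rexp \<Rightarrow> rexp) \<Rightarrow> nat \<Rightarrow> prog" where
  "add_laplacian f a = For 20 (NConst 0) (counter (a + 1))
     (Seq (add_flow f a (NRead (a + 2) (counter 20)) (NRead (a + 3) (counter 20)))
          (add_flow f a (NRead (a + 3) (counter 20)) (NRead (a + 2) (counter 20))))"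

definition update_pieces :: prog where
  "update_pieces = For 20 (NConst 0) (counter 0)
     (For 21 (NRead 4 (counter 20)) (NRead 4 (NAdd (counter 20) (NConst 1)))
       (RWrite 9 (counter 21) (RAdd (RRead 3 (counter 21)) (RRead 24 (counter 20)))))"

text \<open>The order matters: the new \<open>v\<close> is computed from the old \<open>x\<close>,
  which the second assignment overwrites.\<close>

definition advance :: prog where
  "advance = For 20 (NConst 0) (counter 0)
     (Seq (RWrite 23 (counter 20) (RAdd (RRead 22 (counter 20))
        (RDiv (RMul (RSub (RRead 25 (counter 20)) (RRead 22 (counter 20)))
                    (RAdd (ROfNat (counter 22)) (ROfNat (NConst 2))))
              (ROfNat (NConst 2)))))
          (RWrite 22 (counter 20) (RRead 25 (counter 20))))"

definition write_result :: prog where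
  "write_result = For 20 (NConst 0) (counter 0) (RWrite 8 (counter 20) (RRead 22 (counter 20)))"

section \<open>Effect and time of the individual loops, with generous constants\<close>

lemma runs_init_vertices:
  assumes "nmem \<sigma> 0 0 + 1 \<le> K"
  shows "runs ch so K init_vertices \<sigma> (\<lambda>\<sigma>'. changes {10, 20} {11, 22, 23} \<sigma> \<sigma>' \<and>
    (\<forall>u < nmem \<sigma> 0 0. nmem \<sigma>' 10 u = nmem \<sigma> 4 u \<and> rmem \<sigma>' 11 u = rmem \<sigma> 5 u \<and>
       rmem \<sigma>' 22 u = 0 \<and> rmem \<sigma>' 23 u = 0) \<and>
    time \<sigma>' \<le> time \<sigma> + 20 + 100 * real (nmem \<sigma> 0 0))"
  unfolding init_vertices_def
  by (rule runs_weaken[OF runs_For_frame[where A = "{10, 20}" and B = "{11, 22, 23}" and a = 0 and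
        h = "nmem \<sigma> 0 0" and K = 0 and t = "\<lambda>_. 60" and
        J = "\<lambda>i N R. \<forall>u<i. N 10 u = nmem \<sigma> 4 u \<and> R 11 u = rmem \<sigma> 5 u \<and> R 22 u = 0 \<and> R 23 u = 0"]])
    (use assms in \<open>auto simp: changes_def less_Suc_eq\<close>)

lemma runs_copy_pieces:
  assumes "nmem \<sigma> 4 0 \<le> nmem \<sigma> 4 (nmem \<sigma> 0 0)" "nmem \<sigma> 4 (nmem \<sigma> 0 0) - nmem \<sigma> 4 0 + 1 \<le> K"
  shows "runs ch so K copy_pieces \<sigma> (\<lambda>\<sigma>'. changes {20} {7, 8, 10} \<sigma> \<sigma>' \<and>
    (\<forall>j. nmem \<sigma> 4 0 \<le> j \<and> j < nmem \<sigma> 4 (nmem \<sigma> 0 0) \<longrightarrow>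
       rmem \<sigma>' 7 j = rmem \<sigma> 1 j \<and> rmem \<sigma>' 8 j = rmem \<sigma> 2 j \<and> rmem \<sigma>' 10 j = rmem \<sigma> 4 j) \<and>
    time \<sigma>' \<le> time \<sigma> + 20 + 100 * real (nmem \<sigma> 4 (nmem \<sigma> 0 0) - nmem \<sigma> 4 0))"
  unfolding copy_pieces_def
  by (rule runs_weaken[OF runs_For_frame[where A = "{20}" and B = "{7, 8, 10}" and a = "nmem \<sigma> 4 0" and
        h = "nmem \<sigma> 4 (nmem \<sigma> 0 0)" and K = 0 and t = "\<lambda>_. 60" and
        J = "\<lambda>i N R. \<forall>j. nmem \<sigma> 4 0 \<le> j \<and> j < i \<longrightarrow>
          R 7 j = rmem \<sigma> 1 j \<and> R 8 j = rmem \<sigma> 2 j \<and> R 10 j = rmem \<sigma> 4 j"]])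
    (use assms in \<open>auto simp: changes_def less_Suc_eq of_nat_diff\<close>)

lemma runs_extrapolate:
  assumes "nmem \<sigma> 0 0 + 1 \<le> K"
  shows "runs ch so K extrapolate \<sigma> (\<lambda>\<sigma>'. changes {20} {21, 24} \<sigma> \<sigma>' \<and>
    (\<forall>u < nmem \<sigma> 0 0. rmem \<sigma>' 24 u = 0 \<and> rmem \<sigma>' 21 u =
       (real (nmem \<sigma> 22 0) * rmem \<sigma> 22 u + 2 * rmem \<sigma> 23 u) / (real (nmem \<sigma> 22 0) + 2)) \<and>
    time \<sigma>' \<le> time \<sigma> + 20 + 100 * real (nmem \<sigma> 0 0))"
  unfolding extrapolate_def
  by (rule runs_weaken[OF runs_For_frame[where A = "{20}" and B = "{21, 24}" and a = 0 and
        h = "nmem \<sigma> 0 0" and K = 0 and t = "\<lambda>_. 60" and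
        J = "\<lambda>i N R. \<forall>u<i. R 24 u = 0 \<and> R 21 u =
       (real (nmem \<sigma> 22 0) * rmem \<sigma> 22 u + 2 * rmem \<sigma> 23 u) / (real (nmem \<sigma> 22 0) + 2)"]])
    (use assms in \<open>auto simp: changes_def less_Suc_eq\<close>)

lemma runs_advance:
  assumes "nmem \<sigma> 0 0 + 1 \<le> K"
  shows "runs ch so K advance \<sigma> (\<lambda>\<sigma>'. changes {20} {22, 23} \<sigma> \<sigma>' \<and>
    (\<forall>u < nmem \<sigma> 0 0. rmem \<sigma>' 22 u = rmem \<sigma> 25 u \<and> rmem \<sigma>' 23 u =
       rmem \<sigma> 22 u + (rmem \<sigma> 25 u - rmem \<sigma> 22 u) * (real (nmem \<sigma> 22 0) + 2) / 2) \<and>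
    time \<sigma>' \<le> time \<sigma> + 20 + 100 * real (nmem \<sigma> 0 0))"
  unfolding advance_def
  by (rule runs_weaken[OF runs_For_frame[where A = "{20}" and B = "{22, 23}" and a = 0 and
        h = "nmem \<sigma> 0 0" and K = 0 and t = "\<lambda>_. 60" and
        J = "\<lambda>i N R. (\<forall>u\<ge>i. R 22 u = rmem \<sigma> 22 u) \<and> (\<forall>u<i. R 22 u = rmem \<sigma> 25 u \<and> R 23 u =
       rmem \<sigma> 22 u + (rmem \<sigma> 25 u - rmem \<sigma> 22 u) * (real (nmem \<sigma> 22 0) + 2) / 2)"]])
    (use assms in \<open>auto simp: changes_def less_Suc_eq\<close>)

lemma runs_write_result:
  assumes "nmem \<sigma> 0 0 + 1 \<le> K"
  shows "runs ch so K write_result \<sigma> (\<lambda>\<sigma>'. changes {20} {8} \<sigma> \<sigma>' \<and>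
    (\<forall>u < nmem \<sigma> 0 0. rmem \<sigma>' 8 u = rmem \<sigma> 22 u) \<and>
    time \<sigma>' \<le> time \<sigma> + 20 + 100 * real (nmem \<sigma> 0 0))"
  unfolding write_result_def
  by (rule runs_weaken[OF runs_For_frame[where A = "{20}" and B = "{8}" and a = 0 and
        h = "nmem \<sigma> 0 0" and K = 0 and t = "\<lambda>_. 60" and
        J = "\<lambda>i N R. \<forall>u<i. R 8 u = rmem \<sigma> 22 u"]])
    (use assms in \<open>auto simp: changes_def less_Suc_eq\<close>)


lemma edge_stored_graph:
  assumes "e < nmem \<sigma> (a + 1) 0"
  shows "edge_src (stored_graph \<sigma> a) e = nmem \<sigma> (a + 2) e"
    "edge_tgt (stored_graph \<sigma> a) e = nmem \<sigma> (a + 3) e"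
    "conductance (stored_graph \<sigma> a) e = rmem \<sigma> a e"
  using assms by (simp_all add: stored_graph_def edge_src_def edge_tgt_def conductance_def)

lemma num_edges_stored_graph [simp]: "num_edges (stored_graph \<sigma> a) = nmem \<sigma> (a + 1) 0"
  by (simp add: stored_graph_def num_edges_def)

text \<open>\<open>s\<close> is the sign of \<open>f\<close>, and the invariant is the partial sum
  over the first i edges. The bound on \<open>a\<close> keeps the arrays of the graph apart from the
  counter 20 and the accumulator 24.\<close>

lemma runs_add_laplacian:
  assumes f: "\<And>e e' \<sigma>. rval (f e e') \<sigma> = rval e \<sigma> + s * rval e' \<sigma>"
    "\<And>e e'. rcost (f e e') = 1 + rcost e + rcost e'"
    and a: "a < 15" and K: "nmem \<sigma> (a + 1) 0 + 1 \<le> K"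
  shows "runs ch so K (add_laplacian f a) \<sigma> (\<lambda>\<sigma>'. changes {20} {24} \<sigma> \<sigma>' \<and>
    (\<forall>j. rmem \<sigma>' 24 j = rmem \<sigma> 24 j + s * laplacian_apply (stored_graph \<sigma> a) (rmem \<sigma> 21) j) \<and>
    time \<sigma>' \<le> time \<sigma> + 20 + 100 * real (nmem \<sigma> (a + 1) 0))"
proof -
  let ?u = "nmem \<sigma> (a + 2)" and ?v = "nmem \<sigma> (a + 3)" and ?y = "rmem \<sigma> 21" and ?w = "rmem \<sigma> a"
  define L where "L i j = (\<Sum>e<i. ?w e * (?y (?u e) - ?y (?v e)) * (of_bool (j = ?u e) - of_bool (j = ?v e)))"
    for i j
  have L: "laplacian_apply (stored_graph \<sigma> a) ?y j = L (nmem \<sigma> (a + 1) 0) j" for j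
    unfolding laplacian_apply_def L_def num_edges_stored_graph
    by (intro sum.cong) (simp_all add: edge_stored_graph)
  show ?thesis
    unfolding add_laplacian_def
  proof (rule runs_weaken[OF runs_For_frame[where A = "{20}" and B = "{24}" and a = 0 and
        h = "nmem \<sigma> (a + 1) 0" and K = 0 and t = "\<lambda>_. 70" and
        J = "\<lambda>i N R. \<forall>j. R 24 j = rmem \<sigma> 24 j + s * L i j"]])
    show "nval (counter (a + 1)) \<sigma>' = nmem \<sigma> (a + 1) 0" if "changes {20} {24} \<sigma> \<sigma>'" for \<sigma>'
      using that a by (simp add: changes_def)
    fix i \<sigma>'
    assume i: "i < nmem \<sigma> (a + 1) 0" and ch: "changes {20} {24} \<sigma> \<sigma>'" and c: "nmem \<sigma>' 20 0 = i"
      and J: "\<forall>j. rmem \<sigma>' 24 j = rmem \<sigma> 24 j + s * L i j"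
    have mem: "nmem \<sigma>' (a + 2) = ?u" "nmem \<sigma>' (a + 3) = ?v" "rmem \<sigma>' 21 = ?y" "rmem \<sigma>' a = ?w"
      using ch a by (auto simp: changes_def)
    have ne: "a + 2 \<noteq> 20" "a + 3 \<noteq> 20" "a \<noteq> 24"
      using a by auto
    show "runs ch so 0 (Seq (add_flow f a (NRead (a + 2) (counter 20)) (NRead (a + 3) (counter 20)))
        (add_flow f a (NRead (a + 3) (counter 20)) (NRead (a + 2) (counter 20)))) \<sigma>'
      (\<lambda>\<sigma>''. changes {20} {24} \<sigma>' \<sigma>'' \<and> nmem \<sigma>'' 20 0 = i \<and>
        (\<forall>j. rmem \<sigma>'' 24 j = rmem \<sigma> 24 j + s * L (Suc i) j) \<and> time \<sigma>'' \<le> time \<sigma>' + 70)"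
      unfolding add_flow_def
      using J mem ne c by (auto simp: f changes_def L_def algebra_simps)
  qed (use K L in \<open>auto simp: L_def\<close>)
qed

text \<open>Monotone offsets make the index ranges of the vertices disjoint, so the inner loop
  preserves what earlier vertices have written. Its running times telescope to the total number of
  pieces.\<close>

lemma runs_update_pieces:
  assumes mono: "\<And>u. u < nmem \<sigma> 0 0 \<Longrightarrow> nmem \<sigma> 4 u \<le> nmem \<sigma> 4 (Suc u)"
    and K: "nmem \<sigma> 0 0 + (nmem \<sigma> 4 (nmem \<sigma> 0 0) - nmem \<sigma> 4 0) + 2 \<le> K"
  shows "runs ch so K update_pieces \<sigma> (\<lambda>\<sigma>'. changes {20, 21} {9} \<sigma> \<sigma>' \<and>
    (\<forall>u < nmem \<sigma> 0 0. \<forall>j. nmem \<sigma> 4 u \<le> j \<and> j < nmem \<sigma> 4 (Suc u) \<longrightarrow>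
       rmem \<sigma>' 9 j = rmem \<sigma> 3 j + rmem \<sigma> 24 u) \<and>
    time \<sigma>' \<le> time \<sigma> + 20 + 100 * real (nmem \<sigma> 0 0 + (nmem \<sigma> 4 (nmem \<sigma> 0 0) - nmem \<sigma> 4 0)))"
proof -
  let ?n = "nmem \<sigma> 0 0" and ?o = "nmem \<sigma> 4"
  have mono': "?o u \<le> ?o u'" if "u \<le> u'" "u' \<le> ?n" for u u'
    using that by (induction rule: dec_induct) (auto intro: order_trans[OF _ mono])
  have tele: "(\<Sum>i\<in>{0..<k}. real (?o (Suc i) - ?o i)) = real (?o k - ?o 0)" if "k \<le> ?n" for k
    using that
  proof (induction k)
    case (Suc k)
    then show ?case
      using mono'[of 0 k] mono[of k] by (simp add: of_nat_diff)
  qed simp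
  have inner: "runs ch so (?o ?n - ?o 0 + 1)
      (For 21 (NRead 4 (counter 20)) (NRead 4 (NAdd (counter 20) (NConst 1)))
        (RWrite 9 (counter 21) (RAdd (RRead 3 (counter 21)) (RRead 24 (counter 20))))) \<sigma>1
      (\<lambda>\<sigma>2. changes {20, 21} {9} \<sigma>1 \<sigma>2 \<and> nmem \<sigma>2 20 0 = i \<and>
        (\<forall>u<Suc i. \<forall>j. ?o u \<le> j \<and> j < ?o (Suc u) \<longrightarrow> rmem \<sigma>2 9 j = rmem \<sigma> 3 j + rmem \<sigma> 24 u) \<and>
        time \<sigma>2 \<le> time \<sigma>1 + (30 + 60 * real (?o (Suc i) - ?o i)))"
    if i: "i < ?n" and ch: "changes {20, 21} {9} \<sigma> \<sigma>1" and c: "nmem \<sigma>1 20 0 = i"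
      and J: "\<forall>u<i. \<forall>j. ?o u \<le> j \<and> j < ?o (Suc u) \<longrightarrow> rmem \<sigma>1 9 j = rmem \<sigma> 3 j + rmem \<sigma> 24 u"
    for i \<sigma>1
  proof (rule runs_weaken[OF runs_For_frame[where A = "{21}" and B = "{9}" and a = "?o i" and
        h = "?o (Suc i)" and K = 0 and t = "\<lambda>_. 40" and \<sigma> = \<sigma>1 and
        J = "\<lambda>k N R. (\<forall>j<?o i. R 9 j = rmem \<sigma>1 9 j) \<and>
          (\<forall>j. ?o i \<le> j \<and> j < k \<longrightarrow> R 9 j = rmem \<sigma> 3 j + rmem \<sigma> 24 i)"]])
    have mem: "nmem \<sigma>1 4 = ?o" "rmem \<sigma>1 3 = rmem \<sigma> 3" "rmem \<sigma>1 24 = rmem \<sigma> 24"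
      using ch by (auto simp: changes_def)
    show "nval (NRead 4 (counter 20)) \<sigma>1 = ?o i" "?o i \<le> ?o (Suc i)"
      using mem c mono i by simp_all
    show "nval (NRead 4 (NAdd (counter 20) (NConst 1))) \<sigma>' = ?o (Suc i)"
      if "changes {21} {9} \<sigma>1 \<sigma>'" for \<sigma>'
      using that mem c by (simp add: changes_def)
    have "?o (Suc i) \<le> ?o ?n" "?o 0 \<le> ?o i"
      using mono' i by simp_all
    then show "?o (Suc i) - ?o i + 1 \<le> ?o ?n - ?o 0 + 1" "0 + (?o (Suc i) - ?o i) + 1 \<le> ?o (Suc i) - ?o i + 1"
      by simp_all
    show "runs ch so 0 (RWrite 9 (counter 21) (RAdd (RRead 3 (counter 21)) (RRead 24 (counter 20)))) \<sigma>'
       (\<lambda>\<sigma>''. changes {21} {9} \<sigma>' \<sigma>'' \<and> nmem \<sigma>'' 21 0 = k \<and>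
         ((\<forall>j<?o i. rmem \<sigma>'' 9 j = rmem \<sigma>1 9 j) \<and>
          (\<forall>j. ?o i \<le> j \<and> j < Suc k \<longrightarrow> rmem \<sigma>'' 9 j = rmem \<sigma> 3 j + rmem \<sigma> 24 i)) \<and>
         time \<sigma>'' \<le> time \<sigma>' + 40)"
      if "?o i \<le> k" "changes {21} {9} \<sigma>1 \<sigma>'" "nmem \<sigma>' 21 0 = k"
        "(\<forall>j<?o i. rmem \<sigma>' 9 j = rmem \<sigma>1 9 j) \<and>
         (\<forall>j. ?o i \<le> j \<and> j < k \<longrightarrow> rmem \<sigma>' 9 j = rmem \<sigma> 3 j + rmem \<sigma> 24 i)" for k \<sigma>'
      using that mem c by (auto simp: changes_def less_Suc_eq)
    fix \<sigma>2
    assume *: "changes {21} {9} \<sigma>1 \<sigma>2 \<and> ((\<forall>j<?o i. rmem \<sigma>2 9 j = rmem \<sigma>1 9 j) \<and>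
        (\<forall>j. ?o i \<le> j \<and> j < ?o (Suc i) \<longrightarrow> rmem \<sigma>2 9 j = rmem \<sigma> 3 j + rmem \<sigma> 24 i)) \<and>
      time \<sigma>2 \<le> time \<sigma>1 + (6 + real (ncost (NRead 4 (counter 20))) +
          real (ncost (NRead 4 (NAdd (counter 20) (NConst 1))))) +
        (\<Sum>k\<in>{?o i..<?o (Suc i)}. 40 + (10 + real (ncost (NRead 4 (NAdd (counter 20) (NConst 1))))))"
    have "rmem \<sigma>2 9 j = rmem \<sigma> 3 j + rmem \<sigma> 24 u" if "u < Suc i" "?o u \<le> j" "j < ?o (Suc u)" for u j
    proof (cases "u = i")
      case False
      then have "?o (Suc u) \<le> ?o i"
        using that(1) i by (intro mono') auto
      then show ?thesis
        using * J that False by auto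
    qed (use * that in auto)
    then show "changes {20, 21} {9} \<sigma>1 \<sigma>2 \<and> nmem \<sigma>2 20 0 = i \<and>
        (\<forall>u<Suc i. \<forall>j. ?o u \<le> j \<and> j < ?o (Suc u) \<longrightarrow> rmem \<sigma>2 9 j = rmem \<sigma> 3 j + rmem \<sigma> 24 u) \<and>
        time \<sigma>2 \<le> time \<sigma>1 + (30 + 60 * real (?o (Suc i) - ?o i))"
      using * c by (auto simp: changes_def)
  qed auto
  show ?thesis
    unfolding update_pieces_def
  proof (rule runs_weaken[OF runs_For_frame[where A = "{20, 21}" and B = "{9}" and a = 0 and
        h = "?n" and K = "?o ?n - ?o 0 + 1" and t = "\<lambda>i. 30 + 60 * real (?o (Suc i) - ?o i)" and
        J = "\<lambda>i N R. \<forall>u<i. \<forall>j. ?o u \<le> j \<and> j < ?o (Suc u) \<longrightarrow> R 9 j = rmem \<sigma> 3 j + rmem \<sigma> 24 u"]])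
    show "nval (counter 0) \<sigma>' = ?n" if "changes {20, 21} {9} \<sigma> \<sigma>'" for \<sigma>'
      using that by (simp add: changes_def)
    fix \<sigma>'
    assume "changes {20, 21} {9} \<sigma> \<sigma>' \<and>
      (\<forall>u<?n. \<forall>j. ?o u \<le> j \<and> j < ?o (Suc u) \<longrightarrow> rmem \<sigma>' 9 j = rmem \<sigma> 3 j + rmem \<sigma> 24 u) \<and>
      time \<sigma>' \<le> time \<sigma> + (6 + real (ncost (NConst 0)) + real (ncost (counter 0))) +
        (\<Sum>i\<in>{0..<?n}. 30 + 60 * real (?o (Suc i) - ?o i) + (10 + real (ncost (counter 0))))"
    moreover have "(\<Sum>i\<in>{0..<?n}. 30 + 60 * real (?o (Suc i) - ?o i) + (10 + real (ncost (counter 0))))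
        = 42 * real ?n + 60 * real (?o ?n - ?o 0)"
      using tele[of ?n] by (simp add: sum.distrib sum_distrib_left[symmetric])
    ultimately show "changes {20, 21} {9} \<sigma> \<sigma>' \<and>
      (\<forall>u<?n. \<forall>j. ?o u \<le> j \<and> j < ?o (Suc u) \<longrightarrow> rmem \<sigma>' 9 j = rmem \<sigma> 3 j + rmem \<sigma> 24 u) \<and>
      time \<sigma>' \<le> time \<sigma> + 20 + 100 * real (?n + (?o ?n - ?o 0))"
      by simp
  qed (use K inner in auto)
qed

lemma runs_Seq':
  assumes "runs ch so K P \<sigma> R" "\<And>\<sigma>'. R \<sigma>' \<Longrightarrow> runs ch so K P' \<sigma>' Q"
  shows "runs ch so K (Seq P P') \<sigma> Q"
  using assms by (intro runs_Seq runs_weaken[OF assms(1) order_refl])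

definition iteration :: prog where
  "iteration = Seq extrapolate (Seq (add_laplacian RAdd 0) (Seq (add_laplacian RSub 6)
     (Seq update_pieces (Seq (Call 6 25) (Seq advance
       (NWrite 22 (NConst 0) (NAdd (counter 22) (NConst 1))))))))"

text \<open>Squaring avoids the square root: the loop stops at the first k with k + 1 \<ge> 5 sqrt
  \<kappa>.\<close>

definition unfinished :: bexp where
  "unfinished = RLess
     (RMul (ROfNat (NAdd (counter 22) (NConst 1))) (ROfNat (NAdd (counter 22) (NConst 1))))
     (RMul (ROfNat (NConst 25)) (RRead 20 (NConst 0)))"

text \<open>\<kappa> is saved first because \<open>copy_pieces\<close> overwrites real array 7. Real
  array 8 holds pieces of the query during the loop and the result afterwards, so the result is
  written last. Of the n + 1 offsets, \<open>init_vertices\<close> copies n and the separate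
  assignment the last one.\<close>

definition accelerated_solver :: prog where
  "accelerated_solver = Seq (RWrite 20 (NConst 0) (RRead 7 (NConst 0)))
     (Seq (NWrite 22 (NConst 0) (NConst 0)) (Seq init_vertices
       (Seq (NWrite 10 (counter 0) (NRead 4 (counter 0))) (Seq copy_pieces
         (Seq (While unfinished iteration) write_result)))))"

section \<open>Correctness of the program on a fixed input\<close>

locale accelerated_run = sparsified_instance +
  fixes \<sigma>\<^sub>0 :: config and ch :: "diffusion \<Rightarrow> real" and so :: "diffusion \<Rightarrow> (nat \<Rightarrow> real) pmf"
    and \<tau> \<delta> :: real
  assumes input: "input_config D H \<kappa> \<sigma>\<^sub>0"
    and charge: "\<And>y. ch (prox_query D H y) \<le> \<tau>"
    and \<delta>: "\<delta> > 0" "13250 * \<kappa> ^ 4 * \<delta> \<le> 1"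
begin

abbreviation n :: nat where "n \<equiv> num_verts D"
abbreviation off :: "nat \<Rightarrow> nat" where "off \<equiv> nmem \<sigma>\<^sub>0 4"
abbreviation work :: nat where
  "work \<equiv> n + num_edges (graph D) + num_edges H + total_size D"

lemma D_eq: "D = stored_diffusion \<sigma>\<^sub>0 0" and H_eq: "H = stored_graph \<sigma>\<^sub>0 6"
  and \<kappa>_eq: "rmem \<sigma>\<^sub>0 7 0 = \<kappa>"
  using input by (simp_all add: input_config_def)

lemma n_eq: "nmem \<sigma>\<^sub>0 0 0 = n" "nmem \<sigma>\<^sub>0 6 0 = n"
proof -
  show "nmem \<sigma>\<^sub>0 0 0 = n"
    by (subst D_eq) (simp add: stored_diffusion_def stored_graph_def)
  show "nmem \<sigma>\<^sub>0 6 0 = n"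
    using verts_H by (subst (asm) H_eq) (simp add: stored_graph_def)
qed

lemma graph_D_eq: "graph D = stored_graph \<sigma>\<^sub>0 0"
  by (subst D_eq) (simp add: stored_diffusion_def)

lemma num_edges_eq: "nmem \<sigma>\<^sub>0 1 0 = num_edges (graph D)" "nmem \<sigma>\<^sub>0 7 0 = num_edges H"
  unfolding graph_D_eq by (simp, subst H_eq, simp)

lemma weights_eq:
  "weights D = map (\<lambda>u. map (\<lambda>j. (rmem \<sigma>\<^sub>0 1 j, rmem \<sigma>\<^sub>0 2 j, rmem \<sigma>\<^sub>0 3 j, rmem \<sigma>\<^sub>0 4 j))
     [off u ..< off (Suc u)]) [0..<n]"
  by (subst D_eq) (simp add: stored_diffusion_def n_eq(1) numeral_2_eq_2)

lemma bound_eq: "bound D = map (rmem \<sigma>\<^sub>0 5) [0..<n]"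
  by (subst D_eq) (simp add: stored_diffusion_def n_eq(1))

lemma off_less:
  assumes "u < n"
  shows "off u < off (Suc u)"
proof -
  have "splits (weights D ! u) \<noteq> []"
    using diffusion_dataD(2)[OF data assms] by (simp add: vwf_def)
  then show ?thesis
    using assms by (simp add: weights_eq splits_def)
qed

lemma off_mono: "u \<le> u' \<Longrightarrow> u' \<le> n \<Longrightarrow> off u \<le> off u'"
  by (induction rule: dec_induct) (auto intro: order_trans[OF _ less_imp_le[OF off_less]])

lemma total_size_eq: "total_size D = off n - off 0"
proof -
  have "(\<Sum>u\<leftarrow>[0..<k]. off (Suc u) - off u) = off k - off 0" if "k \<le> n" for k
    using that
  proof (induction k)
    case (Suc k)
    then show ?case
      using off_mono[of 0 k] off_less[of k] by simp
  qed simp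
  then show ?thesis
    by (simp add: total_size_def weights_eq comp_def)
qed

text \<open>A VWF has at least one piece, so the offsets increase strictly. This charges the loops
  over vertices to the VWF size.\<close>

lemma n_le_total_size: "n \<le> total_size D"
proof -
  have "off 0 + k \<le> off k" if "k \<le> n" for k
    using that
  proof (induction k)
    case (Suc k)
    then show ?case
      using off_less[of k] by simp
  qed simp
  from this[of n] show ?thesis
    by (simp add: total_size_eq)
qed

definition prepared :: "config \<Rightarrow> bool" where
  "prepared \<sigma> \<longleftrightarrow> (\<forall>a<10. nmem \<sigma> a = nmem \<sigma>\<^sub>0 a) \<and> (\<forall>a<7. rmem \<sigma> a = rmem \<sigma>\<^sub>0 a) \<and>
     (\<forall>u\<le>n. nmem \<sigma> 10 u = off u) \<and> (\<forall>u<n. rmem \<sigma> 11 u = rmem \<sigma>\<^sub>0 5 u) \<and> rmem \<sigma> 20 0 = \<kappa> \<and>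
     (\<forall>j. off 0 \<le> j \<and> j < off n \<longrightarrow>
        rmem \<sigma> 7 j = rmem \<sigma>\<^sub>0 1 j \<and> rmem \<sigma> 8 j = rmem \<sigma>\<^sub>0 2 j \<and> rmem \<sigma> 10 j = rmem \<sigma>\<^sub>0 4 j)"

lemma prepared_changes:
  assumes "prepared \<sigma>" "changes {20, 21, 22} {9, 21, 22, 23, 24, 25} \<sigma> \<sigma>'"
  shows "prepared \<sigma>'"
  using assms by (auto simp: prepared_def changes_def)

lemma prepared_simps:
  assumes "prepared \<sigma>"
  shows "nmem \<sigma> 0 0 = n" "nmem \<sigma> 4 = off" "nmem \<sigma> 1 0 = num_edges (graph D)"
    "nmem \<sigma> 7 0 = num_edges H" "rmem \<sigma> 3 = rmem \<sigma>\<^sub>0 3" "rmem \<sigma> 20 0 = \<kappa>"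
    "stored_graph \<sigma> 0 = graph D" "stored_graph \<sigma> 6 = H"
proof -
  show "stored_graph \<sigma> 0 = graph D"
    using assms unfolding graph_D_eq by (simp add: prepared_def stored_graph_def)
  show "stored_graph \<sigma> 6 = H"
    using assms by (subst H_eq) (simp add: prepared_def stored_graph_def)
qed (use assms n_eq num_edges_eq in \<open>auto simp: prepared_def\<close>)

lemma stored_query:
  assumes \<sigma>: "prepared \<sigma>"
    and q: "\<And>u j. u < n \<Longrightarrow> off u \<le> j \<Longrightarrow> j < off (Suc u) \<Longrightarrow>
      rmem \<sigma> 9 j = rmem \<sigma>\<^sub>0 3 j + (laplacian_apply (graph D) y u - laplacian_apply H y u)"
  shows "stored_diffusion \<sigma> 6 = prox_query D H y"
proof -
  have "map (\<lambda>u. map (\<lambda>j. (rmem \<sigma> 7 j, rmem \<sigma> 8 j, rmem \<sigma> 9 j, rmem \<sigma> 10 j))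
        [nmem \<sigma> 10 u ..< nmem \<sigma> 10 (Suc u)]) [0..<n]
      = map (\<lambda>u. add_linear (laplacian_apply (graph D) y u - laplacian_apply H y u) (weights D ! u)) [0..<n]"
  proof (rule map_cong[OF refl])
    fix u assume "u \<in> set [0..<n]"
    then have u: "u < n"
      by simp
    have "off 0 \<le> off u" "off (Suc u) \<le> off n"
      using u by (auto intro: off_mono)
    then show "map (\<lambda>j. (rmem \<sigma> 7 j, rmem \<sigma> 8 j, rmem \<sigma> 9 j, rmem \<sigma> 10 j))
        [nmem \<sigma> 10 u ..< nmem \<sigma> 10 (Suc u)]
      = add_linear (laplacian_apply (graph D) y u - laplacian_apply H y u) (weights D ! u)"
      using \<sigma> u q[OF u] by (auto simp: weights_eq add_linear_def prepared_def)
  qed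
  moreover have "map (rmem \<sigma> 11) [0..<n] = bound D"
    using \<sigma> by (auto simp: bound_eq prepared_def)
  moreover have "nmem \<sigma> 6 0 = n"
    using \<sigma> n_eq(2) by (simp add: prepared_def)
  ultimately show ?thesis
    using prepared_simps(8)[OF \<sigma>] by (simp add: stored_diffusion_def prox_query_def)
qed

text \<open>Only \<open>accel_inv\<close> is conditional on the accuracy of the answers so far;
  time, number of calls and shape of the queries are asserted for every run. The iteration counter
  doubles as the number of calls.\<close>

definition loop_inv :: "nat \<Rightarrow> config \<Rightarrow> bool" where
  "loop_inv k \<sigma> \<longleftrightarrow> prepared \<sigma> \<and> nmem \<sigma> 22 0 = k \<and> ((real k)\<^sup>2 < 25 * \<kappa> \<or> k = 0) \<and>
     length (calls \<sigma>) = k \<and> (\<forall>(Q, x) \<in> set (calls \<sigma>). \<exists>y. Q = prox_query D H y) \<and>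
     ((\<forall>(Q, x) \<in> set (calls \<sigma>). approx_optimal (1 + \<delta>) Q x) \<longrightarrow>
        accel_inv k (rmem \<sigma> 22) (rmem \<sigma> 23)) \<and>
     time \<sigma> \<le> 1000 * real work + real k * (1000 * real work + \<tau>)"

lemma work_pos: "real work \<ge> 1"
  using G by (simp add: wf_graph_def)

lemma runs_iteration:
  assumes inv: "loop_inv k \<sigma>" and k: "(real k + 1)\<^sup>2 < 25 * \<kappa>" and K: "work + 2 \<le> K"
  shows "runs ch so K iteration (tick (1 + bcost unfinished) \<sigma>) (loop_inv (Suc k))"
proof -
  let ?t = "real (1 + bcost unfinished)" and ?w = "real work"
  let ?x = "rmem \<sigma> 22" and ?v = "rmem \<sigma> 23"
  have t: "?t \<le> 30"
    by (simp add: unfinished_def)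
  have prep: "prepared \<sigma>" and k22: "nmem \<sigma> 22 0 = k"
    using inv by (auto simp: loop_inv_def)
  note mem = prepared_simps[OF prep]
  define y where "y u = (real k * ?x u + 2 * ?v u) / (real k + 2)" for u
  show ?thesis
    unfolding iteration_def
  proof (rule runs_Seq'[OF runs_extrapolate])
    show "nmem (tick (1 + bcost unfinished) \<sigma>) 0 0 + 1 \<le> K"
      using K mem(1) by simp
    fix \<sigma>1
    assume "changes {20} {21, 24} (tick (1 + bcost unfinished) \<sigma>) \<sigma>1 \<and>
      (\<forall>u < nmem (tick (1 + bcost unfinished) \<sigma>) 0 0. rmem \<sigma>1 24 u = 0 \<and> rmem \<sigma>1 21 u =
        (real (nmem (tick (1 + bcost unfinished) \<sigma>) 22 0) * rmem (tick (1 + bcost unfinished) \<sigma>) 22 u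
         + 2 * rmem (tick (1 + bcost unfinished) \<sigma>) 23 u) / (real (nmem (tick (1 + bcost unfinished) \<sigma>) 22 0) + 2)) \<and>
      time \<sigma>1 \<le> time (tick (1 + bcost unfinished) \<sigma>) + 20 + 100 * real (nmem (tick (1 + bcost unfinished) \<sigma>) 0 0)"
    then have ch1: "changes {20} {21, 24} \<sigma> \<sigma>1" and y1: "\<And>u. u < n \<Longrightarrow> rmem \<sigma>1 21 u = y u"
      and l1: "\<And>u. u < n \<Longrightarrow> rmem \<sigma>1 24 u = 0" and t1: "time \<sigma>1 \<le> time \<sigma> + 50 + 100 * real n"
      using mem(1) k22 t by (auto simp: changes_def y_def)
    have prep1: "prepared \<sigma>1"
      using ch1 by (intro prepared_changes[OF prep]) (auto simp: changes_def)
    \<comment> \<open>The query is described by the array as it stands in memory, which agrees with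
      the extrapolated point on the vertices; \<open>accel_step\<close> asks for no more.\<close>
    define y' where "y' = rmem \<sigma>1 21"
    show "runs ch so K (Seq (add_laplacian RAdd 0) (Seq (add_laplacian RSub 6) (Seq update_pieces
      (Seq (Call 6 25) (Seq advance (NWrite 22 (NConst 0) (NAdd (counter 22) (NConst 1)))))))) \<sigma>1
      (loop_inv (Suc k))"
    proof (rule runs_Seq'[OF runs_add_laplacian[where s = 1]])
      show "nmem \<sigma>1 (0 + 1) 0 + 1 \<le> K"
        using K prepared_simps(3)[OF prep1] by simp
      fix \<sigma>2
      assume "changes {20} {24} \<sigma>1 \<sigma>2 \<and>
        (\<forall>j. rmem \<sigma>2 24 j = rmem \<sigma>1 24 j + 1 * laplacian_apply (stored_graph \<sigma>1 0) (rmem \<sigma>1 21) j) \<and>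
        time \<sigma>2 \<le> time \<sigma>1 + 20 + 100 * real (nmem \<sigma>1 (0 + 1) 0)"
      then have ch2: "changes {20} {24} \<sigma>1 \<sigma>2"
        and l2: "\<And>u. u < n \<Longrightarrow> rmem \<sigma>2 24 u = laplacian_apply (graph D) y' u"
        and t2: "time \<sigma>2 \<le> time \<sigma> + 70 + 100 * real (n + num_edges (graph D))"
        using prepared_simps[OF prep1] l1 t1 by (auto simp: y'_def)
      have prep2: "prepared \<sigma>2"
        using ch2 by (intro prepared_changes[OF prep1]) (auto simp: changes_def)
      show "runs ch so K (Seq (add_laplacian RSub 6) (Seq update_pieces
        (Seq (Call 6 25) (Seq advance (NWrite 22 (NConst 0) (NAdd (counter 22) (NConst 1))))))) \<sigma>2
        (loop_inv (Suc k))"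
      proof (rule runs_Seq'[OF runs_add_laplacian[where s = "-1"]])
        show "nmem \<sigma>2 (6 + 1) 0 + 1 \<le> K"
          using K prepared_simps(4)[OF prep2] by simp
        fix \<sigma>3
        assume "changes {20} {24} \<sigma>2 \<sigma>3 \<and>
          (\<forall>j. rmem \<sigma>3 24 j = rmem \<sigma>2 24 j + - 1 * laplacian_apply (stored_graph \<sigma>2 6) (rmem \<sigma>2 21) j) \<and>
          time \<sigma>3 \<le> time \<sigma>2 + 20 + 100 * real (nmem \<sigma>2 (6 + 1) 0)"
        moreover have "rmem \<sigma>2 21 = y'"
          using ch2 by (simp add: changes_def y'_def)
        ultimately have ch3: "changes {20} {24} \<sigma>2 \<sigma>3"
          and l3: "\<And>u. u < n \<Longrightarrow> rmem \<sigma>3 24 u = laplacian_apply (graph D) y' u - laplacian_apply H y' u"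
          and t3: "time \<sigma>3 \<le> time \<sigma> + 90 + 100 * real (n + num_edges (graph D) + num_edges H)"
          using prepared_simps[OF prep2] l2 t2 by auto
        have prep3: "prepared \<sigma>3"
          using ch3 by (intro prepared_changes[OF prep2]) (auto simp: changes_def)
        note mem3 = prepared_simps[OF prep3]
        show "runs ch so K (Seq update_pieces
          (Seq (Call 6 25) (Seq advance (NWrite 22 (NConst 0) (NAdd (counter 22) (NConst 1)))))) \<sigma>3
          (loop_inv (Suc k))"
        proof (rule runs_Seq'[OF runs_update_pieces])
          show "nmem \<sigma>3 4 u \<le> nmem \<sigma>3 4 (Suc u)" if "u < nmem \<sigma>3 0 0" for u
            using that off_less[of u] mem3 by simp
          show "nmem \<sigma>3 0 0 + (nmem \<sigma>3 4 (nmem \<sigma>3 0 0) - nmem \<sigma>3 4 0) + 2 \<le> K"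
            using K mem3 total_size_eq by simp
          fix \<sigma>4
          assume "changes {20, 21} {9} \<sigma>3 \<sigma>4 \<and>
            (\<forall>u < nmem \<sigma>3 0 0. \<forall>j. nmem \<sigma>3 4 u \<le> j \<and> j < nmem \<sigma>3 4 (Suc u) \<longrightarrow>
               rmem \<sigma>4 9 j = rmem \<sigma>3 3 j + rmem \<sigma>3 24 u) \<and>
            time \<sigma>4 \<le> time \<sigma>3 + 20 + 100 * real (nmem \<sigma>3 0 0 + (nmem \<sigma>3 4 (nmem \<sigma>3 0 0) - nmem \<sigma>3 4 0))"
          then have ch4: "changes {20, 21} {9} \<sigma>3 \<sigma>4"
            and q4: "\<And>u j. u < n \<Longrightarrow> off u \<le> j \<Longrightarrow> j < off (Suc u) \<Longrightarrow>
              rmem \<sigma>4 9 j = rmem \<sigma>\<^sub>0 3 j + (laplacian_apply (graph D) y' u - laplacian_apply H y' u)"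
            and t4: "time \<sigma>4 \<le> time \<sigma> + 110 + 200 * ?w"
            using mem3 l3 t3 total_size_eq by auto
          have prep4: "prepared \<sigma>4"
            using ch4 by (intro prepared_changes[OF prep3]) (auto simp: changes_def)
          have query: "stored_diffusion \<sigma>4 6 = prox_query D H y'"
            by (rule stored_query[OF prep4 q4])
          have ch04: "changes {20, 21} {9, 21, 24} \<sigma> \<sigma>4"
            using ch1 ch2 ch3 ch4 by (auto simp: changes_def)
          show "runs ch so K (Seq (Call 6 25)
            (Seq advance (NWrite 22 (NConst 0) (NAdd (counter 22) (NConst 1))))) \<sigma>4 (loop_inv (Suc k))"
          proof (rule runs_Seq, unfold runs_Call, rule ballI)
            fix z
            define \<sigma>5 where "\<sigma>5 = answer_call ch 6 25 z (tick 1 \<sigma>4)"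
            have "stored_diffusion (tick 1 \<sigma>4) 6 = prox_query D H y'"
              using query by (simp add: stored_diffusion_def stored_graph_def)
            then have \<sigma>5: "nmem \<sigma>5 = nmem \<sigma>4" "\<And>a. a \<noteq> 25 \<Longrightarrow> rmem \<sigma>5 a = rmem \<sigma>4 a"
              "\<And>u. u < n \<Longrightarrow> rmem \<sigma>5 25 u = z u" "calls \<sigma>5 = calls \<sigma>4 @ [(prox_query D H y', z)]"
              "time \<sigma>5 = time \<sigma>4 + 1 + ch (prox_query D H y')"
              by (simp_all add: \<sigma>5_def answer_call_def Let_def)
            have prep5: "prepared \<sigma>5"
              using prep4 \<sigma>5(1,2) by (simp add: prepared_def)
            have mem5: "nmem \<sigma>5 22 0 = k" "rmem \<sigma>5 22 = ?x" "nmem \<sigma>5 0 0 = n"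
              using ch04 \<sigma>5(1,2) k22 prepared_simps(1)[OF prep5] by (simp_all add: changes_def)
            have "runs ch so K (Seq advance (NWrite 22 (NConst 0) (NAdd (counter 22) (NConst 1)))) \<sigma>5
              (loop_inv (Suc k))"
            proof (rule runs_Seq'[OF runs_advance])
              show "nmem \<sigma>5 0 0 + 1 \<le> K"
                using K mem5(3) by simp
              fix \<sigma>6
              assume *: "changes {20} {22, 23} \<sigma>5 \<sigma>6 \<and>
                (\<forall>u < nmem \<sigma>5 0 0. rmem \<sigma>6 22 u = rmem \<sigma>5 25 u \<and> rmem \<sigma>6 23 u =
                  rmem \<sigma>5 22 u + (rmem \<sigma>5 25 u - rmem \<sigma>5 22 u) * (real (nmem \<sigma>5 22 0) + 2) / 2) \<and>
                time \<sigma>6 \<le> time \<sigma>5 + 20 + 100 * real (nmem \<sigma>5 0 0)"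
              define \<sigma>7 where "\<sigma>7 = tick 6 (\<sigma>6\<lparr>nmem := (nmem \<sigma>6)(22 := (nmem \<sigma>6 22)(0 := Suc k))\<rparr>)"
              have prep7: "prepared \<sigma>7"
                using * by (intro prepared_changes[OF prep5]) (auto simp: changes_def \<sigma>7_def)
              have calls7: "calls \<sigma>7 = calls \<sigma> @ [(prox_query D H y', z)]"
                using * ch04 \<sigma>5(4) by (simp add: \<sigma>7_def changes_def)
              have acc: "accel_inv (Suc k) (rmem \<sigma>7 22) (rmem \<sigma>7 23)"
                if "\<forall>(Q, x) \<in> set (calls \<sigma>7). approx_optimal (1 + \<delta>) Q x"
              proof (rule accel_step[OF _ k \<delta>])
                show "accel_inv k ?x ?v"
                  using that inv by (simp add: calls7 loop_inv_def)
                show "approx_optimal (1 + \<delta>) (prox_query D H y') z"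
                  using that by (simp add: calls7)
                show "y' u = (real k * ?x u + 2 * ?v u) / (real k + 2)" if "u < n" for u
                  using y1[OF that] by (simp add: y'_def y_def)
                show "rmem \<sigma>7 22 u = z u" if "u < n" for u
                  using * that mem5 \<sigma>5(3) by (simp add: \<sigma>7_def)
                show "rmem \<sigma>7 23 u = ?x u + (z u - ?x u) * (real k + 2) / 2" if "u < n" for u
                  using * that mem5 \<sigma>5(3) by (simp add: \<sigma>7_def)
              qed
              have "time \<sigma>7 \<le> time \<sigma> + (137 + 300 * ?w) + \<tau>"
                using * t4 mem5(3) \<sigma>5(5) charge[of y'] by (simp add: \<sigma>7_def)
              also have "137 + 300 * w \<le> 1000 * w" if "1 \<le> w" for w :: real
                using that by linarith
              note this[OF work_pos]
              finally have t7: "time \<sigma>7 \<le> 1000 * ?w + real (Suc k) * (1000 * ?w + \<tau>)"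
                using inv by (simp add: loop_inv_def algebra_simps)
              have "loop_inv (Suc k) \<sigma>7"
                unfolding loop_inv_def
              proof (intro conjI)
                show "(real (Suc k))\<^sup>2 < 25 * \<kappa> \<or> Suc k = 0"
                  using k by (simp add: add.commute)
                show "\<forall>(Q, x) \<in> set (calls \<sigma>7). \<exists>y. Q = prox_query D H y"
                  using inv by (auto simp: calls7 loop_inv_def)
                show "length (calls \<sigma>7) = Suc k"
                  using inv by (simp add: calls7 loop_inv_def)
              qed (use prep7 acc t7 in \<open>simp_all add: \<sigma>7_def\<close>)
              then show "runs ch so K (NWrite 22 (NConst 0) (NAdd (counter 22) (NConst 1))) \<sigma>6 (loop_inv (Suc k))"
                using * mem5(1) by (simp add: \<sigma>7_def changes_def numeral_eq_Suc)
            qed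
            then show "runs ch so K (Seq advance (NWrite 22 (NConst 0) (NAdd (counter 22) (NConst 1))))
              (answer_call ch 6 25 z (tick 1 \<sigma>4)) (loop_inv (Suc k))"
              by (simp add: \<sigma>5_def)
          qed
        qed
      qed auto
    qed auto
  qed
qed


text \<open>The bound on loop iterations merely has to exist, so the crude 5 \<kappa> serves there;
  the 5 sqrt \<kappa> calls come from the invariant.\<close>

lemma runs_loop:
  assumes K: "work + 2 + nat \<lceil>5 * \<kappa>\<rceil> + 1 \<le> K" and init: "loop_inv 0 \<sigma>"
  shows "runs ch so K (While unfinished iteration) \<sigma> (\<lambda>\<sigma>'. prepared \<sigma>' \<and>
    real (length (calls \<sigma>')) \<le> 5 * sqrt \<kappa> \<and> (\<forall>(Q, x) \<in> set (calls \<sigma>'). \<exists>y. Q = prox_query D H y) \<and>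
    ((\<forall>(Q, x) \<in> set (calls \<sigma>'). approx_optimal (1 + \<delta>) Q x) \<longrightarrow> approx_optimal 2 D (rmem \<sigma>' 22)) \<and>
    time \<sigma>' \<le> 30 + 1000 * real work + real (length (calls \<sigma>')) * (1000 * real work + \<tau>))"
proof -
  have cond: "bval unfinished \<sigma> \<longleftrightarrow> (real k + 1)\<^sup>2 < 25 * \<kappa>" if "loop_inv k \<sigma>" for k \<sigma>
  proof -
    have "rmem \<sigma> 20 0 = \<kappa>" "nmem \<sigma> 22 0 = k"
      using that by (auto simp: loop_inv_def prepared_def)
    then show ?thesis
      by (simp add: unfinished_def power2_eq_square algebra_simps)
  qed
  show ?thesis
  proof (rule runs_weaken[OF runs_While[of loop_inv unfinished, where K = "work + 2" and N = "nat \<lceil>5 * \<kappa>\<rceil>"]])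
    fix k \<sigma>
    assume inv: "loop_inv k \<sigma>"
    show "runs ch so (work + 2) iteration (tick (1 + bcost unfinished) \<sigma>) (loop_inv (Suc k))"
      if "bval unfinished \<sigma>"
      using that cond[OF inv] by (intro runs_iteration inv) auto
    have "real k \<le> 5 * \<kappa>"
      using inv by (intro iteration_count_le) (simp add: loop_inv_def)
    then show "k \<le> nat \<lceil>5 * \<kappa>\<rceil>"
      by linarith
    have "real k \<le> sqrt (25 * \<kappa>)"
      using inv \<kappa> by (intro real_le_rsqrt) (auto simp: loop_inv_def)
    then have "real k \<le> 5 * sqrt \<kappa>"
      by (simp add: real_sqrt_mult)
    moreover have "approx_optimal 2 D (rmem \<sigma> 22)"
      if "\<not> bval unfinished \<sigma>" "\<forall>(Q, x) \<in> set (calls \<sigma>). approx_optimal (1 + \<delta>) Q x"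
      using that inv cond[OF inv] by (intro accel_inv_approx_optimal[of k]) (auto simp: loop_inv_def)
    moreover have "prepared (tick j \<sigma>)" if "prepared \<sigma>" for j
      using that by (simp add: prepared_def)
    moreover have "real (1 + bcost unfinished) \<le> 30"
      by (simp add: unfinished_def)
    ultimately show "prepared (tick (1 + bcost unfinished) \<sigma>) \<and>
      real (length (calls (tick (1 + bcost unfinished) \<sigma>))) \<le> 5 * sqrt \<kappa> \<and>
      (\<forall>(Q, x) \<in> set (calls (tick (1 + bcost unfinished) \<sigma>)). \<exists>y. Q = prox_query D H y) \<and>
      ((\<forall>(Q, x) \<in> set (calls (tick (1 + bcost unfinished) \<sigma>)). approx_optimal (1 + \<delta>) Q x) \<longrightarrow>
        approx_optimal 2 D (rmem (tick (1 + bcost unfinished) \<sigma>) 22)) \<and>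
      time (tick (1 + bcost unfinished) \<sigma>) \<le> 30 + 1000 * real work +
        real (length (calls (tick (1 + bcost unfinished) \<sigma>))) * (1000 * real work + \<tau>)"
      if "\<not> bval unfinished \<sigma>"
      using inv that unfolding loop_inv_def by auto
  qed (use K init in auto)
qed

lemma runs_accelerated_solver:
  assumes K: "work + 2 + nat \<lceil>5 * \<kappa>\<rceil> + 1 \<le> K"
  shows "runs ch so K accelerated_solver \<sigma>\<^sub>0 (\<lambda>\<sigma>'. real (length (calls \<sigma>')) \<le> 5 * sqrt \<kappa> \<and>
    (\<forall>(Q, x) \<in> set (calls \<sigma>'). \<exists>y. Q = prox_query D H y) \<and>
    ((\<forall>(Q, x) \<in> set (calls \<sigma>'). approx_optimal (1 + \<delta>) Q x) \<longrightarrow> approx_optimal 2 D (result \<sigma>')) \<and>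
    time \<sigma>' \<le> 2000 * real work + real (length (calls \<sigma>')) * (1000 * real work + \<tau>))"
proof -
  define \<sigma>1 where "\<sigma>1 = tick (1 + ncost (NConst 0) + ncost (NConst 0))
    ((tick (1 + ncost (NConst 0) + rcost (RRead 7 (NConst 0)))
       (\<sigma>\<^sub>0\<lparr>rmem := (rmem \<sigma>\<^sub>0)(20 := (rmem \<sigma>\<^sub>0 20)(0 := \<kappa>))\<rparr>))
     \<lparr>nmem := (nmem \<sigma>\<^sub>0)(22 := (nmem \<sigma>\<^sub>0 22)(0 := 0))\<rparr>)"
  have zero: "time \<sigma>\<^sub>0 = 0" "calls \<sigma>\<^sub>0 = []"
    using input by (simp_all add: input_config_def)
  have "runs ch so K (Seq init_vertices
       (Seq (NWrite 10 (counter 0) (NRead 4 (counter 0))) (Seq copy_pieces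
         (Seq (While unfinished iteration) write_result)))) \<sigma>1 (\<lambda>\<sigma>'. real (length (calls \<sigma>')) \<le> 5 * sqrt \<kappa> \<and>
    (\<forall>(Q, x) \<in> set (calls \<sigma>'). \<exists>y. Q = prox_query D H y) \<and>
    ((\<forall>(Q, x) \<in> set (calls \<sigma>'). approx_optimal (1 + \<delta>) Q x) \<longrightarrow> approx_optimal 2 D (result \<sigma>')) \<and>
    time \<sigma>' \<le> 2000 * real work + real (length (calls \<sigma>')) * (1000 * real work + \<tau>))"
    (is "runs ch so K _ \<sigma>1 ?Q")
  proof (rule runs_Seq'[OF runs_init_vertices])
    have n1: "nmem \<sigma>1 0 0 = n"
      by (simp add: \<sigma>1_def n_eq)
    then show "nmem \<sigma>1 0 0 + 1 \<le> K"
      using K by simp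
    fix \<sigma>2
    assume *: "changes {10, 20} {11, 22, 23} \<sigma>1 \<sigma>2 \<and>
      (\<forall>u < nmem \<sigma>1 0 0. nmem \<sigma>2 10 u = nmem \<sigma>1 4 u \<and> rmem \<sigma>2 11 u = rmem \<sigma>1 5 u \<and>
         rmem \<sigma>2 22 u = 0 \<and> rmem \<sigma>2 23 u = 0) \<and>
      time \<sigma>2 \<le> time \<sigma>1 + 20 + 100 * real (nmem \<sigma>1 0 0)"
    have c2: "\<And>a. a \<notin> {10, 20} \<Longrightarrow> nmem \<sigma>2 a = nmem \<sigma>1 a"
      "\<And>a. a \<notin> {11, 22, 23} \<Longrightarrow> rmem \<sigma>2 a = rmem \<sigma>1 a" "calls \<sigma>2 = []"
      using * zero by (auto simp: changes_def \<sigma>1_def)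
    define \<sigma>3 where "\<sigma>3 = tick 6 (\<sigma>2\<lparr>nmem := (nmem \<sigma>2)(10 := (nmem \<sigma>2 10)(n := off n))\<rparr>)"
    have c3: "\<And>a. a < 10 \<Longrightarrow> nmem \<sigma>3 a = nmem \<sigma>\<^sub>0 a" "nmem \<sigma>3 22 0 = 0"
      "\<And>a. a < 11 \<Longrightarrow> rmem \<sigma>3 a = rmem \<sigma>\<^sub>0 a" "rmem \<sigma>3 20 0 = \<kappa>"
      "\<And>u. u \<le> n \<Longrightarrow> nmem \<sigma>3 10 u = off u" "\<And>u. u < n \<Longrightarrow> rmem \<sigma>3 11 u = rmem \<sigma>\<^sub>0 5 u"
      "\<And>u. u < n \<Longrightarrow> rmem \<sigma>3 22 u = 0" "\<And>u. u < n \<Longrightarrow> rmem \<sigma>3 23 u = 0"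
      "calls \<sigma>3 = []" "time \<sigma>3 \<le> 50 + 100 * real n"
      using * c2 n1 zero by (auto simp: \<sigma>3_def \<sigma>1_def)
    have "runs ch so K (Seq copy_pieces (Seq (While unfinished iteration) write_result)) \<sigma>3 ?Q"
    proof (rule runs_Seq'[OF runs_copy_pieces])
      have o3: "nmem \<sigma>3 0 0 = n" "nmem \<sigma>3 4 = off"
        using c3(1) n_eq by simp_all
      then show "nmem \<sigma>3 4 0 \<le> nmem \<sigma>3 4 (nmem \<sigma>3 0 0)"
        using off_mono by simp
      show "nmem \<sigma>3 4 (nmem \<sigma>3 0 0) - nmem \<sigma>3 4 0 + 1 \<le> K"
        using o3 K total_size_eq by simp
      fix \<sigma>4
      assume *: "changes {20} {7, 8, 10} \<sigma>3 \<sigma>4 \<and>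
        (\<forall>j. nmem \<sigma>3 4 0 \<le> j \<and> j < nmem \<sigma>3 4 (nmem \<sigma>3 0 0) \<longrightarrow>
          rmem \<sigma>4 7 j = rmem \<sigma>3 1 j \<and> rmem \<sigma>4 8 j = rmem \<sigma>3 2 j \<and> rmem \<sigma>4 10 j = rmem \<sigma>3 4 j) \<and>
        time \<sigma>4 \<le> time \<sigma>3 + 20 + 100 * real (nmem \<sigma>3 4 (nmem \<sigma>3 0 0) - nmem \<sigma>3 4 0)"
      have "time \<sigma>4 \<le> 70 + 100 * real n + 100 * real (total_size D)"
        using * c3(10) o3 total_size_eq by simp
      also have "\<dots> \<le> 70 + 100 * real work"
        by simp
      finally have t4: "time \<sigma>4 \<le> 70 + 100 * real work" .
      have prep4: "prepared \<sigma>4"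
        unfolding prepared_def using * c3 o3 by (auto simp: changes_def)
      have acc: "accel_inv 0 (rmem \<sigma>4 22) (rmem \<sigma>4 23)"
        using * c3(7,8) by (intro accel_inv_init) (auto simp: changes_def)
      have t4': "70 + 100 * w \<le> 1000 * w" if "1 \<le> w" for w :: real
        using that by linarith
      have inv: "loop_inv 0 \<sigma>4"
        unfolding loop_inv_def using prep4 acc * c3(2,9) order_trans[OF t4 t4'[OF work_pos]]
        by (auto simp: changes_def)
      show "runs ch so K (Seq (While unfinished iteration) write_result) \<sigma>4 ?Q"
      proof (rule runs_Seq'[OF runs_loop[OF K inv]])
        fix \<sigma>5
        assume 5: "prepared \<sigma>5 \<and> real (length (calls \<sigma>5)) \<le> 5 * sqrt \<kappa> \<and>
          (\<forall>(Q, x) \<in> set (calls \<sigma>5). \<exists>y. Q = prox_query D H y) \<and>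
          ((\<forall>(Q, x) \<in> set (calls \<sigma>5). approx_optimal (1 + \<delta>) Q x) \<longrightarrow> approx_optimal 2 D (rmem \<sigma>5 22)) \<and>
          time \<sigma>5 \<le> 30 + 1000 * real work + real (length (calls \<sigma>5)) * (1000 * real work + \<tau>)"
        then have n5: "nmem \<sigma>5 0 0 = n"
          using prepared_simps(1) by blast
        show "runs ch so K write_result \<sigma>5 ?Q"
        proof (rule runs_weaken[OF runs_write_result order_refl])
          show "nmem \<sigma>5 0 0 + 1 \<le> K"
            using K n5 by simp
          fix \<sigma>6
          assume 6: "changes {20} {8} \<sigma>5 \<sigma>6 \<and> (\<forall>u < nmem \<sigma>5 0 0. rmem \<sigma>6 8 u = rmem \<sigma>5 22 u) \<and>
            time \<sigma>6 \<le> time \<sigma>5 + 20 + 100 * real (nmem \<sigma>5 0 0)"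
          have "approx_optimal 2 D (rmem \<sigma>6 8) \<longleftrightarrow> approx_optimal 2 D (rmem \<sigma>5 22)"
            using 6 n5 feasible_cong[of D "rmem \<sigma>6 8" "rmem \<sigma>5 22"]
              energy_cong[OF data, of "rmem \<sigma>6 8" "rmem \<sigma>5 22"] by (simp add: approx_optimal_def)
          moreover have "calls \<sigma>6 = calls \<sigma>5"
            using 6 by (simp add: changes_def)
          moreover have "50 + 1000 * w + 100 * w' \<le> 2000 * w" if "1 \<le> w" "w' \<le> w" for w w' :: real
            using that by linarith
          from this[OF work_pos, of "real n"] have "50 + 1000 * real work + 100 * real n \<le> 2000 * real work"
            by simp
          ultimately show "?Q \<sigma>6"
            using 5 6 n5 by (simp add: result_def)
        qed
      qed
    qed
    then show "runs ch so K (Seq (NWrite 10 (counter 0) (NRead 4 (counter 0))) (Seq copy_pieces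
        (Seq (While unfinished iteration) write_result))) \<sigma>2 ?Q"
      using c2(1) n_eq by (simp add: \<sigma>3_def \<sigma>1_def numeral_eq_Suc)
  qed
  then show ?thesis
    unfolding accelerated_solver_def by (simp add: \<sigma>1_def \<kappa>_eq)
qed

end


text \<open>n^(4 \<open>c\<^sub>0\<close>) absorbs \<kappa>^4, and n^14 \<ge> 2^14 = 16384 absorbs
  13250.\<close>

lemma small_accuracy:
  assumes n: "real n \<ge> 2" and \<kappa>: "0 \<le> \<kappa>" "\<kappa> \<le> real n powr c\<^sub>0" and c: "c \<ge> 4 * c\<^sub>0 + 14"
  shows "13250 * \<kappa> ^ 4 * real n powr - c \<le> 1"
proof -
  have "\<kappa> ^ 4 \<le> (real n powr c\<^sub>0) ^ 4"
    using \<kappa> by (intro power_mono)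
  also have "\<dots> = real n powr (4 * c\<^sub>0)"
    using n by (simp add: powr_realpow[symmetric] powr_powr mult.commute)
  finally have "\<kappa> ^ 4 \<le> real n powr (4 * c\<^sub>0)" .
  moreover have "real n powr - c \<le> real n powr - (4 * c\<^sub>0 + 14)"
    using n c by (intro powr_mono) auto
  ultimately have "\<kappa> ^ 4 * real n powr - c \<le> real n powr (4 * c\<^sub>0) * real n powr - (4 * c\<^sub>0 + 14)"
    by (intro mult_mono) auto
  also have "\<dots> = real n powr -14"
    by (simp add: powr_add[symmetric])
  also have "\<dots> \<le> 2 powr -14"
    using n by (intro powr_mono2') auto
  also have "\<dots> = 1 / 16384"
    by (simp add: powr_minus_divide)
  finally show ?thesis
    by simp
qed

theorem lemma4p3:
  fixes c\<^sub>0 :: real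
  assumes "c\<^sub>0 > 0"
  shows "\<exists>P :: prog. \<forall>C\<^sub>1 :: nat. \<exists>(C :: nat) (c\<^sub>1 :: real). \<forall>c \<ge> c\<^sub>1.
    \<forall>(D :: diffusion) (H :: wgraph) (\<kappa> :: real) (S :: nat)
      (solve :: diffusion \<Rightarrow> (nat \<Rightarrow> real) pmf) (T :: nat \<Rightarrow> nat \<Rightarrow> real \<Rightarrow> real) (\<sigma> :: config).
      c > 0 \<and>
      diffusion_instance D \<and> total_size D \<le> C\<^sub>1 * S \<and>
      wf_graph H \<and> spectral_sparsifier \<kappa> (graph D) H \<and>
      1 \<le> \<kappa> \<and> \<kappa> \<le> real (num_edges (graph D)) \<and>
      poly_bounded c\<^sub>0 (num_verts D) (input_numbers D H \<kappa>) \<and>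
      approx_solver c solve \<and> solver_time T \<and>
      input_config D H \<kappa> \<sigma> \<longrightarrow>
      (\<exists>k. let run = exec (call_time T c) solve k P \<sigma> in
        None \<notin> set_pmf run \<and>
        (\<forall>\<sigma>'. Some \<sigma>' \<in> set_pmf run \<longrightarrow>
           time \<sigma>' \<le> real C * sqrt \<kappa> * (real (num_edges (graph D))
             + T (num_edges H) (C * S) (accuracy c (num_verts D))) \<and>
           real (length (calls \<sigma>')) \<le> real C * sqrt \<kappa> \<and>
           (\<forall>(Q, x) \<in> set (calls \<sigma>').
              diffusion_instance Q \<and> graph Q = H \<and> total_size Q \<le> C * S) \<and>
           ((\<forall>(Q, x) \<in> set (calls \<sigma>'). approx_optimal (accuracy c (num_verts D)) Q x) \<longrightarrow>
              approx_optimal 2 D (result \<sigma>'))) \<and>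
        measure_pmf.prob run {Some \<sigma>' | \<sigma>'. approx_optimal 2 D (result \<sigma>')}
          \<ge> 1 - real C * sqrt \<kappa> / real (num_verts D) ^ 10)"
proof (rule exI[of _ accelerated_solver], rule allI)
  fix C\<^sub>1 :: nat
  \<comment> \<open>7005 = 2000 + 5 times 1001, from the setup and from 5 sqrt \<kappa> iterations
    of cost at most 1001 \<open>U\<close> each. The summand with factor 2 covers the vertices and
    the pieces, each at most \<open>C\<^sub>1 * S\<close>.\<close>
  let ?C = "7005 + 2 * C\<^sub>1"
  show "\<exists>(C :: nat) (c\<^sub>1 :: real). \<forall>c \<ge> c\<^sub>1.
    \<forall>(D :: diffusion) (H :: wgraph) (\<kappa> :: real) (S :: nat)
      (solve :: diffusion \<Rightarrow> (nat \<Rightarrow> real) pmf) (T :: nat \<Rightarrow> nat \<Rightarrow> real \<Rightarrow> real) (\<sigma> :: config).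
      c > 0 \<and>
      diffusion_instance D \<and> total_size D \<le> C\<^sub>1 * S \<and>
      wf_graph H \<and> spectral_sparsifier \<kappa> (graph D) H \<and>
      1 \<le> \<kappa> \<and> \<kappa> \<le> real (num_edges (graph D)) \<and>
      poly_bounded c\<^sub>0 (num_verts D) (input_numbers D H \<kappa>) \<and>
      approx_solver c solve \<and> solver_time T \<and>
      input_config D H \<kappa> \<sigma> \<longrightarrow>
      (\<exists>k. let run = exec (call_time T c) solve k accelerated_solver \<sigma> in
        None \<notin> set_pmf run \<and>
        (\<forall>\<sigma>'. Some \<sigma>' \<in> set_pmf run \<longrightarrow>
           time \<sigma>' \<le> real C * sqrt \<kappa> * (real (num_edges (graph D))
             + T (num_edges H) (C * S) (accuracy c (num_verts D))) \<and>
           real (length (calls \<sigma>')) \<le> real C * sqrt \<kappa> \<and>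
           (\<forall>(Q, x) \<in> set (calls \<sigma>').
              diffusion_instance Q \<and> graph Q = H \<and> total_size Q \<le> C * S) \<and>
           ((\<forall>(Q, x) \<in> set (calls \<sigma>'). approx_optimal (accuracy c (num_verts D)) Q x) \<longrightarrow>
              approx_optimal 2 D (result \<sigma>'))) \<and>
        measure_pmf.prob run {Some \<sigma>' | \<sigma>'. approx_optimal 2 D (result \<sigma>')}
          \<ge> 1 - real C * sqrt \<kappa> / real (num_verts D) ^ 10)"
  proof (rule exI[of _ ?C], rule exI[of _ "4 * c\<^sub>0 + 14"], intro allI impI, elim conjE)
    fix c D H \<kappa> S solve T \<sigma>
    assume c: "4 * c\<^sub>0 + 14 \<le> (c :: real)" and D: "diffusion_instance D"
      and S: "total_size D \<le> C\<^sub>1 * S" and H: "wf_graph H" and sp: "spectral_sparsifier \<kappa> (graph D) H"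
      and \<kappa>: "1 \<le> \<kappa>" "\<kappa> \<le> real (num_edges (graph D))"
      and poly: "poly_bounded c\<^sub>0 (num_verts D) (input_numbers D H \<kappa>)"
      and solve: "approx_solver c solve" and T: "solver_time T" and input: "input_config D H \<kappa> \<sigma>"
    let ?n = "num_verts D" and ?m = "real (num_edges (graph D))"
    define \<delta> where "\<delta> = real ?n powr - c"
    define \<tau> where "\<tau> = T (num_edges H) (total_size D) (accuracy c ?n)"
    have "0 < num_edges (graph D)"
      using \<kappa> by simp
    \<comment> \<open>An edge exists since 1 \<le> \<kappa> \<le> m, and its end points are
      distinct.\<close>
    then have n2: "real ?n \<ge> 2"
      using wf_graphD(1-3)[of "graph D" 0] D by (auto simp: diffusion_instance_def)
    have "\<kappa> \<in> input_numbers D H \<kappa>"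
      by (simp add: input_numbers_def)
    then have "\<kappa> \<le> real ?n powr c\<^sub>0"
      using poly \<kappa>(1) by (fastforce simp: poly_bounded_def)
    then have \<delta>: "\<delta> > 0" "13250 * \<kappa> ^ 4 * \<delta> \<le> 1"
      using small_accuracy[OF n2 _ _ c] \<kappa>(1) n2 by (auto simp: \<delta>_def)
    interpret sparsified_instance D H \<kappa>
      using D H sp \<kappa>(1) by unfold_locales
    interpret accelerated_run D H \<kappa> \<sigma> "call_time T c" solve \<tau> \<delta>
      using input \<delta> by unfold_locales (simp_all add: call_time_def \<tau>_def)
    let ?K = "work + 2 + nat \<lceil>5 * \<kappa>\<rceil> + 1"
    define run where "run = exec (call_time T c) solve ?K accelerated_solver \<sigma>"
    have run: "\<exists>\<sigma>'. r = Some \<sigma>' \<and> real (length (calls \<sigma>')) \<le> 5 * sqrt \<kappa> \<and>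
        (\<forall>(Q, x) \<in> set (calls \<sigma>'). \<exists>y. Q = prox_query D H y) \<and>
        ((\<forall>(Q, x) \<in> set (calls \<sigma>'). approx_optimal (1 + \<delta>) Q x) \<longrightarrow> approx_optimal 2 D (result \<sigma>')) \<and>
        time \<sigma>' \<le> 2000 * real work + real (length (calls \<sigma>')) * (1000 * real work + \<tau>)"
      if "r \<in> set_pmf run" for r
      using runs_accelerated_solver[OF order_refl] that unfolding runs_def run_def by blast
    define U where "U = ?m + T (num_edges H) (?C * S) (accuracy c ?n)"
    have "real (num_edges H + ?C * S) \<le> T (num_edges H) (?C * S) (accuracy c ?n)"
      using T by (simp only: solver_time_def)
    moreover have "work \<le> num_edges (graph D) + (num_edges H + ?C * S)"
      using S n_le_total_size by (simp add: algebra_simps)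
    then have "real work \<le> ?m + real (num_edges H + ?C * S)"
      by (metis of_nat_add of_nat_mono)
    ultimately have work_le: "real work \<le> U"
      by (simp add: U_def)
    have size: "total_size D \<le> ?C * S"
      using S by (simp add: algebra_simps)
    then have "\<tau> \<le> T (num_edges H) (?C * S) (accuracy c ?n)"
      unfolding \<tau>_def using T by (simp only: solver_time_def)
    then have \<tau>_le: "\<tau> \<le> U"
      by (simp add: U_def)
    have "real (num_edges H + total_size D) \<le> \<tau>"
      unfolding \<tau>_def using T by (simp only: solver_time_def)
    then have \<tau>_nonneg: "0 \<le> \<tau>"
      by (rule order_trans[OF of_nat_0_le_iff])
    have sqrt: "1 \<le> sqrt \<kappa>"
      using \<kappa>(1) by simp
    have U: "0 \<le> U"
      using work_le work_pos by linarith
    have time_le: "2000 * real work + l * (1000 * real work + \<tau>) \<le> real ?C * sqrt \<kappa> * U"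
      if "l \<le> 5 * sqrt \<kappa>" "0 \<le> l" for l
    proof -
      have "l * (1000 * real work + \<tau>) \<le> (5 * sqrt \<kappa>) * (1001 * U)"
        using that work_le \<tau>_le \<tau>_nonneg sqrt by (intro mult_mono) auto
      moreover have "1 * U \<le> sqrt \<kappa> * U"
        using sqrt U by (intro mult_right_mono)
      moreover have "7005 * (sqrt \<kappa> * U) \<le> real ?C * (sqrt \<kappa> * U)"
        using sqrt U by (intro mult_right_mono) auto
      ultimately show ?thesis
        using work_le by (simp only: mult.assoc) argo
    qed
    have acc: "accuracy c ?n = 1 + \<delta>"
      by (simp add: accuracy_def \<delta>_def)
    \<comment> \<open>Vacuously true outside the instances with n vertices, where the solver
      promises nothing at this accuracy and failure probability; thus the failure bound holds for
      every query. The queries actually made are instances on the same vertices.\<close>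
    define ok where "ok Q x \<longleftrightarrow> (diffusion_instance Q \<and> num_verts Q = ?n \<longrightarrow> approx_optimal (1 + \<delta>) Q x)"
      for Q x
    have fail: "measure_pmf.prob (solve Q) {x. \<not> ok Q x} \<le> 1 / real ?n ^ 10" for Q
    proof (cases "diffusion_instance Q \<and> num_verts Q = ?n")
      case True
      then have "1 - 1 / real ?n ^ 10 \<le> measure_pmf.prob (solve Q) {x. approx_optimal (1 + \<delta>) Q x}"
        using solve acc unfolding approx_solver_def by metis
      moreover have "{x. \<not> ok Q x} = UNIV - {x. approx_optimal (1 + \<delta>) Q x}"
        using True by (auto simp: ok_def)
      ultimately show ?thesis
        using measure_pmf.prob_compl[of "{x. approx_optimal (1 + \<delta>) Q x}" "solve Q"] by simp
    next
      case False
      then have "{x. \<not> ok Q x} = {}"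
        by (auto simp: ok_def)
      then show ?thesis
        by simp
    qed
    let ?bad = "{Some \<sigma>' | \<sigma>'. \<exists>(Q, x) \<in> set (calls \<sigma>'). \<not> ok Q x}"
    let ?good = "{Some \<sigma>' | \<sigma>'. approx_optimal 2 D (result \<sigma>')}"
    have "measure_pmf.prob run ?bad \<le> 1 / real ?n ^ 10 * (5 * sqrt \<kappa>)"
      unfolding run_def
    proof (rule prob_failed_call_le)
      show "calls \<sigma> = []"
        using input by (simp add: input_config_def)
      show "real (length (calls \<sigma>')) \<le> 5 * sqrt \<kappa>"
        if "Some \<sigma>' \<in> set_pmf (exec (call_time T c) solve ?K accelerated_solver \<sigma>)" for \<sigma>'
        using run[of "Some \<sigma>'"] that by (simp add: run_def)
    qed (use fail \<kappa>(1) in auto)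
    also have "\<dots> \<le> real ?C * sqrt \<kappa> / real ?n ^ 10"
      using sqrt by (auto intro!: divide_right_mono mult_right_mono)
    finally have "1 - real ?C * sqrt \<kappa> / real ?n ^ 10 \<le> 1 - measure_pmf.prob run ?bad"
      by simp
    also have "\<dots> = measure_pmf.prob run (UNIV - ?bad)"
      using measure_pmf.prob_compl[of ?bad run] by simp
    also have "\<dots> \<le> measure_pmf.prob run ?good"
    proof (rule measure_pmf.finite_measure_mono_AE, rule AE_pmfI, rule impI)
      fix r assume r: "r \<in> set_pmf run" "r \<in> UNIV - ?bad"
      obtain \<sigma>' where \<sigma>': "r = Some \<sigma>'" "\<forall>(Q, x) \<in> set (calls \<sigma>'). \<exists>y. Q = prox_query D H y"
        "(\<forall>(Q, x) \<in> set (calls \<sigma>'). approx_optimal (1 + \<delta>) Q x) \<longrightarrow> approx_optimal 2 D (result \<sigma>')"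
        using run[OF r(1)] by blast
      have "approx_optimal (1 + \<delta>) Q x" if "(Q, x) \<in> set (calls \<sigma>')" for Q x
      proof -
        have "ok Q x"
          using r(2) \<sigma>'(1) that by blast
        moreover have "\<exists>y. Q = prox_query D H y"
          using bspec[OF \<sigma>'(2) that] by simp
        then obtain y where "Q = prox_query D H y" ..
        ultimately show ?thesis
          using query_instance[of y] by (simp add: ok_def)
      qed
      then have "approx_optimal 2 D (result \<sigma>')"
        by (intro mp[OF \<sigma>'(3)]) auto
      then show "r \<in> ?good"
        using \<sigma>'(1) by auto
    qed simp
    finally have prob: "1 - real ?C * sqrt \<kappa> / real ?n ^ 10 \<le> measure_pmf.prob run ?good" .
    have none: "None \<notin> set_pmf run"
      using run[of None] by auto
    have post: "time \<sigma>' \<le> real ?C * sqrt \<kappa> * U \<and> real (length (calls \<sigma>')) \<le> real ?C * sqrt \<kappa> \<and>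
        (\<forall>(Q, x) \<in> set (calls \<sigma>'). diffusion_instance Q \<and> graph Q = H \<and> total_size Q \<le> ?C * S) \<and>
        ((\<forall>(Q, x) \<in> set (calls \<sigma>'). approx_optimal (accuracy c ?n) Q x) \<longrightarrow>
          approx_optimal 2 D (result \<sigma>'))" if r: "Some \<sigma>' \<in> set_pmf run" for \<sigma>'
    proof -
      have \<sigma>': "real (length (calls \<sigma>')) \<le> 5 * sqrt \<kappa>"
          "\<forall>(Q, x) \<in> set (calls \<sigma>'). \<exists>y. Q = prox_query D H y"
          "(\<forall>(Q, x) \<in> set (calls \<sigma>'). approx_optimal (1 + \<delta>) Q x) \<longrightarrow> approx_optimal 2 D (result \<sigma>')"
          "time \<sigma>' \<le> 2000 * real work + real (length (calls \<sigma>')) * (1000 * real work + \<tau>)"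
        using run[OF r] by simp_all
      have "5 * sqrt \<kappa> \<le> real ?C * sqrt \<kappa>"
        using sqrt by (intro mult_right_mono) auto
      moreover have "diffusion_instance Q \<and> graph Q = H \<and> total_size Q \<le> ?C * S"
        if "(Q, x) \<in> set (calls \<sigma>')" for Q x
      proof -
        have "\<exists>y. Q = prox_query D H y"
          using bspec[OF \<sigma>'(2) that] by simp
        then obtain y where "Q = prox_query D H y" ..
        then show ?thesis
          using query_instance[of y] size by simp
      qed
      ultimately show ?thesis
        using \<sigma>'(1,3) order_trans[OF \<sigma>'(4) time_le[OF \<sigma>'(1)]] unfolding acc by auto
    qed
    show "\<exists>k. let run = exec (call_time T c) solve k accelerated_solver \<sigma> in
        None \<notin> set_pmf run \<and>
        (\<forall>\<sigma>'. Some \<sigma>' \<in> set_pmf run \<longrightarrow>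
           time \<sigma>' \<le> real ?C * sqrt \<kappa> * (?m + T (num_edges H) (?C * S) (accuracy c ?n)) \<and>
           real (length (calls \<sigma>')) \<le> real ?C * sqrt \<kappa> \<and>
           (\<forall>(Q, x) \<in> set (calls \<sigma>').
              diffusion_instance Q \<and> graph Q = H \<and> total_size Q \<le> ?C * S) \<and>
           ((\<forall>(Q, x) \<in> set (calls \<sigma>'). approx_optimal (accuracy c ?n) Q x) \<longrightarrow>
              approx_optimal 2 D (result \<sigma>'))) \<and>
        measure_pmf.prob run ?good \<ge> 1 - real ?C * sqrt \<kappa> / real ?n ^ 10"
      unfolding Let_def
      by (rule exI[of _ ?K], fold run_def, rule conjI[OF none conjI[OF _ prob]], intro allI impI,
          rule post[unfolded U_def])
  qed
qed

end
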